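(* Let $\mathfrak{g}$ be the Kac-Moody algebra over $\mathbb{C}$ of type $C_l$ $(l\ge2)$. For any $\mathbf{a}=(a_1,\dots,a_l)\in(\mathbb{C}^* )^l$ and $S\subseteq\{1,\dots,l\}$, the space $M(\mathbf{a},S)=\mathbb{C}[H_1,\dots,H_l]$ becomes a $\mathfrak{g}$-module under the action $$H_i\cdot g=H_ig,\qquad e_i\cdot g=E_i\,\sigma_i(g),\qquad f_i\cdot g=F_i\,\sigma_i^{-1}(g)\qquad(1\le i\le l),$$ for all $g\in\mathbb{C}[H_1,\dots,H_l]$, where, with $H_0:=0$: For $1\le k\le l-2$, $$(E_k,F_k)=\begin{cases}\left(a_k(H_{k+1}-H_k+\tfrac12),\ a_k^{-1}(H_k-H_{k-1}+\tfrac12)\right), & k,k+1\in S,\\ \left(a_k,\ a_k^{-1}(H_k-H_{k-1}+\tfrac12)(H_{k+1}-H_k-\tfrac12)\right), & k\in S,\ k+1\notin S,\\ \left(a_k(H_k-H_{k-1}-\tfrac12)(H_{k+1}-H_k+\tfrac12),\ a_k^{-1}\right), & k\notin S,\ k+1\in S,\\ \left(a_k(H_k-H_{k-1}-\tfrac12),\ a_k^{-1}(H_{k+1}-H_k-\tfrac12)\right), & k,k+1\notin S;\end{cases}$$ $$(E_{l-1},F_{l-1})=\begin{cases}\left(a_{l-1}(2H_l-H_{l-1}+\tfrac12),\ a_{l-1}^{-1}(H_{l-1}-H_{l-2}+\tfrac12)\right), & l-1,l\in S,\\ \left(a_{l-1},\ a_{l-1}^{-1}(H_{l-1}-H_{l-2}+\tfrac12)(2H_l-H_{l-1}-\tfrac12)\right),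 & l-1\in S,\ l\notin S,\\ \left(a_{l-1}(H_{l-1}-H_{l-2}-\tfrac12)(2H_l-H_{l-1}+\tfrac12),\ a_{l-1}^{-1}\right), & l-1\notin S,\ l\in S,\\ \left(a_{l-1}(H_{l-1}-H_{l-2}-\tfrac12),\ a_{l-1}^{-1}(2H_l-H_{l-1}-\tfrac12)\right), & l-1,l\notin S;\end{cases}$$ $$(E_l,F_l)=\begin{cases}\left(a_l,\ -a_l^{-1}(H_l-\tfrac12H_{l-1}+\tfrac34)(H_l-\tfrac12H_{l-1}+\tfrac14)\right), & l\in S,\\ \left(-a_l(H_l-\tfrac12H_{l-1}-\tfrac34)(H_l-\tfrac12H_{l-1}-\tfrac14),\ a_l^{-1}\right), & l\notin S.\end{cases}$$ Furthermore, $\mathcal{H}(\mathfrak{g})=\{M(\mathbf{a},S)\mid \mathbf{a}\in(\mathbb{C}^* )^l,\ S\subseteq\{1,\dots,l\}\}$. Moreover, the module $M(\mathbf{a},S)$ is simple for any $\mathbf{a}$ and $S$.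
   Context: $\mathfrak{g}$ of type $C_l$ is the simple Lie algebra $\mathfrak{sp}_{2l}(\mathbb{C})$ with Chevalley generators $e_i,f_i,\alpha_i^\vee$ ($1\le i\le l$), $[e_i,f_j]=\delta_{ij}\alpha_i^\vee$, $[\alpha_i^\vee,e_j]=a_{ij}e_j$, $[\alpha_i^\vee,f_j]=-a_{ij}f_j$, where the Cartan matrix $A=(a_{ij})$ has $a_{ii}=2$, $a_{i,i+1}=a_{i+1,i}=-1$ for $1\le i\le l-2$, $a_{l-1,l}=-2$, $a_{l,l-1}=-1$, and all other entries $0$. The Cartan subalgebra $\mathfrak{h}$ has basis $(H_1,\dots,H_l)^T=A^{-1}(\alpha_1^\vee,\dots,\alpha_l^\vee)^T$, so $[H_i,e_j]=\delta_{ij}e_j$, $[H_i,f_j]=-\delta_{ij}f_j$, and $U(\mathfrak{h})=\mathbb{C}[H_1,\dots,H_l]$. $\sigma_i$ is the algebra automorphism of $\mathbb{C}[H_1,\dots,H_l]$ with $\sigma_i(H_j)=H_j-\delta_{ij}$. $\mathcal{H}(\mathfrak{g})$ is the full subcategory of $\mathfrak{g}$-modules whose restriction to $U(\mathfrak{h})$ is free of rank $1$. Via a free generator each object is identified with $U(\mathfrak{h})$ with $\mathfrak{h}$ acting by multiplication; the equality $\mathcal{H}(\mathfrak{g})=\{\dots\}$ means that each listed module lies in $\mathcal{H}(\mathfrak{g})$ and every object of $\mathcal{H}(\mathfrak{g})$ is isomorphic to a listed one. *)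

theory Defs
  imports "HOL-Library.Poly_Mapping" "Jordan_Normal_Form.Matrix"
begin

section \<open>The symplectic Lie algebra and its Chevalley generators\<close>

text \<open>Matrix rows and columns are numbered from \<open>0\<close>, Dynkin nodes from \<open>1\<close> to \<open>l\<close>; node \<open>l\<close>
  carries the long root.\<close>

definition sympl_form :: "nat \<Rightarrow> complex mat" where
  "sympl_form l = mat (2*l) (2*l) (\<lambda>(r, s). if s = r + l then 1 else if r = s + l then -1 else 0)"

definition sp :: "nat \<Rightarrow> complex mat set" where
  "sp l = {X \<in> carrier_mat (2*l) (2*l).
             transpose_mat X * sympl_form l + sympl_form l * X = 0\<^sub>m (2*l) (2*l)}"

definition lie_bracket :: "complex mat \<Rightarrow> complex mat \<Rightarrow> complex mat" where
  "lie_bracket X Y = X * Y - Y * X"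

definition elem_mat :: "nat \<Rightarrow> nat \<Rightarrow> nat \<Rightarrow> complex mat" where
  "elem_mat l r s = mat (2*l) (2*l) (\<lambda>(i, j). if i = r \<and> j = s then 1 else 0)"

definition sp_diag :: "nat \<Rightarrow> (nat \<Rightarrow> complex) \<Rightarrow> complex mat" where
  "sp_diag l d = mat (2*l) (2*l)
     (\<lambda>(r, s). if r = s then (if r < l then d r else - d (r - l)) else 0)"

definition chev_e :: "nat \<Rightarrow> nat \<Rightarrow> complex mat" where
  "chev_e l i = (if i = l then elem_mat l (l - 1) (2*l - 1)
                 else elem_mat l (i - 1) i - elem_mat l (l + i) (l + i - 1))"

definition chev_f :: "nat \<Rightarrow> nat \<Rightarrow> complex mat" where
  "chev_f l i = (if i = l then elem_mat l (2*l - 1) (l - 1)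
                 else elem_mat l i (i - 1) - elem_mat l (l + i - 1) (l + i))"

text \<open>For \<open>i = l\<close> the second summand below vanishes on all positions \<open>j < l\<close>.\<close>

definition coroot :: "nat \<Rightarrow> nat \<Rightarrow> complex mat" where
  "coroot l i = sp_diag l (\<lambda>j. of_bool (Suc j = i) - of_bool (j = i))"

definition cartan :: "nat \<Rightarrow> nat \<Rightarrow> nat \<Rightarrow> complex" where
  "cartan l i j =
     (if i = j then 2
      else if i = l - 1 \<and> j = l then -2
      else if j = Suc i \<or> i = Suc j then -1
      else 0)"

text \<open>The elements \<open>H\<^sub>i\<close>. The lemma \<open>coroot_eq_cartan_coweight\<close> says that
  \<open>(\<alpha>\<^sub>1\<^sup>\<or>, \<dots>, \<alpha>\<^sub>l\<^sup>\<or>)\<^sup>T = A (H\<^sub>1, \<dots>, H\<^sub>l)\<^sup>T\<close>, so these are the components of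
  \<open>A\<^sup>-\<^sup>1 (\<alpha>\<^sub>1\<^sup>\<or>, \<dots>, \<alpha>\<^sub>l\<^sup>\<or>)\<^sup>T\<close>.\<close>

definition coweight :: "nat \<Rightarrow> nat \<Rightarrow> complex mat" where
  "coweight l i = sp_diag l (\<lambda>j. if i = l then 1/2 else of_bool (j < i))"

lemma elem_mat_carrier [simp, intro]: "elem_mat l r s \<in> carrier_mat (2*l) (2*l)"
  by (simp add: elem_mat_def)

lemma sp_diag_carrier [simp, intro]: "sp_diag l d \<in> carrier_mat (2*l) (2*l)"
  by (simp add: sp_diag_def)

lemma dim_elem_mat [simp]: "dim_row (elem_mat l r s) = 2*l" "dim_col (elem_mat l r s) = 2*l"
  by (simp_all add: elem_mat_def)

lemma dim_sp_diag [simp]: "dim_row (sp_diag l d) = 2*l" "dim_col (sp_diag l d) = 2*l"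
  by (simp_all add: sp_diag_def)

lemma elem_mat_mult:
  assumes "s < 2*l" "t < 2*l"
  shows "elem_mat l r s * elem_mat l t u = (if s = t then elem_mat l r u else 0\<^sub>m (2*l) (2*l))"
proof (rule eq_matI)
  fix i j assume "i < dim_row (if s = t then elem_mat l r u else 0\<^sub>m (2*l) (2*l))"
    "j < dim_col (if s = t then elem_mat l r u else 0\<^sub>m (2*l) (2*l))"
  hence ij: "i < 2*l" "j < 2*l" by (auto split: if_splits)
  have "(elem_mat l r s * elem_mat l t u) $$ (i, j)
      = (\<Sum>k = 0..<2*l. (if i = r \<and> k = s then 1 else 0) * (if k = t \<and> j = u then 1 else 0))"
    using ij by (simp add: elem_mat_def scalar_prod_def)
  also have "\<dots> = (\<Sum>k = 0..<2*l. if k = s then (if i = r \<and> s = t \<and> j = u then 1 else 0) else 0)"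
    by (rule sum.cong) auto
  also have "\<dots> = (if i = r \<and> s = t \<and> j = u then 1 else 0)"
    using assms by simp
  finally show "(elem_mat l r s * elem_mat l t u) $$ (i, j)
      = (if s = t then elem_mat l r u else 0\<^sub>m (2*l) (2*l)) $$ (i, j)"
    using ij by (simp add: elem_mat_def)
qed auto

lemma sp_diag_mult_left:
  assumes "X \<in> carrier_mat (2*l) (2*l)" "i < 2*l" "j < 2*l"
  shows "(sp_diag l d * X) $$ (i, j) = (if i < l then d i else - d (i - l)) * X $$ (i, j)"
proof -
  have "(sp_diag l d * X) $$ (i, j)
      = (\<Sum>k = 0..<2*l. (if i = k then (if i < l then d i else - d (i - l)) else 0) * X $$ (k, j))"
    using assms by (auto simp: sp_diag_def scalar_prod_def intro!: sum.cong)
  also have "\<dots> = (\<Sum>k = 0..<2*l. if k = i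
      then (if i < l then d i else - d (i - l)) * X $$ (i, j) else 0)"
    by (rule sum.cong) auto
  also have "\<dots> = (if i < l then d i else - d (i - l)) * X $$ (i, j)"
    using assms by simp
  finally show ?thesis .
qed

lemma sp_diag_mult_right:
  assumes "X \<in> carrier_mat (2*l) (2*l)" "i < 2*l" "j < 2*l"
  shows "(X * sp_diag l d) $$ (i, j) = (if j < l then d j else - d (j - l)) * X $$ (i, j)"
proof -
  have "(X * sp_diag l d) $$ (i, j)
      = (\<Sum>k = 0..<2*l. X $$ (i, k) * (if k = j then (if k < l then d k else - d (k - l)) else 0))"
    using assms by (auto simp: sp_diag_def scalar_prod_def intro!: sum.cong)
  also have "\<dots> = (\<Sum>k = 0..<2*l. if k = j
      then (if j < l then d j else - d (j - l)) * X $$ (i, j) else 0)"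
    by (rule sum.cong) auto
  also have "\<dots> = (if j < l then d j else - d (j - l)) * X $$ (i, j)"
    using assms by simp
  finally show ?thesis .
qed

lemma bracket_diag_index:
  assumes "X \<in> carrier_mat (2*l) (2*l)" "i < 2*l" "j < 2*l"
  shows "lie_bracket (sp_diag l d) X $$ (i, j)
    = ((if i < l then d i else - d (i - l)) - (if j < l then d j else - d (j - l))) * X $$ (i, j)"
proof -
  have "X * sp_diag l d \<in> carrier_mat (2*l) (2*l)"
    using assms by auto
  then show ?thesis
    using assms sp_diag_mult_left[OF assms] sp_diag_mult_right[OF assms]
    by (simp add: lie_bracket_def left_diff_distrib)
qed

lemma chev_carrier [simp, intro]:
  "chev_e l i \<in> carrier_mat (2*l) (2*l)" "chev_f l i \<in> carrier_mat (2*l) (2*l)"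
  by (auto simp: chev_e_def chev_f_def)

lemma dim_chev [simp]:
  "dim_row (chev_e l i) = 2*l" "dim_col (chev_e l i) = 2*l"
  "dim_row (chev_f l i) = 2*l" "dim_col (chev_f l i) = 2*l"
  by (simp_all add: chev_e_def chev_f_def)

lemma elem_mat_index:
  "r < 2*l \<Longrightarrow> s < 2*l \<Longrightarrow> elem_mat l p q $$ (r, s) = of_bool (r = p \<and> s = q)"
  by (simp add: elem_mat_def)

lemma chev_e_index:
  assumes "r < 2*l" "s < 2*l"
  shows "chev_e l i $$ (r, s) =
    (if i = l then of_bool (r = l - 1 \<and> s = 2*l - 1)
     else of_bool (r = i - 1 \<and> s = i) - of_bool (r = l + i \<and> s = l + i - 1))"
  using assms
  by (cases "i = l") (simp_all only: chev_e_def if_True if_False simp_thms elem_mat_index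
      index_minus_mat dim_elem_mat)

lemma chev_f_index:
  assumes "r < 2*l" "s < 2*l"
  shows "chev_f l i $$ (r, s) =
    (if i = l then of_bool (r = 2*l - 1 \<and> s = l - 1)
     else of_bool (r = i \<and> s = i - 1) - of_bool (r = l + i - 1 \<and> s = l + i))"
  using assms
  by (cases "i = l") (simp_all only: chev_f_def if_True if_False simp_thms elem_mat_index
      index_minus_mat dim_elem_mat)

lemma bracket_dim:
  assumes "X \<in> carrier_mat (2*l) (2*l)" "Y \<in> carrier_mat (2*l) (2*l)"
  shows "dim_row (lie_bracket X Y) = 2*l" "dim_col (lie_bracket X Y) = 2*l"
  using assms by (auto simp: lie_bracket_def)

lemma diag_bracket_e:
  assumes "j \<in> {1..l}"
  shows "lie_bracket (sp_diag l d) (chev_e l j)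
    = (if j = l then 2 * d (l - 1) else d (j - 1) - d j) \<cdot>\<^sub>m chev_e l j" (is "_ = ?c \<cdot>\<^sub>m _")
proof (rule eq_matI)
  fix r s assume "r < dim_row (?c \<cdot>\<^sub>m chev_e l j)" and "s < dim_col (?c \<cdot>\<^sub>m chev_e l j)"
  hence rs: "r < 2*l" "s < 2*l" by simp_all
  have "((if r < l then d r else - d (r - l)) - (if s < l then d s else - d (s - l))) * chev_e l j $$ (r, s)
      = ?c * chev_e l j $$ (r, s)"
  proof (cases "chev_e l j $$ (r, s) = 0")
    case False
    then consider "j = l" "r = l - 1" "s = 2*l - 1"
      | "j \<noteq> l" "r = j - 1" "s = j" | "j \<noteq> l" "r = l + j" "s = l + j - 1"
      using rs by (simp add: chev_e_index of_bool_def split: if_splits)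
    then have "(if r < l then d r else - d (r - l)) - (if s < l then d s else - d (s - l)) = ?c"
    proof cases
      case 1
      moreover have "2*l - 1 - l = l - 1" by simp
      ultimately show ?thesis using assms by simp
    next
      case 2
      then have "j - 1 < l" "j < l" using assms by auto
      with 2 show ?thesis by simp
    next
      case 3
      moreover have "l + j - 1 - l = j - 1" "\<not> l + j - 1 < l" using assms by auto
      ultimately show ?thesis using assms by simp
    qed
    then show ?thesis by (rule arg_cong)
  qed simp
  then show "lie_bracket (sp_diag l d) (chev_e l j) $$ (r, s) = (?c \<cdot>\<^sub>m chev_e l j) $$ (r, s)"
    using rs by (simp only: bracket_diag_index chev_carrier) simp
qed (simp_all add: bracket_dim[OF sp_diag_carrier chev_carrier(1)])

lemma diag_bracket_f:
  assumes "j \<in> {1..l}"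
  shows "lie_bracket (sp_diag l d) (chev_f l j)
    = (- (if j = l then 2 * d (l - 1) else d (j - 1) - d j)) \<cdot>\<^sub>m chev_f l j" (is "_ = ?c \<cdot>\<^sub>m _")
proof (rule eq_matI)
  fix r s assume "r < dim_row (?c \<cdot>\<^sub>m chev_f l j)" and "s < dim_col (?c \<cdot>\<^sub>m chev_f l j)"
  hence rs: "r < 2*l" "s < 2*l" by simp_all
  have "((if r < l then d r else - d (r - l)) - (if s < l then d s else - d (s - l))) * chev_f l j $$ (r, s)
      = ?c * chev_f l j $$ (r, s)"
  proof (cases "chev_f l j $$ (r, s) = 0")
    case False
    then consider "j = l" "r = 2*l - 1" "s = l - 1"
      | "j \<noteq> l" "r = j" "s = j - 1" | "j \<noteq> l" "r = l + j - 1" "s = l + j"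
      using rs by (simp add: chev_f_index of_bool_def split: if_splits)
    then have "(if r < l then d r else - d (r - l)) - (if s < l then d s else - d (s - l)) = ?c"
    proof cases
      case 1
      moreover have "2*l - 1 - l = l - 1" by simp
      ultimately show ?thesis using assms by simp
    next
      case 2
      then have "j - 1 < l" "j < l" using assms by auto
      with 2 show ?thesis by simp
    next
      case 3
      moreover have "l + j - 1 - l = j - 1" "\<not> l + j - 1 < l" using assms by auto
      ultimately show ?thesis using assms by simp
    qed
    then show ?thesis by (rule arg_cong)
  qed simp
  then show "lie_bracket (sp_diag l d) (chev_f l j) $$ (r, s) = (?c \<cdot>\<^sub>m chev_f l j) $$ (r, s)"
    using rs by (simp only: bracket_diag_index chev_carrier) simp
qed (simp_all add: bracket_dim[OF sp_diag_carrier chev_carrier(2)])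

lemma coroot_bracket_e:
  assumes "i \<in> {1..l}" "j \<in> {1..l}"
  shows "lie_bracket (coroot l i) (chev_e l j) = cartan l i j \<cdot>\<^sub>m chev_e l j"
proof -
  obtain i' j' l' where "i = Suc i'" "j = Suc j'" "l = Suc l'"
    using assms by (metis atLeastAtMost_iff not0_implies_Suc not_one_le_zero order_trans)
  then show ?thesis
    unfolding coroot_def diag_bracket_e[OF assms(2)] cartan_def
    using assms by (intro arg_cong[where f = "\<lambda>c. c \<cdot>\<^sub>m _"]) (simp add: of_bool_def)
qed

lemma coroot_bracket_f:
  assumes "i \<in> {1..l}" "j \<in> {1..l}"
  shows "lie_bracket (coroot l i) (chev_f l j) = (- cartan l i j) \<cdot>\<^sub>m chev_f l j"
proof -
  obtain i' j' l' where "i = Suc i'" "j = Suc j'" "l = Suc l'"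
    using assms by (metis atLeastAtMost_iff not0_implies_Suc not_one_le_zero order_trans)
  then show ?thesis
    unfolding coroot_def diag_bracket_f[OF assms(2)] cartan_def
    using assms by (intro arg_cong[where f = "\<lambda>c. c \<cdot>\<^sub>m _"]) (simp add: of_bool_def)
qed

lemma coweight_bracket_e:
  assumes "i \<in> {1..l}" "j \<in> {1..l}"
  shows "lie_bracket (coweight l i) (chev_e l j) = of_bool (i = j) \<cdot>\<^sub>m chev_e l j"
proof -
  obtain i' j' l' where "i = Suc i'" "j = Suc j'" "l = Suc l'"
    using assms by (metis atLeastAtMost_iff not0_implies_Suc not_one_le_zero order_trans)
  then show ?thesis
    unfolding coweight_def diag_bracket_e[OF assms(2)] cartan_def
    using assms by (intro arg_cong[where f = "\<lambda>c. c \<cdot>\<^sub>m _"]) (simp add: of_bool_def)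
qed

lemma coweight_bracket_f:
  assumes "i \<in> {1..l}" "j \<in> {1..l}"
  shows "lie_bracket (coweight l i) (chev_f l j) = (- of_bool (i = j)) \<cdot>\<^sub>m chev_f l j"
proof -
  obtain i' j' l' where "i = Suc i'" "j = Suc j'" "l = Suc l'"
    using assms by (metis atLeastAtMost_iff not0_implies_Suc not_one_le_zero order_trans)
  then show ?thesis
    unfolding coweight_def diag_bracket_f[OF assms(2)] cartan_def
    using assms by (intro arg_cong[where f = "\<lambda>c. c \<cdot>\<^sub>m _"]) (simp add: of_bool_def)
qed

lemma chev_e_bracket_f:
  assumes "i \<in> {1..l}" "j \<in> {1..l}"
  shows "lie_bracket (chev_e l i) (chev_f l j) = (if i = j then coroot l i else 0\<^sub>m (2*l) (2*l))"
proof -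
  obtain i' j' l' where ijl: "i = Suc i'" "j = Suc j'" "l = Suc l'"
    using assms by (metis atLeastAtMost_iff not0_implies_Suc not_one_le_zero order_trans)
  have le: "i' \<le> l'" "j' \<le> l'" using assms ijl by simp_all
  have e: "chev_e l i = (if i' = l' then elem_mat l l' (Suc (l' + l'))
      else elem_mat l i' (Suc i') - elem_mat l (Suc (Suc (l' + i'))) (Suc (l' + i')))"
    and f: "chev_f l j = (if j' = l' then elem_mat l (Suc (l' + l')) l'
      else elem_mat l (Suc j') j' - elem_mat l (Suc (l' + j')) (Suc (Suc (l' + j'))))"
    by (simp_all add: ijl chev_e_def chev_f_def mult_2)
  have m: "elem_mat l r s * elem_mat l t u = (if s = t then elem_mat l r u else 0\<^sub>m (2*l) (2*l))"
    if "s < Suc (Suc (l' + l'))" "t < Suc (Suc (l' + l'))" for r s t u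
    using that by (intro elem_mat_mult) (simp_all add: ijl)
  have z: "0\<^sub>m (2*l) (2*l) - 0\<^sub>m (2*l) (2*l) = (0\<^sub>m (2*l) (2*l) :: complex mat)"
    by auto
  note ex = lie_bracket_def mult_minus_distrib_mat[of _ "2*l" "2*l" _ "2*l"]
    minus_mult_distrib_mat[of _ "2*l" "2*l" _ _ "2*l"] m
  consider "i' = l'" "j' = l'" | "i' = l'" "j' < l'" | "i' < l'" "j' = l'" | "i' < l'" "j' < l'"
    using le by linarith
  then show ?thesis
  proof cases
    case 1
    then show ?thesis
      unfolding e f
      by (simp add: ex) (intro impI conjI eq_matI; auto simp: ijl coroot_def elem_mat_index sp_diag_def)
  next
    case 2
    then show ?thesis
      unfolding e f by (simp add: ex ijl(1,2) z)
  next
    case 3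
    then show ?thesis
      unfolding e f by (simp add: ex ijl(1,2) z)
  next
    case 4
    have "lie_bracket (elem_mat l p q - elem_mat l p' q') (elem_mat l t u - elem_mat l t' u')
        = (elem_mat l p q * elem_mat l t u - elem_mat l p' q' * elem_mat l t u)
          - (elem_mat l p q * elem_mat l t' u' - elem_mat l p' q' * elem_mat l t' u')
          - ((elem_mat l t u * elem_mat l p q - elem_mat l t' u' * elem_mat l p q)
          - (elem_mat l t u * elem_mat l p' q' - elem_mat l t' u' * elem_mat l p' q'))"
      for p q p' q' t u t' u'
      unfolding lie_bracket_def
      by (simp add: mult_minus_distrib_mat[of _ "2*l" "2*l" _ "2*l"] minus_carrier_mat
          minus_mult_distrib_mat[of _ "2*l" "2*l" _ _ "2*l"])
    with 4 show ?thesis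
      unfolding e f
      by (simp add: m z) (intro impI conjI eq_matI; auto simp: ijl coroot_def elem_mat_index sp_diag_def)
  qed
qed

lemma coroot_eq_cartan_coweight:
  assumes "2 \<le> l" "i \<in> {1..l}" "r < 2*l" "s < 2*l"
  shows "coroot l i $$ (r, s) = (\<Sum>j = 1..l. cartan l i j * coweight l j $$ (r, s))"
proof -
  define D where "D = (\<lambda>j k. if j = l then 1/2 else of_bool (k < j) :: complex)"
  have cl: "(\<Sum>j = 1..l. cartan l i j * D j k) = of_bool (Suc k = i) - of_bool (k = i)"
    if "k < l" for k
  proof -
    have "(\<Sum>j = 1..l. cartan l i j * D j k)
        = (\<Sum>j = 1..l. (if j = i then 2 * D i k else 0) + (if j = Suc i then cartan l i j * D j k else 0)
            + (if j = i - 1 then cartan l i j * D j k else 0))"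
      using assms by (intro sum.cong) (auto simp: cartan_def)
    also have "\<dots> = 2 * D i k + (if i < l then cartan l i (Suc i) * D (Suc i) k else 0)
            + (if 1 < i then cartan l i (i - 1) * D (i - 1) k else 0)"
      using assms by (auto simp: sum.distrib)
    also have "\<dots> = of_bool (Suc k = i) - of_bool (k = i)"
    proof -
      have c1: "cartan l i (Suc i) = (if Suc i = l then -2 else -1)" if "i < l"
        using that by (simp add: cartan_def) linarith
      obtain i' where i': "i = Suc i'" using assms by (cases i) auto
      have c2: "cartan l i i' = -1" if "0 < i'"
        using that assms i' by (simp add: cartan_def)
      have "i' < l" using assms i' by simp
      consider "k < i'" | "k = i'" | "k = Suc i'" | "Suc i' < k" by linarith
      then show ?thesis
        using \<open>k < l\<close> \<open>i' < l\<close> c1 c2 unfolding i' by cases (auto simp: D_def)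
    qed
    finally show ?thesis .
  qed
  show ?thesis
    using cl[of r] cl[of "r - l"] assms
    by (auto simp: coroot_def coweight_def sp_diag_def D_def sum_negf)
qed

lemma sp_iff:
  "X \<in> sp l \<longleftrightarrow> X \<in> carrier_mat (2*l) (2*l) \<and>
     (\<forall>r < l. \<forall>s < l. X $$ (l + r, l + s) = - X $$ (s, r)
        \<and> X $$ (r, l + s) = X $$ (s, l + r) \<and> X $$ (l + r, s) = X $$ (l + s, r))"
proof (cases "X \<in> carrier_mat (2*l) (2*l)")
  case True
  have X: "dim_row X = 2*l" "dim_col X = 2*l" using True by auto
  define Y where "Y = transpose_mat X * sympl_form l + sympl_form l * X"
  have Y: "Y $$ (r, s) = (if s < l then - X $$ (s + l, r) else X $$ (s - l, r))
       + (if r < l then X $$ (r + l, s) else - X $$ (r - l, s))"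
    if rs: "r < 2*l" "s < 2*l" for r s
  proof -
    have "(\<Sum>k = 0..<2*l. X $$ (k, r) * (if s = k + l then 1 else if k = s + l then -1 else 0))
       = (\<Sum>k = 0..<2*l. if k = (if s < l then s + l else s - l) then
             (if s < l then - X $$ (s + l, r) else X $$ (s - l, r)) else 0)"
      using rs by (intro sum.cong) auto
    also have "\<dots> = (if s < l then - X $$ (s + l, r) else X $$ (s - l, r))"
      using rs by (subst sum.delta) auto
    finally have 1: "(\<Sum>k = 0..<2*l. X $$ (k, r) * (if s = k + l then 1 else if k = s + l then -1 else 0))
       = (if s < l then - X $$ (s + l, r) else X $$ (s - l, r))" .
    have "(\<Sum>k = 0..<2*l. (if k = r + l then 1 else if r = k + l then -1 else 0) * X $$ (k, s))
       = (\<Sum>k = 0..<2*l. if k = (if r < l then r + l else r - l) then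
             (if r < l then X $$ (r + l, s) else - X $$ (r - l, s)) else 0)"
      using rs by (intro sum.cong) auto
    also have "\<dots> = (if r < l then X $$ (r + l, s) else - X $$ (r - l, s))"
      using rs by (subst sum.delta) auto
    finally have 2: "(\<Sum>k = 0..<2*l. (if k = r + l then 1 else if r = k + l then -1 else 0) * X $$ (k, s))
       = (if r < l then X $$ (r + l, s) else - X $$ (r - l, s))" .
    show ?thesis
      unfolding 1[symmetric] 2[symmetric]
      using rs X by (simp add: Y_def sympl_form_def scalar_prod_def)
  qed
  have dim: "dim_row Y = 2*l" "dim_col Y = 2*l" "dim_row (sympl_form l) = 2*l"
    using X by (auto simp: Y_def sympl_form_def)
  have eq: "X \<in> sp l \<longleftrightarrow> (\<forall>r < 2*l. \<forall>s < 2*l. Y $$ (r, s) = 0)"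
    using True dim by (simp add: sp_def mat_eq_iff Y_def[symmetric])
  show ?thesis
  proof
    assume "X \<in> sp l"
    hence Z: "Y $$ (r, s) = 0" if "r < 2*l" "s < 2*l" for r s using eq that by blast
    have "X $$ (l + r, l + s) = - X $$ (s, r) \<and> X $$ (r, l + s) = X $$ (s, l + r)
        \<and> X $$ (l + r, s) = X $$ (l + s, r)" if "r < l" "s < l" for r s
      using Z[of r "l + s"] Z[of "l + r" "l + s"] Z[of r s] that
      by (auto simp: Y add.commute add_eq_0_iff)
    then show "X \<in> carrier_mat (2*l) (2*l) \<and>
     (\<forall>r < l. \<forall>s < l. X $$ (l + r, l + s) = - X $$ (s, r)
        \<and> X $$ (r, l + s) = X $$ (s, l + r) \<and> X $$ (l + r, s) = X $$ (l + s, r))"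
      using True by blast
  next
    assume R: "X \<in> carrier_mat (2*l) (2*l) \<and>
     (\<forall>r < l. \<forall>s < l. X $$ (l + r, l + s) = - X $$ (s, r)
        \<and> X $$ (r, l + s) = X $$ (s, l + r) \<and> X $$ (l + r, s) = X $$ (l + s, r))"
    have "Y $$ (r, s) = 0" if rs: "r < 2*l" "s < 2*l" for r s
    proof (cases "r < l"; cases "s < l")
      assume "r < l" "s < l"
      then show ?thesis using R rs by (simp add: Y add.commute[of _ l])
    next
      assume a: "r < l" "\<not> s < l"
      then obtain t where "s = l + t" by (metis le_Suc_ex not_less)
      then show ?thesis using R rs a by (simp add: Y add.commute[of _ l])
    next
      assume a: "\<not> r < l" "s < l"
      then obtain t where "r = l + t" by (metis le_Suc_ex not_less)
      then show ?thesis using R rs a by (simp add: Y add.commute[of _ l])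
    next
      assume a: "\<not> r < l" "\<not> s < l"
      then obtain t u where "r = l + t" "s = l + u" by (metis le_Suc_ex not_less)
      then show ?thesis using R rs a by (simp add: Y)
    qed
    then show "X \<in> sp l" using eq by blast
  qed
qed (auto simp: sp_def)

lemma generators_in_sp:
  assumes "i \<in> {1..l}"
  shows "chev_e l i \<in> sp l" "chev_f l i \<in> sp l" "coroot l i \<in> sp l" "coweight l i \<in> sp l"
proof -
  obtain i' where i': "i = Suc i'"
    using assms by (cases i) auto
  have e: "chev_e l i $$ (r, s) = (if Suc i' = l then of_bool (r = i' \<and> s = l + i')
      else of_bool (r = i' \<and> s = Suc i') - of_bool (r = l + Suc i' \<and> s = l + i'))"
    if "r < 2*l" "s < 2*l" for r s
    using that by (auto simp: chev_e_index i' mult_2)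
  have f: "chev_f l i $$ (r, s) = (if Suc i' = l then of_bool (r = l + i' \<and> s = i')
      else of_bool (r = Suc i' \<and> s = i') - of_bool (r = l + i' \<and> s = l + Suc i'))"
    if "r < 2*l" "s < 2*l" for r s
    using that by (auto simp: chev_f_index i' mult_2)
  have "i' < l" using assms i' by simp
  then show "chev_e l i \<in> sp l" "chev_f l i \<in> sp l"
    unfolding sp_iff by (auto simp: e f of_bool_def)
  show "coroot l i \<in> sp l" "coweight l i \<in> sp l"
    unfolding sp_iff by (auto simp: coroot_def coweight_def sp_diag_def)
qed


section \<open>The polynomial ring\<close>

text \<open>Polynomials over \<open>\<complex>\<close> in variables numbered by natural numbers; \<open>\<complex>[H\<^sub>1, \<dots>, H\<^sub>l]\<close> is the
  subring of those involving only the variables \<open>1, \<dots>, l\<close>.\<close>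

type_synonym cpoly = "(nat \<Rightarrow>\<^sub>0 nat) \<Rightarrow>\<^sub>0 complex"

definition polys :: "nat \<Rightarrow> cpoly set" where
  "polys l = {p. \<forall>m \<in> Poly_Mapping.keys p. Poly_Mapping.keys m \<subseteq> {1..l}}"

definition cst :: "complex \<Rightarrow> cpoly" where
  "cst c = Poly_Mapping.single 0 c"

definition var :: "nat \<Rightarrow> cpoly" where
  "var i = Poly_Mapping.single (Poly_Mapping.single i 1) 1"

definition poly_scale :: "complex \<Rightarrow> cpoly \<Rightarrow> cpoly" where
  "poly_scale c p = cst c * p"

definition poly_subst :: "(nat \<Rightarrow> cpoly) \<Rightarrow> cpoly \<Rightarrow> cpoly" where
  "poly_subst \<theta> p = (\<Sum>m \<in> Poly_Mapping.keys p.
     cst (Poly_Mapping.lookup p m) * (\<Prod>i \<in> Poly_Mapping.keys m. \<theta> i ^ Poly_Mapping.lookup m i))"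

definition sigma :: "nat \<Rightarrow> cpoly \<Rightarrow> cpoly" where
  "sigma i = poly_subst (\<lambda>j. var j - of_bool (i = j))"


section \<open>Modules and the category \<open>\<H>(\<gg>)\<close>\<close>

text \<open>A module is a complex vector space \<open>V\<close>, given as a subspace of the ambient space
  \<open>'v\<close> with scalar multiplication \<open>scale\<close>, with a bilinear action \<open>\<rho>\<close> on it. Values of \<open>\<rho>\<close> outside
  \<open>sp l\<close> and \<open>V\<close> are irrelevant.\<close>

definition sp_module ::
  "nat \<Rightarrow> (complex \<Rightarrow> 'v :: ab_group_add \<Rightarrow> 'v) \<Rightarrow> 'v set \<Rightarrow> (complex mat \<Rightarrow> 'v \<Rightarrow> 'v) \<Rightarrow> bool" where
  "sp_module l scale V \<rho> \<longleftrightarrow>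
     vector_space scale \<and> module.subspace scale V \<and>
     (\<forall>x \<in> sp l. \<forall>v \<in> V. \<rho> x v \<in> V) \<and>
     (\<forall>x \<in> sp l. \<forall>v \<in> V. \<forall>w \<in> V. \<rho> x (v + w) = \<rho> x v + \<rho> x w) \<and>
     (\<forall>x \<in> sp l. \<forall>c. \<forall>v \<in> V. \<rho> x (scale c v) = scale c (\<rho> x v)) \<and>
     (\<forall>x \<in> sp l. \<forall>y \<in> sp l. \<forall>v \<in> V. \<rho> (x + y) v = \<rho> x v + \<rho> y v) \<and>
     (\<forall>x \<in> sp l. \<forall>c. \<forall>v \<in> V. \<rho> (c \<cdot>\<^sub>m x) v = scale c (\<rho> x v)) \<and>
     (\<forall>x \<in> sp l. \<forall>y \<in> sp l. \<forall>v \<in> V. \<rho> (lie_bracket x y) v = \<rho> x (\<rho> y v) - \<rho> y (\<rho> x v))"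

definition sp_module_iso ::
  "nat \<Rightarrow> (complex \<Rightarrow> 'v :: ab_group_add \<Rightarrow> 'v) \<Rightarrow> 'v set \<Rightarrow> (complex mat \<Rightarrow> 'v \<Rightarrow> 'v) \<Rightarrow>
   (complex \<Rightarrow> 'w :: ab_group_add \<Rightarrow> 'w) \<Rightarrow> 'w set \<Rightarrow> (complex mat \<Rightarrow> 'w \<Rightarrow> 'w) \<Rightarrow> bool" where
  "sp_module_iso l scale V \<rho> scale' W \<rho>' \<longleftrightarrow>
     (\<exists>\<phi>. bij_betw \<phi> V W \<and>
        (\<forall>v \<in> V. \<forall>w \<in> V. \<phi> (v + w) = \<phi> v + \<phi> w) \<and>
        (\<forall>c. \<forall>v \<in> V. \<phi> (scale c v) = scale' c (\<phi> v)) \<and>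
        (\<forall>x \<in> sp l. \<forall>v \<in> V. \<phi> (\<rho> x v) = \<rho>' x (\<phi> v)))"

definition sp_simple ::
  "nat \<Rightarrow> (complex \<Rightarrow> 'v :: ab_group_add \<Rightarrow> 'v) \<Rightarrow> 'v set \<Rightarrow> (complex mat \<Rightarrow> 'v \<Rightarrow> 'v) \<Rightarrow> bool" where
  "sp_simple l scale V \<rho> \<longleftrightarrow>
     sp_module l scale V \<rho> \<and> V \<noteq> {0} \<and>
     (\<forall>W. W \<subseteq> V \<longrightarrow> module.subspace scale W \<longrightarrow> (\<forall>x \<in> sp l. \<forall>w \<in> W. \<rho> x w \<in> W) \<longrightarrow>
        W = {0} \<or> W = V)"

text \<open>The restriction of \<open>\<rho>\<close> to \<open>U(\<hh>) = \<complex>[H\<^sub>1, \<dots>, H\<^sub>l]\<close>: the monomial with exponents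
  \<open>m\<close> acts by \<open>\<rho>(H\<^sub>1)\<^bsup>m\<^sub>1\<^esup> \<circ> \<dots> \<circ> \<rho>(H\<^sub>l)\<^bsup>m\<^sub>l\<^esup>\<close> (the factors commute).\<close>

definition Uh_act ::
  "nat \<Rightarrow> (complex \<Rightarrow> 'v :: ab_group_add \<Rightarrow> 'v) \<Rightarrow> (complex mat \<Rightarrow> 'v \<Rightarrow> 'v) \<Rightarrow> cpoly \<Rightarrow> 'v \<Rightarrow> 'v" where
  "Uh_act l scale \<rho> p v =
     (\<Sum>m \<in> Poly_Mapping.keys p. scale (Poly_Mapping.lookup p m)
        (foldr (\<lambda>i. \<rho> (coweight l i) ^^ Poly_Mapping.lookup m i) [1..<Suc l] v))"

definition in_H ::
  "nat \<Rightarrow> (complex \<Rightarrow> 'v :: ab_group_add \<Rightarrow> 'v) \<Rightarrow> 'v set \<Rightarrow> (complex mat \<Rightarrow> 'v \<Rightarrow> 'v) \<Rightarrow> bool" where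
  "in_H l scale V \<rho> \<longleftrightarrow>
     sp_module l scale V \<rho> \<and> (\<exists>v \<in> V. bij_betw (\<lambda>p. Uh_act l scale \<rho> p v) (polys l) V)"


section \<open>The modules \<open>M(a, S)\<close>\<close>

definition Hvar :: "nat \<Rightarrow> cpoly" where
  "Hvar i = (if i = 0 then 0 else var i)"

definition EF :: "nat \<Rightarrow> (nat \<Rightarrow> complex) \<Rightarrow> nat set \<Rightarrow> nat \<Rightarrow> cpoly \<times> cpoly" where
  "EF l a S k =
    (if k \<le> l - 2 then
       (if k \<in> S \<and> k + 1 \<in> S then
          (cst (a k) * (Hvar (k+1) - Hvar k + cst (1/2)),
           cst (inverse (a k)) * (Hvar k - Hvar (k-1) + cst (1/2)))
        else if k \<in> S \<and> k + 1 \<notin> S then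
          (cst (a k),
           cst (inverse (a k)) * (Hvar k - Hvar (k-1) + cst (1/2))
             * (Hvar (k+1) - Hvar k - cst (1/2)))
        else if k \<notin> S \<and> k + 1 \<in> S then
          (cst (a k) * (Hvar k - Hvar (k-1) - cst (1/2)) * (Hvar (k+1) - Hvar k + cst (1/2)),
           cst (inverse (a k)))
        else
          (cst (a k) * (Hvar k - Hvar (k-1) - cst (1/2)),
           cst (inverse (a k)) * (Hvar (k+1) - Hvar k - cst (1/2))))
     else if k = l - 1 then
       (if l - 1 \<in> S \<and> l \<in> S then
          (cst (a (l-1)) * (2 * Hvar l - Hvar (l-1) + cst (1/2)),
           cst (inverse (a (l-1))) * (Hvar (l-1) - Hvar (l-2) + cst (1/2)))
        else if l - 1 \<in> S \<and> l \<notin> S then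
          (cst (a (l-1)),
           cst (inverse (a (l-1))) * (Hvar (l-1) - Hvar (l-2) + cst (1/2))
             * (2 * Hvar l - Hvar (l-1) - cst (1/2)))
        else if l - 1 \<notin> S \<and> l \<in> S then
          (cst (a (l-1)) * (Hvar (l-1) - Hvar (l-2) - cst (1/2))
             * (2 * Hvar l - Hvar (l-1) + cst (1/2)),
           cst (inverse (a (l-1))))
        else
          (cst (a (l-1)) * (Hvar (l-1) - Hvar (l-2) - cst (1/2)),
           cst (inverse (a (l-1))) * (2 * Hvar l - Hvar (l-1) - cst (1/2))))
     else
       (if l \<in> S then
          (cst (a l),
           - cst (inverse (a l)) * (Hvar l - cst (1/2) * Hvar (l-1) + cst (3/4))
             * (Hvar l - cst (1/2) * Hvar (l-1) + cst (1/4)))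
        else
          (- cst (a l) * (Hvar l - cst (1/2) * Hvar (l-1) - cst (3/4))
             * (Hvar l - cst (1/2) * Hvar (l-1) - cst (1/4)),
           cst (inverse (a l)))))"

text \<open>\<open>\<rho>\<close> is a module structure on \<open>\<complex>[H\<^sub>1, \<dots>, H\<^sub>l]\<close> in which \<open>H\<^sub>i, e\<^sub>i, f\<^sub>i\<close> act by the
  prescribed formulas; it is determined on \<open>sp l\<close> because the \<open>e\<^sub>i, f\<^sub>i\<close> generate \<open>sp l\<close>.\<close>

definition is_M :: "nat \<Rightarrow> (nat \<Rightarrow> complex) \<Rightarrow> nat set \<Rightarrow> (complex mat \<Rightarrow> cpoly \<Rightarrow> cpoly) \<Rightarrow> bool" where
  "is_M l a S \<rho> \<longleftrightarrow>
     sp_module l poly_scale (polys l) \<rho> \<and>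
     (\<forall>i \<in> {1..l}. \<forall>g \<in> polys l.
        \<rho> (coweight l i) g = Hvar i * g \<and>
        \<rho> (chev_e l i) g = fst (EF l a S i) * sigma i g \<and>
        \<rho> (chev_f l i) g = snd (EF l a S i) * inv_into (polys l) (sigma i) g)"

definition is_param :: "nat \<Rightarrow> (nat \<Rightarrow> complex) \<Rightarrow> nat set \<Rightarrow> bool" where
  "is_param l a S \<longleftrightarrow> (\<forall>i \<in> {1..l}. a i \<noteq> 0) \<and> S \<subseteq> {1..l}"

end

theory Submission
  imports Defs "HOL-Computational_Algebra.Polynomial"
begin

text \<open>
  Put \<open>h\<^sub>k = H\<^sub>k - H\<^sub>k\<^sub>-\<^sub>1\<close> for \<open>k < l\<close> and \<open>h\<^sub>l = 2 H\<^sub>l - H\<^sub>l\<^sub>-\<^sub>1\<close>. In these coordinates \<open>M(a, S)\<close> is the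
  restriction of a module over the Weyl algebra with Euler operators \<open>h\<^sub>k - 1/2\<close>: the variable
  \<open>x\<^sub>k\<close> acts by a pure shift of \<open>h\<^sub>k\<close> if \<open>k \<in> S\<close>, and \<open>\<partial>\<^sub>k\<close> does otherwise. The quadratic
  elements of the Weyl algebra form a copy of \<open>sp l\<close>, whence the module structure. Since
  \<open>x\<^sub>k\<^sup>2\<close> or \<open>\<partial>\<^sub>k\<^sup>2\<close> is a pure shift for each \<open>k\<close>, a nonzero element of least total degree in a
  submodule is fixed by shifts in all directions, hence constant; this gives simplicity.

  For the classification, an object is \<open>\<complex>[H\<^sub>1, \<dots>, H\<^sub>l]\<close> with \<open>e\<^sub>i\<close>, \<open>f\<^sub>i\<close> acting by \<open>E\<^sub>i \<sigma>\<^sub>i\<close> and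
  \<open>F\<^sub>i \<sigma>\<^sub>i\<^sup>-\<^sup>1\<close>. The relations \<open>[e\<^sub>i, f\<^sub>i] = \<alpha>\<^sub>i\<^sup>\<or>\<close> determine \<open>E\<^sub>i \<sigma>\<^sub>i(F\<^sub>i)\<close> up to a summand free of \<open>H\<^sub>i\<close>.
  At the end of the diagram, comparing degrees in \<open>H\<^sub>l\<^sub>-\<^sub>1\<close> and \<open>H\<^sub>l\<close> forces \<open>E\<^sub>l\<close> or \<open>F\<^sub>l\<close> to be
  constant and then determines the rest. Going down, the relations between nodes \<open>k\<close> and
  \<open>k - 1\<close> show that \<open>h\<^sub>k + 1/2\<close> divides \<open>E\<^sub>k\<^sub>-\<^sub>1\<close> or \<open>h\<^sub>k - 1/2\<close> divides \<open>F\<^sub>k\<^sub>-\<^sub>1\<close>; the cofactors have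
  product \<open>h\<^sub>k\<^sub>-\<^sub>1 - 1/2\<close> up to \<open>\<sigma>\<^sub>k\<^sub>-\<^sub>1\<close>, so one of them is constant.
\<close>

section \<open>Polynomials\<close>

lemma cst_0 [simp]: "cst 0 = 0" and cst_1 [simp]: "cst 1 = 1"
  and cst_add: "cst (a + b) = cst a + cst b"
  and cst_diff: "cst (a - b) = cst a - cst b"
  and cst_minus: "cst (- a) = - cst a"
  and cst_mult: "cst (a * b) = cst a * cst b"
  by (simp_all add: cst_def single_add single_diff single_uminus mult_single)

lemma cst_sum: "cst (sum f A) = (\<Sum>x\<in>A. cst (f x))"
  by (induction A rule: infinite_finite_induct) (auto simp: cst_add)

lemma cst_of_nat: "cst (of_nat n) = of_nat n"
  by (simp add: cst_def single_of_nat)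

lemma cst_numeral [simp]: "cst (numeral n) = numeral n"
  by (simp add: cst_def single_numeral)

lemma cst_eq_iff [simp]: "cst a = cst b \<longleftrightarrow> a = b"
  by (metis cst_def lookup_single_eq)

lemma cst_eq_0_iff [simp]: "cst a = 0 \<longleftrightarrow> a = 0"
  using cst_eq_iff[of a 0] by simp

lemma cst_eq_1_iff [simp]: "cst a = 1 \<longleftrightarrow> a = 1"
  using cst_eq_iff[of a 1] by simp

section \<open>Monomials and induction over polynomials\<close>

definition monom_of :: "(nat \<Rightarrow>\<^sub>0 nat) \<Rightarrow> cpoly" where
  "monom_of m = Poly_Mapping.single m 1"

lemma cst_mult_monom_of: "cst c * monom_of m = Poly_Mapping.single m c"
  by (simp add: cst_def monom_of_def mult_single)

lemma monom_of_0 [simp]: "monom_of 0 = 1"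
  by (simp add: monom_of_def)

lemma monom_of_add: "monom_of (m + n) = monom_of m * monom_of n"
  by (simp add: monom_of_def mult_single)

lemma monom_of_single_1: "monom_of (Poly_Mapping.single i 1) = var i"
  by (simp add: monom_of_def var_def)

lemma cpoly_expansion:
  "p = (\<Sum>m \<in> Poly_Mapping.keys p. cst (Poly_Mapping.lookup p m) * monom_of m)"
  by (rule poly_mapping_eqI)
     (simp add: cst_mult_monom_of lookup_sum lookup_single when_def in_keys_iff)

text \<open>Splitting off one variable lowers the total exponent by exactly one, which is the
  measure for the induction rule that follows.\<close>

lemma exponent_split:
  fixes m :: "nat \<Rightarrow>\<^sub>0 nat"
  assumes "i \<in> Poly_Mapping.keys m"
  obtains m' where "m = Poly_Mapping.single i 1 + m'"
    "Poly_Mapping.keys m' \<subseteq> Poly_Mapping.keys m"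
    "(\<Sum>j\<in>Poly_Mapping.keys m. Poly_Mapping.lookup m j)
      = Suc (\<Sum>j\<in>Poly_Mapping.keys m'. Poly_Mapping.lookup m' j)"
proof -
  define m' where "m' = m - Poly_Mapping.single i 1"
  have lk: "Poly_Mapping.lookup m' j = Poly_Mapping.lookup m j - (if j = i then 1 else 0)" for j
    by (simp add: m'_def lookup_minus lookup_single when_def)
  have pos: "Poly_Mapping.lookup m i > 0"
    using assms by (simp add: in_keys_iff)
  have 1: "m = Poly_Mapping.single i 1 + m'"
    using pos by (intro poly_mapping_eqI) (auto simp: lookup_add lk lookup_single when_def)
  have 2: "Poly_Mapping.keys m' \<subseteq> Poly_Mapping.keys m"
    by (auto simp: in_keys_iff lk)
  have "(\<Sum>j\<in>Poly_Mapping.keys m'. Poly_Mapping.lookup m' j)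
      = (\<Sum>j\<in>Poly_Mapping.keys m. Poly_Mapping.lookup m' j)"
    using 2 by (intro sum.mono_neutral_left) (auto simp: in_keys_iff)
  moreover have "(\<Sum>j\<in>Poly_Mapping.keys m. Poly_Mapping.lookup m j)
      = (\<Sum>j\<in>Poly_Mapping.keys m. Poly_Mapping.lookup m' j + (if j = i then 1 else 0))"
    using pos by (intro sum.cong) (auto simp: lk)
  ultimately have "(\<Sum>j\<in>Poly_Mapping.keys m. Poly_Mapping.lookup m j)
      = Suc (\<Sum>j\<in>Poly_Mapping.keys m'. Poly_Mapping.lookup m' j)"
    using assms by (simp add: sum.distrib)
  with 1 2 that show ?thesis by blast
qed

lemma exponent_induct [case_names zero add, consumes 1]:
  fixes m :: "nat \<Rightarrow>\<^sub>0 nat"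
  assumes "Poly_Mapping.keys m \<subseteq> I"
    and "P 0"
    and "\<And>i m. i \<in> I \<Longrightarrow> Poly_Mapping.keys m \<subseteq> I \<Longrightarrow> P m \<Longrightarrow> P (Poly_Mapping.single i 1 + m)"
  shows "P m"
  using assms(1)
proof (induction "\<Sum>j\<in>Poly_Mapping.keys m. Poly_Mapping.lookup m j" arbitrary: m)
  case 0
  then have "m = 0"
    by (intro poly_mapping_eqI) (metis finite_keys in_keys_iff lookup_zero sum_eq_0_iff)
  then show ?case using assms(2) by simp
next
  case (Suc n)
  then have "Poly_Mapping.keys m \<noteq> {}" by auto
  then obtain i where i: "i \<in> Poly_Mapping.keys m" by blast
  then obtain m' where m': "m = Poly_Mapping.single i 1 + m'"
    "Poly_Mapping.keys m' \<subseteq> Poly_Mapping.keys m"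
    "(\<Sum>j\<in>Poly_Mapping.keys m. Poly_Mapping.lookup m j)
      = Suc (\<Sum>j\<in>Poly_Mapping.keys m'. Poly_Mapping.lookup m' j)"
    by (rule exponent_split)
  then show ?case
    using Suc i assms(3)[of i m'] by auto
qed

section \<open>The subring of polynomials in H_1, ..., H_l\<close>

lemma polys_zero [simp]: "0 \<in> polys l" by (simp add: polys_def)

lemma polys_cst [simp]: "cst c \<in> polys l"
  by (simp add: polys_def cst_def)

lemma polys_one [simp]: "1 \<in> polys l"
  using polys_cst[of 1] by simp

lemma polys_add: "p \<in> polys l \<Longrightarrow> q \<in> polys l \<Longrightarrow> p + q \<in> polys l"
  using keys_add[of p q] by (auto simp: polys_def)

lemma polys_minus: "p \<in> polys l \<Longrightarrow> - p \<in> polys l"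
  by (simp add: polys_def in_keys_iff)

lemma polys_diff: "p \<in> polys l \<Longrightarrow> q \<in> polys l \<Longrightarrow> p - q \<in> polys l"
  using polys_add[of p l "- q"] polys_minus[of q] by simp

lemma polys_mult:
  assumes "p \<in> polys l" "q \<in> polys l"
  shows "p * q \<in> polys l"
  unfolding polys_def
proof safe
  fix m i assume m: "m \<in> Poly_Mapping.keys (p * q)" and i: "i \<in> Poly_Mapping.keys m"
  then obtain a b where "m = a + b" "a \<in> Poly_Mapping.keys p" "b \<in> Poly_Mapping.keys q"
    using keys_mult by blast
  with i keys_add[of a b] show "i \<in> {1..l}"
    using assms unfolding polys_def by blast
qed

lemma polys_var: "i \<in> {1..l} \<Longrightarrow> var i \<in> polys l"
  by (simp add: polys_def var_def)

lemma polys_sum: "(\<And>i. i \<in> A \<Longrightarrow> f i \<in> polys l) \<Longrightarrow> sum f A \<in> polys l"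
  by (induction A rule: infinite_finite_induct) (auto intro: polys_add)

lemma polys_numeral [simp]: "numeral n \<in> polys l"
  using polys_cst[of "numeral n"] by simp

lemmas polys_intros = polys_add polys_minus polys_diff polys_mult polys_var

text \<open>A monomial arises from its coefficient by multiplying with one variable at a time, so
  maps on the subring are controlled by constants, sums and single variables. Membership in
  \<open>polys l\<close> is carried along because each summand must stay inside the subring.\<close>

lemma polys_induct [consumes 1, case_names cst add var]:
  assumes "p \<in> polys l"
    and "\<And>c. P (cst c)"
    and "\<And>p q. p \<in> polys l \<Longrightarrow> q \<in> polys l \<Longrightarrow> P p \<Longrightarrow> P q \<Longrightarrow> P (p + q)"
    and "\<And>i p. i \<in> {1..l} \<Longrightarrow> p \<in> polys l \<Longrightarrow> P p \<Longrightarrow> P (var i * p)"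
  shows "P p"
proof -
  have mono: "P (cst c * monom_of m) \<and> cst c * monom_of m \<in> polys l"
    if "Poly_Mapping.keys m \<subseteq> {1..l}" for m c
    using that
  proof (induction m rule: exponent_induct)
    case zero
    then show ?case by (simp add: assms(2))
  next
    case (add i m)
    then have "P (var i * (cst c * monom_of m))" "var i * (cst c * monom_of m) \<in> polys l"
      using assms(4) polys_mult polys_var by blast+
    moreover have "var i * (cst c * monom_of m) = cst c * monom_of (Poly_Mapping.single i 1 + m)"
      by (simp only: monom_of_add monom_of_single_1 mult_ac)
    ultimately show ?case by simp
  qed
  have "P (\<Sum>m \<in> A. cst (Poly_Mapping.lookup p m) * monom_of m)
     \<and> (\<Sum>m \<in> A. cst (Poly_Mapping.lookup p m) * monom_of m) \<in> polys l"
    if "finite A" "A \<subseteq> Poly_Mapping.keys p" for A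
    using that
  proof (induction A)
    case empty
    then show ?case using assms(2)[of 0] by simp
  next
    case (insert m A)
    then have "Poly_Mapping.keys m \<subseteq> {1..l}" using assms(1) by (auto simp: polys_def)
    with insert mono[of m "Poly_Mapping.lookup p m"] show ?case
      by (auto intro!: assms(3) polys_add)
  qed
  from this[of "Poly_Mapping.keys p"] show ?thesis
    using cpoly_expansion[of p] by simp
qed

lemma cpoly_induct [case_names cst add var]:
  assumes cst: "\<And>c. P (cst c)"
    and add: "\<And>p q. P p \<Longrightarrow> P q \<Longrightarrow> P (p + q)"
    and var: "\<And>i p. P p \<Longrightarrow> P (var i * p)"
  shows "P p"
proof -
  have mono: "P (cst c * monom_of m)" for m c
    using subset_UNIV[of "Poly_Mapping.keys m"]
  proof (induction m rule: exponent_induct)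
    case zero
    then show ?case by (simp add: cst)
  next
    case (add i m)
    then have "P (var i * (cst c * monom_of m))" by (intro var)
    moreover have "var i * (cst c * monom_of m) = cst c * monom_of (Poly_Mapping.single i 1 + m)"
      by (simp only: monom_of_add monom_of_single_1 mult_ac)
    ultimately show ?case by simp
  qed
  have "P (\<Sum>m \<in> A. cst (Poly_Mapping.lookup p m) * monom_of m)" if "finite A" for A
    using that cst[of 0] by (induction A) (auto intro!: add mono)
  from this[of "Poly_Mapping.keys p"] show ?thesis
    using cpoly_expansion[of p] by simp
qed

text \<open>A common generalization of \<open>poly_subst\<close> and of the embedding \<open>uni j\<close> below, which
  views a polynomial as a univariate polynomial in the variable \<open>j\<close>.\<close>

definition ev :: "(complex \<Rightarrow> 'a) \<Rightarrow> (nat \<Rightarrow> 'a :: comm_ring_1) \<Rightarrow> cpoly \<Rightarrow> 'a" where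
  "ev \<iota> \<theta> p = (\<Sum>m \<in> Poly_Mapping.keys p.
     \<iota> (Poly_Mapping.lookup p m) * (\<Prod>i \<in> Poly_Mapping.keys m. \<theta> i ^ Poly_Mapping.lookup m i))"

lemma poly_subst_eq_ev: "poly_subst \<theta> = ev cst \<theta>"
  by (simp add: poly_subst_def ev_def fun_eq_iff)

text \<open>Two instances are used: \<open>cst\<close> itself, giving substitution, and constants
  viewed in \<open>cpoly poly\<close>, giving the univariate view \<open>uni\<close>.\<close>

locale coeff_hom =
  fixes \<iota> :: "complex \<Rightarrow> 'a :: comm_ring_1"
  assumes \<iota>_add: "\<iota> (a + b) = \<iota> a + \<iota> b"
    and \<iota>_mult: "\<iota> (a * b) = \<iota> a * \<iota> b"
    and \<iota>_1: "\<iota> 1 = 1"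
begin

lemma \<iota>_0 [simp]: "\<iota> 0 = 0"
  using \<iota>_add[of 0 0] by simp

lemma ev_superset:
  assumes "finite A" "Poly_Mapping.keys p \<subseteq> A"
  shows "ev \<iota> \<theta> p = (\<Sum>m \<in> A.
     \<iota> (Poly_Mapping.lookup p m) * (\<Prod>i \<in> Poly_Mapping.keys m. \<theta> i ^ Poly_Mapping.lookup m i))"
  unfolding ev_def using assms
  by (intro sum.mono_neutral_left) (auto simp: in_keys_iff)

lemma ev_cst [simp]: "ev \<iota> \<theta> (cst c) = \<iota> c"
  using ev_superset[of "{0}" "cst c"] by (simp add: cst_def)

lemma ev_add [simp]: "ev \<iota> \<theta> (p + q) = ev \<iota> \<theta> p + ev \<iota> \<theta> q"
proof -
  let ?A = "Poly_Mapping.keys p \<union> Poly_Mapping.keys q"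
  have "Poly_Mapping.keys (p + q) \<subseteq> ?A" by (rule keys_add)
  then show ?thesis
    by (subst (1 2 3) ev_superset[of ?A])
       (auto simp: lookup_add \<iota>_add distrib_right sum.distrib)
qed

lemma ev_var_monom:
  "(\<Prod>j \<in> Poly_Mapping.keys (Poly_Mapping.single i 1 + m).
      \<theta> j ^ Poly_Mapping.lookup (Poly_Mapping.single i 1 + m) j)
   = \<theta> i * (\<Prod>j \<in> Poly_Mapping.keys m. (\<theta> j :: 'a) ^ Poly_Mapping.lookup m j)" (is "?L = _")
proof -
  let ?A = "insert i (Poly_Mapping.keys m)"
  have "?L = (\<Prod>j \<in> ?A. \<theta> j ^ Poly_Mapping.lookup (Poly_Mapping.single i 1 + m) j)"
    by (intro prod.mono_neutral_left) (auto simp: in_keys_iff lookup_add lookup_single when_def split: if_splits)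
  also have "\<dots> = (\<Prod>j \<in> ?A. (if j = i then \<theta> i else 1) * \<theta> j ^ Poly_Mapping.lookup m j)"
    by (intro prod.cong) (auto simp: lookup_add lookup_single when_def)
  also have "\<dots> = \<theta> i * (\<Prod>j \<in> ?A. \<theta> j ^ Poly_Mapping.lookup m j)"
    by (subst prod.distrib) simp
  also have "(\<Prod>j \<in> ?A. \<theta> j ^ Poly_Mapping.lookup m j)
      = (\<Prod>j \<in> Poly_Mapping.keys m. \<theta> j ^ Poly_Mapping.lookup m j)"
    by (intro prod.mono_neutral_right) (auto simp: in_keys_iff)
  finally show ?thesis .
qed

lemma ev_single: "ev \<iota> \<theta> (Poly_Mapping.single m c)
    = \<iota> c * (\<Prod>j \<in> Poly_Mapping.keys m. \<theta> j ^ Poly_Mapping.lookup m j)"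
  using ev_superset[of "{m}" "Poly_Mapping.single m c"] by simp

lemma ev_cst_mult: "ev \<iota> \<theta> (cst c * p) = \<iota> c * ev \<iota> \<theta> p"
proof -
  have lk: "Poly_Mapping.lookup (cst c * p) m = c * Poly_Mapping.lookup p m" for m
    unfolding cst_def mult_map_scale_conv_mult[symmetric] Poly_Mapping.map.rep_eq
    by (simp add: when_def)
  have "Poly_Mapping.keys (cst c * p) \<subseteq> Poly_Mapping.keys p"
    by (auto simp: in_keys_iff lk)
  then show ?thesis
    by (subst ev_superset[of "Poly_Mapping.keys p"])
       (simp_all add: lk ev_def \<iota>_mult sum_distrib_left mult.assoc)
qed

lemma ev_sum: "ev \<iota> \<theta> (sum f A) = (\<Sum>x\<in>A. ev \<iota> \<theta> (f x))"
  by (induction A rule: infinite_finite_induct) (use ev_cst[of \<theta> 0] in auto)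

lemma ev_var_mult: "ev \<iota> \<theta> (var i * q) = \<theta> i * ev \<iota> \<theta> q"
proof -
  have "var i * q = (\<Sum>m \<in> Poly_Mapping.keys q.
      Poly_Mapping.single (Poly_Mapping.single i 1 + m) (Poly_Mapping.lookup q m))"
    by (subst cpoly_expansion[of q])
       (simp add: sum_distrib_left cst_mult_monom_of var_def mult_single)
  then have "ev \<iota> \<theta> (var i * q) = (\<Sum>m \<in> Poly_Mapping.keys q.
      ev \<iota> \<theta> (Poly_Mapping.single (Poly_Mapping.single i 1 + m) (Poly_Mapping.lookup q m)))"
    by (simp add: ev_sum)
  also have "\<dots> = \<theta> i * ev \<iota> \<theta> q"
    by (simp only: ev_single ev_var_monom) (simp add: ev_def sum_distrib_left mult_ac)
  finally show ?thesis .
qed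

text \<open>Induction on the first factor leaves only multiplication by a constant or by one
  variable, so no convolution of two sums has to be expanded.\<close>

lemma ev_mult [simp]: "ev \<iota> \<theta> (p * q) = ev \<iota> \<theta> p * ev \<iota> \<theta> q"
  by (induction p rule: cpoly_induct)
     (simp_all add: ev_cst_mult ev_var_mult distrib_right mult.assoc)

lemma ev_0 [simp]: "ev \<iota> \<theta> 0 = 0" and ev_1 [simp]: "ev \<iota> \<theta> 1 = 1"
  using ev_cst[of \<theta> 0] ev_cst[of \<theta> 1] by (simp_all add: \<iota>_1)

lemma ev_var [simp]: "ev \<iota> \<theta> (var i) = \<theta> i"
  using ev_var_mult[of \<theta> i 1] by simp

lemma ev_minus [simp]: "ev \<iota> \<theta> (- p) = - ev \<iota> \<theta> p"
  using ev_add[of \<theta> p "- p"] by (simp add: add_eq_0_iff)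

lemma ev_diff [simp]: "ev \<iota> \<theta> (p - q) = ev \<iota> \<theta> p - ev \<iota> \<theta> q"
  using ev_add[of \<theta> p "- q"] by simp

lemma ev_power [simp]: "ev \<iota> \<theta> (p ^ n) = ev \<iota> \<theta> p ^ n"
  by (induction n) auto

lemma ev_of_nat [simp]: "ev \<iota> \<theta> (of_nat n) = of_nat n"
  by (induction n) auto

lemma ev_numeral [simp]: "ev \<iota> \<theta> (numeral n) = numeral n"
  using ev_of_nat[of \<theta> "numeral n"] by simp

lemma ev_of_bool [simp]: "ev \<iota> \<theta> (of_bool b) = of_bool b"
  by (cases b) auto

end

interpretation subst: coeff_hom cst
  rewrites "ev cst = poly_subst"
proof -
  show "coeff_hom cst"
    by unfold_locales (simp_all add: cst_add cst_mult)
  show "ev cst = poly_subst"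
    by (rule ext) (simp add: poly_subst_eq_ev)
qed

lemmas subst_simps [simp] = subst.ev_cst subst.ev_add subst.ev_mult subst.ev_0 subst.ev_1
  subst.ev_var subst.ev_minus subst.ev_diff subst.ev_power subst.ev_numeral subst.ev_of_bool

section \<open>Substitutions and shifts of the variables\<close>

lemma poly_subst_poly_subst:
  "poly_subst \<theta> (poly_subst \<theta>' p) = poly_subst (\<lambda>i. poly_subst \<theta> (\<theta>' i)) p"
  by (induction p rule: cpoly_induct) auto

lemma poly_subst_id [simp]: "poly_subst var p = p"
  by (induction p rule: cpoly_induct) auto

lemma poly_subst_cong:
  assumes "p \<in> polys l" "\<And>i. i \<in> {1..l} \<Longrightarrow> \<theta> i = \<theta>' i"
  shows "poly_subst \<theta> p = poly_subst \<theta>' p"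
  using assms(1) by (induction p rule: polys_induct) (auto simp: assms(2))

lemma poly_subst_in_polys:
  assumes "p \<in> polys l" "\<And>i. i \<in> {1..l} \<Longrightarrow> \<theta> i \<in> polys l"
  shows "poly_subst \<theta> p \<in> polys l"
  using assms(1) by (induction p rule: polys_induct) (auto simp: assms(2) polys_intros)

text \<open>Complex shift vectors are allowed because in the Weyl algebra picture a variable moves
  H_l by 1/2. The automorphisms \<open>sigma i\<close> and their inverses are special cases.\<close>

definition shift :: "(nat \<Rightarrow> complex) \<Rightarrow> cpoly \<Rightarrow> cpoly" where
  "shift d = poly_subst (\<lambda>j. var j - cst (d j))"

lemma shift_shift: "shift d (shift d' p) = shift (\<lambda>i. d i + d' i) p"
  by (simp add: shift_def poly_subst_poly_subst cst_add algebra_simps)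

lemma shift_0 [simp]: "shift (\<lambda>_. 0) p = p"
  by (simp add: shift_def)

lemma shift_in_polys: "p \<in> polys l \<Longrightarrow> shift d p \<in> polys l"
  unfolding shift_def by (intro poly_subst_in_polys) (auto intro!: polys_diff polys_var)

lemma shift_simps [simp]:
  "shift d (cst c) = cst c" "shift d (p + q) = shift d p + shift d q"
  "shift d (p * q) = shift d p * shift d q" "shift d 0 = 0" "shift d 1 = 1"
  "shift d (- p) = - shift d p" "shift d (p - q) = shift d p - shift d q"
  "shift d (p ^ n) = shift d p ^ n" "shift d (numeral k) = numeral k"
  "shift d (var i) = var i - cst (d i)"
  by (simp_all add: shift_def)

definition sigma_inv :: "nat \<Rightarrow> cpoly \<Rightarrow> cpoly" where
  "sigma_inv i = shift (\<lambda>j. - of_bool (i = j))"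

lemma sigma_eq_shift: "sigma i = shift (\<lambda>j. of_bool (i = j))"
  by (auto simp: sigma_def shift_def fun_eq_iff intro!: arg_cong2[where f = poly_subst])

lemma sigma_sigma_inv [simp]: "sigma i (sigma_inv i p) = p"
  and sigma_inv_sigma [simp]: "sigma_inv i (sigma i p) = p"
  by (simp_all add: sigma_eq_shift sigma_inv_def shift_shift)

lemma sigma_simps [simp]:
  "sigma i (cst c) = cst c" "sigma i (p + q) = sigma i p + sigma i q"
  "sigma i (p * q) = sigma i p * sigma i q" "sigma i 0 = 0" "sigma i 1 = 1"
  "sigma i (- p) = - sigma i p" "sigma i (p - q) = sigma i p - sigma i q"
  "sigma i (p ^ n) = sigma i p ^ n" "sigma i (numeral k) = numeral k"
  "sigma i (var j) = var j - of_bool (i = j)"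
  by (auto simp: sigma_eq_shift)

lemma sigma_inv_simps [simp]:
  "sigma_inv i (cst c) = cst c" "sigma_inv i (p + q) = sigma_inv i p + sigma_inv i q"
  "sigma_inv i (p * q) = sigma_inv i p * sigma_inv i q" "sigma_inv i 0 = 0" "sigma_inv i 1 = 1"
  "sigma_inv i (- p) = - sigma_inv i p" "sigma_inv i (p - q) = sigma_inv i p - sigma_inv i q"
  "sigma_inv i (p ^ n) = sigma_inv i p ^ n" "sigma_inv i (numeral k) = numeral k"
  "sigma_inv i (var j) = var j + of_bool (i = j)"
  by (auto simp: sigma_inv_def cst_minus)

lemma sigma_inv_in_polys: "p \<in> polys l \<Longrightarrow> sigma_inv i p \<in> polys l"
  by (simp add: sigma_inv_def shift_in_polys)

text \<open>The inverse shift is defined on all polynomials and preserves the subring, so the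
  \<open>inv_into\<close> in the definition of the module is again a shift.\<close>

lemma inv_into_sigma: "g \<in> polys l \<Longrightarrow> inv_into (polys l) (sigma i) g = sigma_inv i g"
  by (rule inv_into_f_eq) (auto simp: inj_on_def sigma_inv_in_polys dest: arg_cong[of _ _ "sigma_inv i"])

section \<open>Degree and coefficients in one chosen variable\<close>

definition uni :: "nat \<Rightarrow> cpoly \<Rightarrow> cpoly poly" where
  "uni j = ev (\<lambda>c. [:cst c:]) (\<lambda>i. if i = j then [:0, 1:] else [:var i:])"

definition deg :: "nat \<Rightarrow> cpoly \<Rightarrow> nat" where
  "deg j p = degree (uni j p)"

interpretation uni: coeff_hom "\<lambda>c. [:cst c:]"
  by unfold_locales (simp_all add: cst_add cst_mult one_pCons)

lemma uni_simps [simp]: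
  "uni j (cst c) = [:cst c:]" "uni j (p + q) = uni j p + uni j q"
  "uni j (p * q) = uni j p * uni j q" "uni j 0 = 0" "uni j 1 = 1"
  "uni j (- p) = - uni j p" "uni j (p - q) = uni j p - uni j q"
  "uni j (p ^ n) = uni j p ^ n" "uni j (numeral k) = numeral k"
  "uni j (of_bool b) = of_bool b"
  "uni j (var i) = (if i = j then [:0, 1:] else [:var i:])"
  by (simp_all add: uni_def)

text \<open>Evaluation at the chosen variable undoes \<open>uni j\<close>; hence
  \<open>uni j\<close> is injective and identities may be compared coefficientwise.\<close>

lemma poly_uni [simp]: "poly (uni j p) (var j) = p"
  by (induction p rule: cpoly_induct) auto

lemma uni_eq_iff [simp]: "uni j p = uni j q \<longleftrightarrow> p = q"
  by (metis poly_uni)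

lemma uni_eq_0_iff [simp]: "uni j p = 0 \<longleftrightarrow> p = 0"
  using uni_eq_iff[of j p 0] by simp

lemma deg_mult: "p \<noteq> 0 \<Longrightarrow> q \<noteq> 0 \<Longrightarrow> deg j (p * q) = deg j p + deg j q"
  by (simp add: deg_def degree_mult_eq)

lemma deg_eq_0D: "deg j p = 0 \<Longrightarrow> uni j p = [:coeff (uni j p) 0:]"
  by (metis degree_0_id deg_def)

text \<open>The coefficients have type \<open>cpoly\<close>, which could still contain the variable
  j; this says that they do not.\<close>

lemma coeff_uni_const: "uni j (coeff (uni j p) n) = [:coeff (uni j p) n:]"
proof (induction p arbitrary: n rule: cpoly_induct)
  case (cst c)
  then show ?case by (cases n) (auto simp: coeff_pCons)
next
  case (var i p)
  then show ?case by (cases n) (auto simp: coeff_pCons)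
qed auto

lemma deg_coeff_uni [simp]: "deg j (coeff (uni j p) n) = 0"
  by (simp add: deg_def coeff_uni_const)

lemma uni_const: "deg j p = 0 \<Longrightarrow> uni j p = [:p:]"
  by (metis coeff_uni_const deg_eq_0D uni_eq_iff)

text \<open>On the main variable \<open>sigma j\<close> is a translation; every other
  \<open>sigma i\<close> acts on the coefficients only, see \<open>uni_sigma\<close>.\<close>

lemma uni_sigma_same: "uni j (sigma j p) = pcompose (uni j p) [:-1, 1:]"
  by (induction p rule: cpoly_induct) (auto simp: pcompose_add pcompose_mult pcompose_pCons one_pCons)

lemma sigma_inj [simp]: "sigma i p = sigma i q \<longleftrightarrow> p = q"
  by (metis sigma_inv_sigma)

lemma sigma_eq_0_iff [simp]: "sigma i p = 0 \<longleftrightarrow> p = 0"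
  using sigma_inj[of i p 0] by simp

lemma uni_sigma: "i \<noteq> j \<Longrightarrow> uni j (sigma i p) = map_poly (sigma i) (uni j p)"
proof (induction p rule: cpoly_induct)
  case (cst c)
  then show ?case by (simp add: map_poly_pCons)
next
  case (add p q)
  then show ?case by (simp add: poly_eq_iff coeff_map_poly)
next
  case (var k p)
  show ?case
  proof (cases "k = j")
    case True
    with var show ?thesis by (simp add: map_poly_pCons)
  next
    case False
    with var show ?thesis by (auto simp add: poly_eq_iff coeff_map_poly one_pCons)
  qed
qed

lemma deg_sigma [simp]: "deg j (sigma i p) = deg j p"
proof (cases "i = j")
  case True
  then show ?thesis by (simp add: deg_def uni_sigma_same degree_pcompose)
next
  case False
  then show ?thesis
    by (auto simp: deg_def uni_sigma intro!: degree_map_poly)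
qed

text \<open>Invariance forces the value p(0) at all multiples n c, and in characteristic 0 these are
  infinitely many roots of p - p(0).\<close>

lemma pcompose_shift_invariant:
  fixes p :: "'a :: {idom, ring_char_0} poly"
  assumes "pcompose p [:c, 1:] = p" "c \<noteq> 0"
  shows "degree p = 0"
proof -
  have "poly p (of_nat n * c) = poly p 0" for n
  proof (induction n)
    case (Suc n)
    have "poly p (of_nat (Suc n) * c) = poly (pcompose p [:c, 1:]) (of_nat n * c)"
      by (simp add: poly_pcompose algebra_simps)
    with Suc assms(1) show ?case by simp
  qed simp
  then have "range (\<lambda>n. of_nat n * c) \<subseteq> {x. poly (p - [:poly p 0:]) x = 0}"
    by auto
  moreover have "infinite (range (\<lambda>n::nat. of_nat n * c))"
    using assms(2) by (intro range_inj_infinite) (auto simp: inj_def)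
  ultimately have "p - [:poly p 0:] = 0"
    by (metis finite_subset poly_roots_finite)
  then show ?thesis
    by (metis degree_pCons_0 eq_iff_diff_eq_0)
qed

lemma sigma_pow_invariant:
  assumes "(sigma j ^^ n) p = p" "n > 0"
  shows "deg j p = 0"
proof -
  have "uni j ((sigma j ^^ n) p) = pcompose (uni j p) [:- of_nat n, 1:]" for n
    by (induction n) (auto simp: uni_sigma_same pcompose_assoc[symmetric] pcompose_pCons algebra_simps)
  from this[of n] show ?thesis
    using pcompose_shift_invariant[of "uni j p" "- of_nat n"] assms by (simp add: deg_def)
qed

text \<open>This translates between the relations, which involve shifts, and absence of a
  variable.\<close>

lemma sigma_invariant_iff: "sigma j p = p \<longleftrightarrow> deg j p = 0"
proof
  assume "sigma j p = p"
  then show "deg j p = 0" using sigma_pow_invariant[where n = 1] by simp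
next
  assume "deg j p = 0"
  then have "uni j (sigma j p) = uni j p"
    by (simp add: uni_sigma_same uni_const)
  then show "sigma j p = p" by simp
qed

lemma poly_uni_subst: "poly (uni j p) q = poly_subst (var(j := q)) p"
  by (induction p rule: cpoly_induct) auto

text \<open>Setting a variable of degree 0 to zero changes nothing. Doing so for the finitely many
  variables that occur turns p into a constant.\<close>

lemma deg_eq_0_imp_cst:
  assumes "\<And>j. deg j p = 0"
  shows "\<exists>c. p = cst c"
proof -
  have "p = poly_subst (\<lambda>i. if i \<in> A then 0 else var i) p" if "finite A" for A
    using that
  proof (induction A)
    case (insert j A)
    have "p = poly_subst (var(j := 0)) p"
      unfolding poly_uni_subst[symmetric] using uni_const[OF assms, of j] by simp
    also have "\<dots> = poly_subst (var(j := 0)) (poly_subst (\<lambda>i. if i \<in> A then 0 else var i) p)"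
      using insert.IH by simp
    also have "\<dots> = poly_subst (\<lambda>i. if i \<in> insert j A then 0 else var i) p"
      unfolding poly_subst_poly_subst by (rule arg_cong2[where f = poly_subst]) auto
    finally show ?case .
  qed simp
  note subst_zero = this
  define A where "A = (\<Union>m \<in> Poly_Mapping.keys p. Poly_Mapping.keys m)"
  have "p = poly_subst (\<lambda>i. if i \<in> A then 0 else var i) p"
    by (rule subst_zero) (simp add: A_def)
  also have "\<dots> = poly_subst (\<lambda>_. 0) p"
    unfolding poly_subst_def A_def
    by (intro sum.cong prod.cong arg_cong2[where f = "(*)"] arg_cong2[where f = "(^)"]) auto
  also have "\<exists>c. poly_subst (\<lambda>_. 0) p = cst c"
  proof (induction p rule: cpoly_induct)
    case (var i p)
    show ?case by (intro exI[of _ 0]) simp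
  qed (auto simp flip: cst_add)
  finally show ?thesis .
qed

text \<open>Degrees of nonzero polynomials add, so both factors have degree 0 in every
  variable.\<close>

lemma unit_imp_cst:
  assumes "p * q = cst c" "c \<noteq> 0"
  shows "\<exists>a. p = cst a \<and> a \<noteq> 0"
proof -
  have nz: "p \<noteq> 0" "q \<noteq> 0" using assms by auto
  have "deg j p + deg j q = 0" for j
    using deg_mult[OF nz, of j] assms by (simp add: deg_def)
  then show ?thesis using deg_eq_0_imp_cst[of p] nz by auto
qed

section \<open>The oscillator representation\<close>

locale symplectic_ops =
  fixes l :: nat and w :: "nat \<Rightarrow> cpoly \<Rightarrow> cpoly"
    and eps :: "nat \<Rightarrow> complex" and dual :: "nat \<Rightarrow> nat"
  defines "eps \<equiv> \<lambda>s. if s < l then 1 else -1"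
    and "dual \<equiv> \<lambda>s. if s < l then s + l else s - l"
  assumes w_add: "w r (p + q) = w r p + w r q"
    and w_cst: "w r (cst c * p) = cst c * w r p"
    and w_comm: "r < 2*l \<Longrightarrow> t < 2*l \<Longrightarrow>
      w r (w t p) = w t (w r p) + cst (of_bool (r = dual t) * eps t) * p"
begin

text \<open>The usual embedding of sp into the quadratic part of the Weyl algebra. The normalization
  1/2 and the signs \<open>eps\<close> make the commutator of \<open>quad X\<close> with
  \<open>w t\<close> equal to the image of the t-th basis vector under X.\<close>

definition quad :: "complex mat \<Rightarrow> cpoly \<Rightarrow> cpoly" where
  "quad X g = cst (1/2) * (\<Sum>r<2*l. \<Sum>s<2*l. cst (X $$ (r, s) * eps s) * w r (w (dual s) g))"

lemma w_sum: "w r (sum f A) = (\<Sum>x\<in>A. w r (f x))"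
  using w_cst[of r 0 0] by (induction A rule: infinite_finite_induct) (auto simp: w_add)

lemma dual_less: "s < 2*l \<Longrightarrow> dual s < 2*l"
  and dual_dual: "s < 2*l \<Longrightarrow> dual (dual s) = s"
  and eps_dual: "s < 2*l \<Longrightarrow> eps (dual s) = - eps s"
  and eps_eps: "eps s * eps s = 1"
  by (auto simp: dual_def eps_def)

lemma sum_dual: "(\<Sum>s<2*l. f (dual s)) = (\<Sum>s<2*l. f s)"
  by (rule sum.reindex_bij_witness[of _ dual dual]) (auto simp: dual_less dual_dual)

text \<open>The three block conditions of \<open>sp_iff\<close> in one formula: X times the matrix
  of the form is symmetric.\<close>

lemma sp_dual:
  assumes "X \<in> sp l" "r < 2*l" "t < 2*l"
  shows "X $$ (dual t, dual r) * eps (dual r) * eps t = X $$ (r, t)"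
proof -
  have sp: "X $$ (l + r, l + s) = - X $$ (s, r)" "X $$ (r, l + s) = X $$ (s, l + r)"
    "X $$ (l + r, s) = X $$ (l + s, r)" if "r < l" "s < l" for r s
    using assms(1) that unfolding sp_iff by blast+
  show ?thesis
    using sp[of t r] sp[of "t - l" "r"] sp[of t "r - l"] sp[of "r - l" "t - l"] assms
    by (auto simp: dual_def eps_def add.commute[of _ l])
qed

lemma quad_add: "quad X (p + q) = quad X p + quad X q"
  by (simp add: quad_def w_add distrib_left sum.distrib)

lemma quad_cst: "quad X (cst c * p) = cst c * quad X p"
  by (simp add: quad_def w_cst sum_distrib_left mult.left_commute[of _ "cst c"])

lemma quad_mat_add:
  assumes "X \<in> carrier_mat (2*l) (2*l)" "Y \<in> carrier_mat (2*l) (2*l)"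
  shows "quad (X + Y) p = quad X p + quad Y p"
  using assms
  by (simp add: quad_def cst_add distrib_right distrib_left sum.distrib)

lemma quad_mat_minus:
  assumes "X \<in> carrier_mat (2*l) (2*l)" "Y \<in> carrier_mat (2*l) (2*l)"
  shows "quad (X - Y) p = quad X p - quad Y p"
  using assms
  by (simp add: quad_def cst_diff left_diff_distrib right_diff_distrib sum_subtractf)

lemma quad_mat_smult:
  assumes "X \<in> carrier_mat (2*l) (2*l)"
  shows "quad (c \<cdot>\<^sub>m X) p = cst c * quad X p"
  using assms
  by (simp add: quad_def cst_mult sum_distrib_left mult_ac)

lemma quad_elem_mat:
  assumes "r < 2*l" "s < 2*l"
  shows "quad (elem_mat l r s) g = cst (1/2 * eps s) * w r (w (dual s) g)"
proof -
  have "quad (elem_mat l r s) g = cst (1/2) *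
      (\<Sum>i<2*l. \<Sum>j<2*l. if j = s then if i = r then cst (eps s) * w r (w (dual s) g) else 0 else 0)"
    unfolding quad_def
    by (intro arg_cong2[where f = "(*)"] sum.cong) (auto simp: elem_mat_index)
  also have "\<dots> = cst (1/2 * eps s) * w r (w (dual s) g)"
    using assms by (simp only: sum.delta finite_lessThan lessThan_iff if_True cst_mult mult.assoc)
  finally show ?thesis .
qed

lemma quad_sp_diag:
  "quad (sp_diag l d) g = cst (1/2) * (\<Sum>r<l. cst (d r) * (w r (w (l + r) g) + w (l + r) (w r g)))"
proof -
  have "quad (sp_diag l d) g = cst (1/2) *
      (\<Sum>i<2*l. \<Sum>j<2*l. if j = i then cst ((if i < l then d i else - d (i - l)) * eps i) * w i (w (dual i) g) else 0)"
    unfolding quad_def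
    by (intro arg_cong2[where f = "(*)"] sum.cong) (auto simp: sp_diag_def)
  also have "\<dots> = cst (1/2) * (\<Sum>i<2*l. cst ((if i < l then d i else - d (i - l)) * eps i) * w i (w (dual i) g))"
    by simp
  also have "{..<2*l} = {..<l} \<union> {l..<2*l}" by auto
  also have "(\<Sum>i\<in>\<dots>. cst ((if i < l then d i else - d (i - l)) * eps i) * w i (w (dual i) g))
      = (\<Sum>i<l. cst (d i) * w i (w (l + i) g)) + (\<Sum>i<l. cst (d i) * w (l + i) (w i g))"
  proof (subst sum.union_disjoint)
    have "(\<Sum>i = l..<2*l. cst ((if i < l then d i else - d (i - l)) * eps i) * w i (w (dual i) g))
      = (\<Sum>i<l. cst (d i) * w (l + i) (w i g))"
      by (rule sum.reindex_bij_witness[of _ "\<lambda>i. l + i" "\<lambda>i. i - l"]) (auto simp: eps_def dual_def)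
    then show "(\<Sum>i<l. cst ((if i < l then d i else - d (i - l)) * eps i) * w i (w (dual i) g))
      + (\<Sum>i = l..<2*l. cst ((if i < l then d i else - d (i - l)) * eps i) * w i (w (dual i) g))
      = (\<Sum>i<l. cst (d i) * w i (w (l + i) g)) + (\<Sum>i<l. cst (d i) * w (l + i) (w i g))"
      by (auto simp: eps_def dual_def add.commute intro!: sum.cong)
  qed auto
  finally show ?thesis by (simp add: distrib_left sum.distrib)
qed

text \<open>The operators \<open>w t\<close> span a copy of the defining representation.\<close>

lemma quad_w:
  assumes X: "X \<in> sp l" and t: "t < 2*l"
  shows "quad X (w t g) = w t (quad X g) + (\<Sum>r<2*l. cst (X $$ (r, t)) * w r g)"
proof -
  have 1: "w r (w (dual s) (w t g)) = w t (w r (w (dual s) g))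
      + cst (of_bool (r = dual t) * eps t) * w (dual s) g + cst (of_bool (s = t) * eps t) * w r g"
    if "r < 2*l" "s < 2*l" for r s
  proof -
    have "dual s = dual t \<longleftrightarrow> s = t" using that t dual_dual by metis
    then have "w r (w (dual s) (w t g)) = w r (w t (w (dual s) g) + cst (of_bool (s = t) * eps t) * g)"
      using w_comm[OF dual_less[OF that(2)] t, of g] by simp
    also have "\<dots> = w r (w t (w (dual s) g)) + cst (of_bool (s = t) * eps t) * w r g"
      by (simp only: w_add w_cst)
    finally show ?thesis
      by (simp add: w_comm[OF that(1) t, of "w (dual s) g"])
  qed
  have "(\<Sum>r<2*l. \<Sum>s<2*l. cst (X $$ (r, s) * eps s) * w r (w (dual s) (w t g)))
     = (\<Sum>r<2*l. \<Sum>s<2*l. cst (X $$ (r, s) * eps s) * w t (w r (w (dual s) g)))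
     + (\<Sum>r<2*l. \<Sum>s<2*l. if r = dual t then cst (X $$ (dual t, s) * eps s * eps t) * w (dual s) g else 0)
     + (\<Sum>r<2*l. \<Sum>s<2*l. if s = t then cst (X $$ (r, t) * (eps t * eps t)) * w r g else 0)"
    unfolding sum.distrib[symmetric]
    by (intro sum.cong refl) (auto simp: 1 algebra_simps cst_mult)
  also have "(\<Sum>r<2*l. \<Sum>s<2*l. cst (X $$ (r, s) * eps s) * w t (w r (w (dual s) g)))
      = w t (\<Sum>r<2*l. \<Sum>s<2*l. cst (X $$ (r, s) * eps s) * w r (w (dual s) g))"
    by (simp add: w_sum w_cst)
  also have "(\<Sum>r<2*l. \<Sum>s<2*l. if r = dual t then cst (X $$ (dual t, s) * eps s * eps t) * w (dual s) g else 0)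
     = (\<Sum>s<2*l. cst (X $$ (dual t, s) * eps s * eps t) * w (dual s) g)"
    by (subst sum.swap) (simp add: dual_less t)
  also have "\<dots> = (\<Sum>s<2*l. cst (X $$ (dual t, dual (dual s)) * eps (dual (dual s)) * eps t) * w (dual s) g)"
    by (intro sum.cong) (auto simp: dual_dual)
  also have "\<dots> = (\<Sum>s<2*l. cst (X $$ (dual t, dual s) * eps (dual s) * eps t) * w s g)"
    by (rule sum_dual)
  \<comment> \<open>By \<open>sp_dual\<close> the two contributions of the product rule coincide,
    which absorbs the factor 1/2.\<close>
  also have "\<dots> = (\<Sum>s<2*l. cst (X $$ (s, t)) * w s g)"
    by (intro sum.cong) (auto simp: sp_dual[OF X _ t])
  also have "(\<Sum>r<2*l. \<Sum>s<2*l. if s = t then cst (X $$ (r, t) * (eps t * eps t)) * w r g else 0)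
     = (\<Sum>r<2*l. cst (X $$ (r, t)) * w r g)"
    using t by (simp add: eps_eps)
  finally have "quad X (w t g) = cst (1/2) *
      (w t (\<Sum>r<2*l. \<Sum>s<2*l. cst (X $$ (r, s) * eps s) * w r (w (dual s) g))
       + (\<Sum>s<2*l. cst (X $$ (s, t)) * w s g) + (\<Sum>r<2*l. cst (X $$ (r, t)) * w r g))"
    by (simp add: quad_def)
  also have "\<dots> = w t (quad X g) + (cst (1/2) + cst (1/2)) * (\<Sum>r<2*l. cst (X $$ (r, t)) * w r g)"
    by (simp add: quad_def w_cst algebra_simps)
  finally show ?thesis by (simp flip: cst_add)
qed

text \<open>The rule \<open>quad_w\<close> for the second factor in \<open>quad\<close>, with its
  sign moved so that the matrix entry becomes one of X rather than of its dual.\<close>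

lemma quad_w_dual:
  assumes X: "X \<in> sp l" and s: "s < 2*l"
  shows "cst (eps s) * quad X (w (dual s) g) = cst (eps s) * w (dual s) (quad X g)
     - (\<Sum>t<2*l. cst (X $$ (s, t) * eps t) * w (dual t) g)"
proof -
  have "cst (eps s) * (\<Sum>r<2*l. cst (X $$ (r, dual s)) * w r g)
      = (\<Sum>r<2*l. cst (eps s * X $$ (dual r, dual s)) * w (dual r) g)"
    by (subst sum_dual[symmetric]) (simp add: sum_distrib_left cst_mult mult.assoc)
  also have "\<dots> = (\<Sum>r<2*l. - (cst (X $$ (s, r) * eps r) * w (dual r) g))"
  proof (intro sum.cong refl)
    fix r assume "r \<in> {..<2*l}"
    then have r: "r < 2*l" by simp
    have "eps s * X $$ (dual r, dual s) = eps s * (X $$ (s, r) * eps r * eps (dual s))"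
      using sp_dual[OF X dual_less[OF r] dual_less[OF s]] by (simp add: dual_dual r s)
    also have "\<dots> = - (X $$ (s, r) * eps r)"
      unfolding eps_dual[OF s] by (cases "s < l") (simp_all add: eps_def)
    finally show "cst (eps s * X $$ (dual r, dual s)) * w (dual r) g
        = - (cst (X $$ (s, r) * eps r) * w (dual r) g)" by (simp add: cst_minus)
  qed
  finally show ?thesis
    unfolding quad_w[OF X dual_less[OF s]] distrib_left by (simp add: sum_negf)
qed

text \<open>Moving \<open>quad X\<close> through both factors of \<open>quad Y\<close> produces two
  correction terms, one for each factor. They are the quadratic elements of X Y and of Y X.\<close>

lemma quad_bracket:
  assumes X: "X \<in> sp l" and Y: "Y \<in> sp l"
  shows "quad (lie_bracket X Y) g = quad X (quad Y g) - quad Y (quad X g)"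
proof -
  have c: "X \<in> carrier_mat (2*l) (2*l)" "Y \<in> carrier_mat (2*l) (2*l)"
    using X Y by (auto simp: sp_def)
  have prod: "(A * B) $$ (r, s) = (\<Sum>t<2*l. A $$ (r, t) * B $$ (t, s))"
    if "A \<in> carrier_mat (2*l) (2*l)" "B \<in> carrier_mat (2*l) (2*l)" "r < 2*l" "s < 2*l" for A B r s
    using that by (simp add: scalar_prod_def lessThan_atLeast0)
  have qsum: "quad X (sum f A) = (\<Sum>x\<in>A. quad X (f x))" for X f and A :: "nat set"
    using quad_cst[of X 0 0] by (induction A rule: infinite_finite_induct) (auto simp: quad_add)
  have summand: "cst (Y $$ (r, s) * eps s) * quad X (w r (w (dual s) g))
      = cst (Y $$ (r, s) * eps s) * w r (w (dual s) (quad X g))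
      + (\<Sum>t<2*l. cst (X $$ (t, r) * Y $$ (r, s) * eps s) * w t (w (dual s) g))
      - (\<Sum>t<2*l. cst (Y $$ (r, s) * X $$ (s, t) * eps t) * w r (w (dual t) g))"
    if "r < 2*l" "s < 2*l" for r s
  proof -
    have "cst (Y $$ (r, s) * eps s) * quad X (w r (w (dual s) g))
       = cst (Y $$ (r, s)) * (w r (cst (eps s) * quad X (w (dual s) g))
         + cst (eps s) * (\<Sum>t<2*l. cst (X $$ (t, r)) * w t (w (dual s) g)))"
      by (simp add: quad_w[OF X that(1)] w_cst cst_mult algebra_simps)
    also have "w r (cst (eps s) * quad X (w (dual s) g)) = cst (eps s) * w r (w (dual s) (quad X g))
       - (\<Sum>t<2*l. cst (X $$ (s, t) * eps t) * w r (w (dual t) g))"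
    proof -
      have m: "w r (p - q) = w r p - w r q" for p q
        using w_add[of r "p - q" q] by simp
      show ?thesis
        unfolding quad_w_dual[OF X that(2)] by (simp add: m w_cst w_sum)
    qed
    finally show ?thesis
      by (simp add: algebra_simps sum_distrib_left cst_mult)
  qed
  have "quad X (quad Y g) = cst (1/2) * (\<Sum>r<2*l. \<Sum>s<2*l.
       cst (Y $$ (r, s) * eps s) * quad X (w r (w (dual s) g)))"
    unfolding quad_def[of Y] by (simp add: quad_cst qsum)
  also have "\<dots> = quad Y (quad X g)
     + cst (1/2) * (\<Sum>r<2*l. \<Sum>s<2*l. \<Sum>t<2*l. cst (X $$ (t, r) * Y $$ (r, s) * eps s) * w t (w (dual s) g))
     - cst (1/2) * (\<Sum>r<2*l. \<Sum>s<2*l. \<Sum>t<2*l. cst (Y $$ (r, s) * X $$ (s, t) * eps t) * w r (w (dual t) g))"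
    by (simp add: summand sum.distrib sum_subtractf quad_def[of Y] distrib_left right_diff_distrib)
  also have "(\<Sum>r<2*l. \<Sum>s<2*l. \<Sum>t<2*l. cst (X $$ (t, r) * Y $$ (r, s) * eps s) * w t (w (dual s) g))
      = (\<Sum>t<2*l. \<Sum>s<2*l. \<Sum>r<2*l. cst (X $$ (t, r) * Y $$ (r, s) * eps s) * w t (w (dual s) g))"
    by (subst sum.swap, subst (2) sum.swap, subst sum.swap) simp
  also have "cst (1/2) * \<dots> = quad (X * Y) g"
    unfolding quad_def using c
    by (intro arg_cong2[where f = "(*)"] sum.cong refl)
       (simp add: prod sum_distrib_right cst_sum del: index_mult_mat)
  also have "(\<Sum>r<2*l. \<Sum>s<2*l. \<Sum>t<2*l. cst (Y $$ (r, s) * X $$ (s, t) * eps t) * w r (w (dual t) g))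
      = (\<Sum>r<2*l. \<Sum>t<2*l. \<Sum>s<2*l. cst (Y $$ (r, s) * X $$ (s, t) * eps t) * w r (w (dual t) g))"
    by (intro sum.cong refl sum.swap)
  also have "cst (1/2) * \<dots> = quad (Y * X) g"
    unfolding quad_def using c
    by (intro arg_cong2[where f = "(*)"] sum.cong refl)
       (simp add: prod sum_distrib_right cst_sum del: index_mult_mat)
  finally show ?thesis
    using c unfolding lie_bracket_def by (simp add: quad_mat_minus)
qed

end


lemma cst_half [simp]: "2 * cst (1/2) = 1" "cst (1/2) * 2 = 1"
  "cst (1/2) + cst (1/2) = 1" "cst (1/2) * (2 * p) = p" "2 * (cst (1/2) * p) = p"
proof -
  show half: "cst (1/2) * 2 = 1" "2 * cst (1/2) = 1" "cst (1/2) + cst (1/2) = 1"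
    by (simp_all del: cst_numeral flip: cst_numeral cst_mult cst_add)
  show "cst (1/2) * (2 * p) = p" "2 * (cst (1/2) * p) = p"
    by (simp_all only: mult.assoc[symmetric] half mult_1_left)
qed

section \<open>The coordinates h_k and the Weyl algebra operators\<close>

definition wt :: "nat \<Rightarrow> nat \<Rightarrow> cpoly" where
  "wt l k = (if k = l then 2 * var l - Hvar (l - 1) else Hvar k - Hvar (k - 1))"

text \<open>This vector lowers h_r by 1 and fixes the other h_k: H_i is h_1 + ... + h_i for i < l,
  but H_l is half of h_1 + ... + h_l, whence the entry 1/2.\<close>

definition wtshift :: "nat \<Rightarrow> nat \<Rightarrow> nat \<Rightarrow> complex" where
  "wtshift l r i = (if i = l then 1/2 else of_bool (r \<le> i))"

text \<open>In the Weyl algebra picture \<open>x\<^sub>k\<close> acts by \<open>up l S k\<close> times a shift by \<open>wtshift l k\<close>, and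
  \<open>\<partial>\<^sub>k\<close> by \<open>down l S k\<close> times the inverse shift.\<close>

definition up :: "nat \<Rightarrow> nat set \<Rightarrow> nat \<Rightarrow> cpoly" where
  "up l S k = (if k \<in> S then 1 else wt l k - cst (1/2))"

definition down :: "nat \<Rightarrow> nat set \<Rightarrow> nat \<Rightarrow> cpoly" where
  "down l S k = (if k \<in> S then wt l k + cst (1/2) else 1)"

lemma Hvar_in_polys: "i \<le> l \<Longrightarrow> Hvar i \<in> polys l"
  by (auto simp: Hvar_def intro: polys_var)

lemma wt_in_polys: "k \<in> {1..l} \<Longrightarrow> wt l k \<in> polys l"
  by (auto simp: wt_def intro!: polys_diff polys_mult Hvar_in_polys polys_var)

lemma up_in_polys: "k \<in> {1..l} \<Longrightarrow> up l S k \<in> polys l"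
  and down_in_polys: "k \<in> {1..l} \<Longrightarrow> down l S k \<in> polys l"
  by (auto simp: up_def down_def intro!: polys_add polys_diff wt_in_polys)

text \<open>In the Weyl algebra picture e_k is x_k times the derivative in direction k + 1, and f_k
  the reverse. This form covers all eight cases of the definition below node l.\<close>

lemma EF_less:
  assumes "k \<in> {1..l}" "k < l"
  shows "EF l a S k = (cst (a k) * up l S k * down l S (k + 1),
    cst (inverse (a k)) * down l S k * up l S (k + 1))"
proof (cases "k \<le> l - 2")
  case True
  then have "k + 1 \<noteq> l" "k \<noteq> l" using assms by auto
  moreover have "Hvar (k + 1) - Hvar k = wt l (k + 1)" "Hvar k - Hvar (k - 1) = wt l k"
    using calculation by (simp_all add: wt_def)
  ultimately show ?thesis
    using True by (simp add: EF_def up_def down_def mult.assoc)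
next
  case False
  then have k: "k = l - 1" "\<not> l - 1 \<le> l - 2" "l - 1 + 1 = l" "l - 1 \<noteq> l"
    "l - Suc 0 \<noteq> l" using assms by auto
  have h: "2 * Hvar l - Hvar (l - 1) = wt l l" "Hvar (l - 1) - Hvar (l - 2) = wt l (l - 1)"
    using k(4,5) assms by (simp_all add: wt_def Hvar_def numeral_2_eq_2)
  show ?thesis
    unfolding k(1) k(3) EF_def using k(2-) h by (simp add: up_def down_def mult.assoc)
qed

text \<open>Each linear factor of the definition is half of one in h_l; the two halves give the
  denominator 4.\<close>

lemma EF_last:
  assumes "2 \<le> l"
  shows "EF l a S l = (if l \<in> S then
      (cst (a l), - cst (inverse (a l) / 4) * (wt l l + cst (3/2)) * (wt l l + cst (1/2)))
    else (- cst (a l / 4) * (wt l l - cst (3/2)) * (wt l l - cst (1/2)), cst (inverse (a l))))"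
proof -
  have h: "Hvar l - cst (1/2) * Hvar (l - 1) = cst (1/2) * wt l l"
    using assms by (simp add: wt_def Hvar_def right_diff_distrib mult.assoc[symmetric])
  have e: "cst (1/2) * p + cst (3/4) = cst (1/2) * (p + cst (3/2))"
    "cst (1/2) * p + cst (1/4) = cst (1/2) * (p + cst (1/2))"
    "cst (1/2) * p - cst (3/4) = cst (1/2) * (p - cst (3/2))"
    "cst (1/2) * p - cst (1/4) = cst (1/2) * (p - cst (1/2))" for p
    by (simp_all add: distrib_left right_diff_distrib flip: cst_mult)
  have f: "- cst c * (cst (1/2) * p) * (cst (1/2) * q) = - cst (c / 4) * p * q" for c p q
  proof -
    have "- cst c * (cst (1/2) * p) * (cst (1/2) * q) = - cst (c * (1/2) * (1/2)) * p * q"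
      by (simp only: cst_mult) (simp add: mult_ac)
    then show ?thesis by simp
  qed
  show ?thesis
    using assms unfolding EF_def h e f by auto
qed

lemma sigma_wt:
  assumes "k \<in> {1..l}" "i \<in> {1..l}"
  shows "sigma i (wt l k) = wt l k - of_bool (i = k) * (if i = l then 2 else 1) + of_bool (k = i + 1)"
  using assms by (auto simp: wt_def Hvar_def)

lemma poly_scale_vector_space: "vector_space poly_scale"
  by unfold_locales (auto simp: poly_scale_def algebra_simps cst_add cst_mult)

lemma polys_subspace: "module.subspace poly_scale (polys l)"
proof -
  interpret vector_space poly_scale by (rule poly_scale_vector_space)
  show ?thesis by (auto simp: subspace_def poly_scale_def intro: polys_add polys_mult)
qed

text \<open>Rescaling x_r by \<open>b r\<close> and the derivative by its inverse preserves the Weyl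
  relations; this freedom realizes all parameters a.\<close>

locale oscillator =
  fixes l :: nat and b :: "nat \<Rightarrow> complex" and S :: "nat set"
  assumes b: "r \<in> {1..l} \<Longrightarrow> b r \<noteq> 0"
begin

definition xop :: "nat \<Rightarrow> cpoly \<Rightarrow> cpoly" where
  "xop r g = cst (b r) * up l S r * shift (wtshift l r) g"

definition dop :: "nat \<Rightarrow> cpoly \<Rightarrow> cpoly" where
  "dop r g = cst (inverse (b r)) * down l S r * shift (\<lambda>i. - wtshift l r i) g"

lemma shift_wt:
  assumes "r \<in> {1..l}" "k \<in> {1..l}"
  shows "shift (wtshift l r) (wt l k) = wt l k - of_bool (k = r)"
    "shift (\<lambda>i. - wtshift l r i) (wt l k) = wt l k + of_bool (k = r)"
  using assms
  by (auto simp: wt_def wtshift_def Hvar_def cst_minus right_diff_distrib distrib_left)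

lemma shift_up_down:
  assumes "r \<in> {1..l}" "k \<in> {1..l}" "r \<noteq> k"
  shows "shift (wtshift l r) (up l S k) = up l S k" "shift (wtshift l r) (down l S k) = down l S k"
    "shift (\<lambda>i. - wtshift l r i) (up l S k) = up l S k"
    "shift (\<lambda>i. - wtshift l r i) (down l S k) = down l S k"
  using assms by (simp_all add: up_def down_def shift_wt)

lemma xop_linear: "xop r (p + q) = xop r p + xop r q" "xop r (cst c * p) = cst c * xop r p"
  and dop_linear: "dop r (p + q) = dop r p + dop r q" "dop r (cst c * p) = cst c * dop r p"
  by (simp_all add: xop_def dop_def algebra_simps)

lemma xop_xop: "r \<in> {1..l} \<Longrightarrow> t \<in> {1..l} \<Longrightarrow> xop r (xop t g) = xop t (xop r g)"
  by (cases "r = t") (simp_all add: xop_def shift_up_down shift_shift add.commute mult_ac)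

lemma dop_dop: "r \<in> {1..l} \<Longrightarrow> t \<in> {1..l} \<Longrightarrow> dop r (dop t g) = dop t (dop r g)"
  by (cases "r = t") (simp_all add: dop_def shift_up_down shift_shift add.commute mult_ac)

text \<open>Exactly one of \<open>up\<close> and \<open>down\<close> is nontrivial, so either order
  yields a single linear factor. The symmetric normalization 1/2 makes h_r the mean of the two
  orders.\<close>

lemma dop_xop_same:
  assumes "r \<in> {1..l}"
  shows "dop r (xop r g) = (wt l r + cst (1/2)) * g" "xop r (dop r g) = (wt l r - cst (1/2)) * g"
proof -
  have c: "cst (inverse (b r)) * cst (b r) = 1"
    using b[OF assms] by (simp flip: cst_mult)
  have h: "cst (1/2) + cst (1/2) = 1" by (simp flip: cst_add)
  have "dop r (xop r g) = (cst (inverse (b r)) * cst (b r)) *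
      (down l S r * shift (\<lambda>i. - wtshift l r i) (up l S r)) * g"
    by (simp add: dop_def xop_def shift_shift mult_ac)
  also have "down l S r * shift (\<lambda>i. - wtshift l r i) (up l S r) = wt l r + cst (1/2)"
    using h by (simp add: up_def down_def shift_wt[OF assms assms] algebra_simps)
  finally show "dop r (xop r g) = (wt l r + cst (1/2)) * g" by (simp add: c)
  have "xop r (dop r g) = (cst (inverse (b r)) * cst (b r)) *
      (up l S r * shift (wtshift l r) (down l S r)) * g"
    by (simp add: dop_def xop_def shift_shift mult_ac)
  also have "up l S r * shift (wtshift l r) (down l S r) = wt l r - cst (1/2)"
    using h by (simp add: up_def down_def shift_wt[OF assms assms] algebra_simps)
  finally show "xop r (dop r g) = (wt l r - cst (1/2)) * g" by (simp add: c)
qed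

lemma dop_xop:
  assumes "r \<in> {1..l}" "t \<in> {1..l}"
  shows "dop r (xop t g) = xop t (dop r g) + of_bool (r = t) * g"
proof (cases "r = t")
  case True
  have h: "cst (1/2) + cst (1/2) = 1" by (simp flip: cst_add)
  have "(wt l t + cst (1/2)) * g = (wt l t - cst (1/2)) * g + (cst (1/2) + cst (1/2)) * g"
    by (simp only: left_diff_distrib distrib_right) simp
  with True assms show ?thesis by (simp add: dop_xop_same h)
next
  case False
  with assms show ?thesis
    by (simp add: xop_def dop_def shift_up_down shift_shift add.commute mult_ac)
qed

text \<open>Row r < l of the defining representation corresponds to x_(r+1), row l + r to the
  derivative in the same direction.\<close>

definition wop :: "nat \<Rightarrow> cpoly \<Rightarrow> cpoly" where
  "wop r = (if r < l then xop (Suc r) else dop (Suc (r - l)))"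

sublocale symplectic_ops l wop "\<lambda>s. if s < l then 1 else -1" "\<lambda>s. if s < l then s + l else s - l"
proof unfold_locales
  fix r t p assume rt: "r < 2*l" "t < 2*l"
  consider "r < l" "t < l" | "r < l" "\<not> t < l" | "\<not> r < l" "t < l" | "\<not> r < l" "\<not> t < l" by blast
  then show "wop r (wop t p) = wop t (wop r p)
      + cst (of_bool (r = (if t < l then t + l else t - l)) * (if t < l then 1 else - 1)) * p"
  proof cases
    case 1
    then show ?thesis using xop_xop[of "Suc r" "Suc t" p] by (auto simp: wop_def)
  next
    case 2
    then show ?thesis using dop_xop[of "Suc (t - l)" "Suc r" p] rt
      by (auto simp: wop_def cst_minus)
  next
    case 3
    then have "(r = t + l) = (r - l = t)" by auto
    then show ?thesis using 3 dop_xop[of "Suc (r - l)" "Suc t" p] rt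
      by (auto simp: wop_def)
  next
    case 4
    then show ?thesis using dop_dop[of "Suc (r - l)" "Suc (t - l)" p] rt by (auto simp: wop_def)
  qed
qed (auto simp: wop_def xop_linear dop_linear)

lemma wop_in_polys: "r < 2*l \<Longrightarrow> g \<in> polys l \<Longrightarrow> wop r g \<in> polys l"
  by (auto simp: wop_def xop_def dop_def
      intro!: polys_mult up_in_polys down_in_polys shift_in_polys)

lemma quad_in_polys: "g \<in> polys l \<Longrightarrow> quad X g \<in> polys l"
  unfolding quad_def by (intro polys_mult polys_sum wop_in_polys) auto

lemma quad_module: "sp_module l poly_scale (polys l) quad"
  unfolding sp_module_def
  by (auto simp: poly_scale_vector_space polys_subspace quad_in_polys quad_add quad_cst
      poly_scale_def quad_mat_add quad_mat_smult quad_bracket sp_def)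

section \<open>The formulas of M(a, S) inside the oscillator representation\<close>

lemma quad_coweight:
  assumes "2 \<le> l" "i \<in> {1..l}"
  shows "quad (coweight l i) g = Hvar i * g"
proof -
  have diag: "quad (sp_diag l d) g = (\<Sum>r<l. cst (d r) * wt l (Suc r)) * g" for d
  proof -
    have "wop r (wop (l + r) g) + wop (l + r) (wop r g) = 2 * (wt l (Suc r) * g)" if "r < l" for r
      using that by (simp add: wop_def dop_xop_same algebra_simps)
    then have "quad (sp_diag l d) g = cst (1/2) * (\<Sum>r<l. cst (d r) * (2 * (wt l (Suc r) * g)))"
      unfolding quad_sp_diag by simp
    also have "\<dots> = (cst (1/2) * cst 2) * (\<Sum>r<l. cst (d r) * wt l (Suc r)) * g"
      unfolding sum_distrib_left sum_distrib_right
      by (intro sum.cong refl) (simp add: mult_ac)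
    also have "cst (1/2) * cst 2 = 1" by (simp del: cst_numeral flip: cst_mult)
    finally show ?thesis by simp
  qed
  \<comment> \<open>Valid only below l, since h_l is not the difference of neighbouring H.\<close>
  have tele: "(\<Sum>r<k. wt l (Suc r)) = Hvar k" if "k < l" for k
    using that by (induction k) (auto simp: wt_def Hvar_def)
  show ?thesis
  proof (cases "i = l")
    case True
    obtain l' where l': "l = Suc l'" using assms by (cases l) auto
    have "(\<Sum>r<l. cst (1/2) * wt l (Suc r)) = cst (1/2) * ((\<Sum>r<l'. wt l (Suc r)) + wt l l)"
      unfolding sum_distrib_left[symmetric] by (simp add: l')
    also have "\<dots> = cst (1/2) * cst 2 * var l"
      using tele[of l'] by (simp add: l' wt_def)
    also have "\<dots> = Hvar l" using assms by (simp add: Hvar_def del: cst_numeral flip: cst_mult)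
    finally show ?thesis using True by (simp add: coweight_def diag)
  next
    case False
    then have "(\<Sum>r<l. cst (of_bool (r < i)) * wt l (Suc r)) = (\<Sum>r<i. wt l (Suc r))"
      using assms by (intro sum.mono_neutral_cong_right) auto
    with False tele[of i] assms show ?thesis by (simp add: coweight_def diag)
  qed
qed

text \<open>Up to constants these are the squares of x_r and of the derivative. They are computed
  for every r, not only for node l, because simplicity uses all long roots.\<close>

lemma quad_long:
  assumes "r \<in> {1..l}"
  shows "quad (elem_mat l (r - 1) (l + r - 1)) g
      = - cst (b r ^ 2 / 2) * up l S r * shift (wtshift l r) (up l S r) * shift (\<lambda>i. 2 * wtshift l r i) g"
    and "quad (elem_mat l (l + r - 1) (r - 1)) g
      = cst (inverse (b r ^ 2) / 2) * down l S r * shift (\<lambda>i. - wtshift l r i) (down l S r)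
        * shift (\<lambda>i. - 2 * wtshift l r i) g"
proof -
  obtain k where k: "r = Suc k" "k < l" using assms by (cases r) auto
  have s: "(\<lambda>i. wtshift l r i + wtshift l r i) = (\<lambda>i. 2 * wtshift l r i)"
    "(\<lambda>i. - wtshift l r i - wtshift l r i) = (\<lambda>i. - 2 * wtshift l r i)" by auto
  have "quad (elem_mat l (r - 1) (l + r - 1)) g = cst (- 1/2) * xop r (xop r g)"
    using k by (simp add: quad_elem_mat wop_def)
  also have "\<dots> = cst (- 1/2 * b r * b r) * up l S r * shift (wtshift l r) (up l S r) * shift (\<lambda>i. 2 * wtshift l r i) g"
    by (simp only: cst_mult) (simp add: xop_def shift_shift s mult_ac)
  finally show "quad (elem_mat l (r - 1) (l + r - 1)) g
      = - cst (b r ^ 2 / 2) * up l S r * shift (wtshift l r) (up l S r) * shift (\<lambda>i. 2 * wtshift l r i) g"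
    by (simp add: power2_eq_square cst_minus)
  have "quad (elem_mat l (l + r - 1) (r - 1)) g = cst (1/2) * dop r (dop r g)"
    using k by (simp add: quad_elem_mat wop_def)
  also have "\<dots> = cst (1/2 * inverse (b r) * inverse (b r)) * down l S r * shift (\<lambda>i. - wtshift l r i) (down l S r) * shift (\<lambda>i. - 2 * wtshift l r i) g"
    by (simp only: cst_mult) (simp add: dop_def shift_shift s mult_ac)
  finally show "quad (elem_mat l (l + r - 1) (r - 1)) g
      = cst (inverse (b r ^ 2) / 2) * down l S r * shift (\<lambda>i. - wtshift l r i) (down l S r)
        * shift (\<lambda>i. - 2 * wtshift l r i) g"
    by (simp add: power2_eq_square)
qed

text \<open>Each of the two matrix units contributes half of x_k times the derivative in direction k
  + 1; the factors commute, and the difference of their shifts is that of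
  \<open>sigma k\<close>.\<close>

lemma quad_short:
  assumes "k \<in> {1..l}" "k < l"
  shows "quad (chev_e l k) g
      = cst (b k * inverse (b (k + 1))) * up l S k * down l S (k + 1) * sigma k g"
    and "quad (chev_f l k) g
      = cst (b (k + 1) * inverse (b k)) * down l S k * up l S (k + 1) * sigma_inv k g"
proof -
  obtain j where j: "k = Suc j" "Suc j < l" using assms by (cases k) auto
  have h: "cst (1/2) * p + cst (1/2) * p = p" for p
    by (simp flip: cst_add distrib_right)
  have sh: "(\<lambda>i. wtshift l k i - wtshift l (Suc k) i) = (\<lambda>i. of_bool (k = i))"
    "(\<lambda>i. wtshift l (Suc k) i - wtshift l k i) = (\<lambda>i. - of_bool (k = i))"
    using assms by (auto simp: wtshift_def fun_eq_iff)
  have "quad (chev_e l k) g = xop k (dop (Suc k) g)"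
    using j dop_xop[of "Suc k" k g]
    by (simp add: chev_e_def quad_mat_minus quad_elem_mat wop_def cst_minus h)
  then show "quad (chev_e l k) g
      = cst (b k * inverse (b (k + 1))) * up l S k * down l S (k + 1) * sigma k g"
    using assms by (simp add: xop_def dop_def shift_up_down shift_shift sh sigma_eq_shift cst_mult mult_ac)
  have "quad (chev_f l k) g = xop (Suc k) (dop k g)"
    using j dop_xop[of k "Suc k" g]
    by (simp add: chev_f_def quad_mat_minus quad_elem_mat wop_def cst_minus h)
  then show "quad (chev_f l k) g
      = cst (b (k + 1) * inverse (b k)) * down l S k * up l S (k + 1) * sigma_inv k g"
    using assms by (simp add: xop_def dop_def shift_up_down shift_shift sh sigma_inv_def cst_mult mult_ac)
qed

text \<open>Here e_l acts as -1/2 times the square of x_l. Matching with \<open>EF_last\<close>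
  gives two different formulas for a, since for l not in S the definition already contains the
  factor 1/4.\<close>

lemma quad_last:
  assumes "2 \<le> l" "a = (if l \<in> S then - (b l)\<^sup>2 / 2 else 2 * (b l)\<^sup>2)" and g: "g \<in> polys l"
  shows "quad (chev_e l l) g = fst (EF l (\<lambda>_. a) S l) * sigma l g"
    and "quad (chev_f l l) g = snd (EF l (\<lambda>_. a) S l) * sigma_inv l g"
proof -
  have bl: "b l \<noteq> 0" "l \<in> {1..l}" using b[of l] assms(1) by auto
  \<comment> \<open>Beyond index l the doubled shift differs from \<open>sigma l\<close>, so the
    argument must lie in \<open>polys l\<close>.\<close>
  have "shift (\<lambda>i. 2 * wtshift l l i) p = sigma l p" "shift (\<lambda>i. - 2 * wtshift l l i) p = sigma_inv l p"
    if "p \<in> polys l" for p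
    unfolding sigma_eq_shift sigma_inv_def shift_def
    using that by (auto simp: wtshift_def intro!: poly_subst_cong)
  then have sh: "shift (\<lambda>i. 2 * wtshift l l i) g = sigma l g"
    "shift (\<lambda>i. - 2 * wtshift l l i) g = sigma_inv l g"
    using g by auto
  have h: "cst (1/2) + 1 = cst (3/2)" by (simp flip: cst_1 cst_add)
  have e: "chev_e l l = elem_mat l (l - 1) (l + l - 1)" "chev_f l l = elem_mat l (l + l - 1) (l - 1)"
    by (simp_all add: chev_e_def chev_f_def mult_2)
  have up: "up l S l * shift (wtshift l l) (up l S l) = (if l \<in> S then 1
      else (wt l l - cst (3/2)) * (wt l l - cst (1/2)))"
    using bl h by (simp add: up_def shift_wt algebra_simps)
  have down: "down l S l * shift (\<lambda>i. - wtshift l l i) (down l S l) = (if l \<in> S then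
      (wt l l + cst (3/2)) * (wt l l + cst (1/2)) else 1)"
    using bl h by (simp add: down_def shift_wt add.assoc add.commute[of 1] mult.commute)
  have c: "inverse a / 4 = - (inverse (b l ^ 2) / 2)" if "l \<in> S"
    using bl assms that by (simp add: field_simps)
  have c': "inverse a = inverse (b l ^ 2) / 2" if "l \<notin> S"
    using bl assms that by (simp add: field_simps)
  show "quad (chev_e l l) g = fst (EF l (\<lambda>_. a) S l) * sigma l g"
    unfolding e quad_long(1)[OF bl(2), of g] sh EF_last[OF assms(1)]
      mult.assoc[of _ "up l S l"] up using assms(2)
    by (simp add: cst_minus mult.assoc)
  show "quad (chev_f l l) g = snd (EF l (\<lambda>_. a) S l) * sigma_inv l g"
    unfolding e quad_long(2)[OF bl(2), of g] sh EF_last[OF assms(1)]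
      mult.assoc[of _ "down l S l"] down
    by (simp add: cst_minus c c' mult.assoc)
qed

lemma quad_is_M:
  assumes "2 \<le> l" and "\<And>k. k \<in> {1..<l} \<Longrightarrow> a k = b k * inverse (b (k + 1))"
    and "a l = (if l \<in> S then - (b l)\<^sup>2 / 2 else 2 * (b l)\<^sup>2)"
  shows "is_M l a S quad"
proof -
  have "quad (chev_e l i) g = fst (EF l a S i) * sigma i g \<and>
        quad (chev_f l i) g = snd (EF l a S i) * inv_into (polys l) (sigma i) g"
    if i: "i \<in> {1..l}" and g: "g \<in> polys l" for i g
  proof (cases "i = l")
    case True
    have "EF l a S l = EF l (\<lambda>_. a l) S l" by (simp add: EF_last assms(1))
    then show ?thesis using True quad_last[OF assms(1,3) g] g by (simp add: inv_into_sigma)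
  next
    case False
    then have "i < l" using i by auto
    then show ?thesis
      using quad_short[OF i, of g] EF_less[OF i, of a S] i g assms(2)[of i]
      by (simp add: inv_into_sigma field_simps)
  qed
  then show ?thesis
    unfolding is_M_def using quad_module quad_coweight assms(1) by blast
qed

end

text \<open>The equations for b are solved downwards from l; only the square of \<open>b l\<close>
  is prescribed, so a complex square root suffices.\<close>

lemma oscillator_params:
  assumes "2 \<le> l" "is_param l a S"
  obtains b where "oscillator l b" "\<And>k. k \<in> {1..<l} \<Longrightarrow> a k = b k * inverse (b (k + 1))"
    "a l = (if l \<in> S then - (b l)\<^sup>2 / 2 else 2 * (b l)\<^sup>2)"
proof -
  have nz: "a k \<noteq> 0" if "k \<in> {1..l}" for k using assms(2) that by (auto simp: is_param_def)
  define c where "c = csqrt (if l \<in> S then - 2 * a l else a l / 2)"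
  have c: "c\<^sup>2 = (if l \<in> S then - 2 * a l else a l / 2)" by (simp add: c_def)
  define b where "b k = c * (\<Prod>j = k..<l. a j)" for k
  have "c \<noteq> 0" using c nz[of l] assms(1) by (auto split: if_splits)
  then have b: "b k \<noteq> 0" if "k \<in> {1..l}" for k
    using that by (auto simp: b_def prod_zero_iff intro!: nz)
  show ?thesis
  proof
    show "oscillator l b" by unfold_locales (rule b)
    show "a k = b k * inverse (b (k + 1))" if k: "k \<in> {1..<l}" for k
    proof -
      have "b k = a k * b (k + 1)"
        using k by (simp add: b_def prod.atLeast_Suc_lessThan)
      then show ?thesis using b[of "k + 1"] k by simp
    qed
    show "a l = (if l \<in> S then - (b l)\<^sup>2 / 2 else 2 * (b l)\<^sup>2)"
      using c by (simp add: b_def power_mult_distrib)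
  qed
qed

section \<open>Generation by the Chevalley generators\<close>

lemma sp_carrier: "X \<in> sp l \<Longrightarrow> X \<in> carrier_mat (2*l) (2*l)"
  by (simp add: sp_def)

lemma sp_add: "X \<in> sp l \<Longrightarrow> Y \<in> sp l \<Longrightarrow> X + Y \<in> sp l"
  unfolding sp_iff by auto

lemma sp_smult: "X \<in> sp l \<Longrightarrow> c \<cdot>\<^sub>m X \<in> sp l"
  unfolding sp_iff by auto

text \<open>The statement that the e_i and f_i generate \<open>sp l\<close>, phrased for predicates.
  It is applied with \<open>P\<close> expressing that two module structures agree.\<close>

locale sp_closed =
  fixes l :: nat and P :: "complex mat \<Rightarrow> bool"
  assumes l: "1 \<le> l"
    and add: "X \<in> sp l \<Longrightarrow> Y \<in> sp l \<Longrightarrow> P X \<Longrightarrow> P Y \<Longrightarrow> P (X + Y)"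
    and smult: "X \<in> sp l \<Longrightarrow> P X \<Longrightarrow> P (c \<cdot>\<^sub>m X)"
    and bracket: "X \<in> sp l \<Longrightarrow> Y \<in> sp l \<Longrightarrow> P X \<Longrightarrow> P Y \<Longrightarrow> P (lie_bracket X Y)"
    and chev: "i \<in> {1..l} \<Longrightarrow> P (chev_e l i)" "i \<in> {1..l} \<Longrightarrow> P (chev_f l i)"
begin

text \<open>With \<open>up_mat\<close> and \<open>low_mat\<close>, for distinct indices, the root
  vectors of \<epsilon>_r - \<epsilon>_s and of plus or minus \<epsilon>_r + \<epsilon>_s. For equal
  indices, \<open>gl_mat\<close> is diagonal and the other two are twice a long root vector.\<close>

definition gl_mat :: "nat \<Rightarrow> nat \<Rightarrow> complex mat" where
  "gl_mat r s = elem_mat l r s - elem_mat l (l + s) (l + r)"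

definition up_mat :: "nat \<Rightarrow> nat \<Rightarrow> complex mat" where
  "up_mat r s = elem_mat l r (l + s) + elem_mat l s (l + r)"

definition low_mat :: "nat \<Rightarrow> nat \<Rightarrow> complex mat" where
  "low_mat r s = elem_mat l (l + r) s + elem_mat l (l + s) r"

lemma mat_index:
  assumes "i < 2*l" "j < 2*l"
  shows "gl_mat r s $$ (i, j) = of_bool (i = r \<and> j = s) - of_bool (i = l + s \<and> j = l + r)"
    "up_mat r s $$ (i, j) = of_bool (i = r \<and> j = l + s) + of_bool (i = s \<and> j = l + r)"
    "low_mat r s $$ (i, j) = of_bool (i = l + r \<and> j = s) + of_bool (i = l + s \<and> j = r)"
  using assms by (simp_all add: gl_mat_def up_mat_def low_mat_def elem_mat_index)

lemma mat_carrier: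
  "gl_mat r s \<in> carrier_mat (2*l) (2*l)" "up_mat r s \<in> carrier_mat (2*l) (2*l)"
  "low_mat r s \<in> carrier_mat (2*l) (2*l)"
  by (auto simp: gl_mat_def up_mat_def low_mat_def)

lemma mat_in_sp:
  assumes "r < l" "s < l"
  shows "gl_mat r s \<in> sp l" "up_mat r s \<in> sp l" "low_mat r s \<in> sp l"
  using assms unfolding sp_iff
  by (intro conjI allI impI; simp add: mat_carrier mat_index conj_commute add.commute)+

lemma elem_mat_mult_index:
  assumes "X \<in> carrier_mat (2*l) (2*l)" "r < 2*l" "s < 2*l" "i < 2*l" "j < 2*l"
  shows "(elem_mat l r s * X) $$ (i, j) = of_bool (i = r) * X $$ (s, j)"
    "(X * elem_mat l r s) $$ (i, j) = X $$ (i, r) * of_bool (j = s)"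
proof -
  have "(elem_mat l r s * X) $$ (i, j) = (\<Sum>k = 0..<2*l. of_bool (i = r \<and> k = s) * X $$ (k, j))"
    using assms by (simp add: scalar_prod_def elem_mat_index)
  also have "\<dots> = (\<Sum>k = 0..<2*l. if k = s then of_bool (i = r) * X $$ (s, j) else 0)"
    by (intro sum.cong) auto
  finally show "(elem_mat l r s * X) $$ (i, j) = of_bool (i = r) * X $$ (s, j)"
    using assms by simp
  have "(X * elem_mat l r s) $$ (i, j) = (\<Sum>k = 0..<2*l. X $$ (i, k) * of_bool (k = r \<and> j = s))"
    using assms by (simp add: scalar_prod_def elem_mat_index)
  also have "\<dots> = (\<Sum>k = 0..<2*l. if k = r then X $$ (i, r) * of_bool (j = s) else 0)"
    by (intro sum.cong) auto
  finally show "(X * elem_mat l r s) $$ (i, j) = X $$ (i, r) * of_bool (j = s)"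
    using assms by simp
qed

lemma bracket_index:
  assumes X: "X \<in> carrier_mat (2*l) (2*l)" and rs: "r < l" "s < l" and ij: "i < 2*l" "j < 2*l"
  shows "lie_bracket (gl_mat r s) X $$ (i, j) =
      of_bool (i = r) * X $$ (s, j) - of_bool (i = l + s) * X $$ (l + r, j)
      - (X $$ (i, r) * of_bool (j = s) - X $$ (i, l + s) * of_bool (j = l + r))"
proof -
  have *: "l + r < 2*l" "l + s < 2*l" "r < 2*l" "s < 2*l" using rs by auto
  note c = elem_mat_carrier[of l] and idx = elem_mat_mult_index[OF X]
  have "lie_bracket (gl_mat r s) X = (elem_mat l r s * X - elem_mat l (l + s) (l + r) * X)
      - (X * elem_mat l r s - X * elem_mat l (l + s) (l + r))"
    unfolding lie_bracket_def gl_mat_def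
    by (simp only: minus_mult_distrib_mat[OF c c X] mult_minus_distrib_mat[OF X c c])
  then show "lie_bracket (gl_mat r s) X $$ (i, j) =
      of_bool (i = r) * X $$ (s, j) - of_bool (i = l + s) * X $$ (l + r, j)
      - (X $$ (i, r) * of_bool (j = s) - X $$ (i, l + s) * of_bool (j = l + r))"
    using ij * X by (simp add: idx del: index_mult_mat(1))
qed

lemma bracket_index_right:
  assumes X: "X \<in> carrier_mat (2*l) (2*l)" and rs: "r < l" "s < l" and ij: "i < 2*l" "j < 2*l"
  shows "lie_bracket X (gl_mat r s) $$ (i, j) =
      X $$ (i, r) * of_bool (j = s) - X $$ (i, l + s) * of_bool (j = l + r)
      - (of_bool (i = r) * X $$ (s, j) - of_bool (i = l + s) * X $$ (l + r, j))"
proof -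
  have "lie_bracket X (gl_mat r s) $$ (i, j) = - (lie_bracket (gl_mat r s) X $$ (i, j))"
    using X ij mat_carrier(1)[of r s] by (simp add: lie_bracket_def del: index_mult_mat(1))
  then show ?thesis unfolding bracket_index[OF assms] by simp
qed

lemma bracket_elem_index:
  assumes X: "X \<in> carrier_mat (2*l) (2*l)" and "r < 2*l" "s < 2*l" "i < 2*l" "j < 2*l"
  shows "lie_bracket (elem_mat l r s) X $$ (i, j) =
      of_bool (i = r) * X $$ (s, j) - X $$ (i, r) * of_bool (j = s)"
  using assms by (simp add: lie_bracket_def elem_mat_mult_index[OF X] del: index_mult_mat(1))

lemma bracket_eqI:
  assumes "X \<in> carrier_mat (2*l) (2*l)" "Y \<in> carrier_mat (2*l) (2*l)" "Z \<in> carrier_mat (2*l) (2*l)"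
    and "\<And>i j. i < 2*l \<Longrightarrow> j < 2*l \<Longrightarrow> lie_bracket X Y $$ (i, j) = Z $$ (i, j)"
  shows "lie_bracket X Y = Z"
  using assms bracket_dim[OF assms(1,2)] by (intro eq_matI) auto

lemmas bracket_simps = bracket_index bracket_index_right bracket_elem_index
  mat_carrier mat_index elem_mat_index of_bool_conj

lemma bracket_gl_gl:
  assumes "r < l" "s < l" "t < l" "r \<noteq> t"
  shows "lie_bracket (gl_mat r s) (gl_mat s t) = gl_mat r t"
  using assms by (intro bracket_eqI mat_carrier) (simp_all add: bracket_simps)

lemma bracket_gl_up:
  assumes "r < l" "s < l" "t < l" "r \<noteq> s" "s \<noteq> t"
  shows "lie_bracket (gl_mat r s) (up_mat s t) = up_mat r t"
  using assms by (intro bracket_eqI mat_carrier) (simp_all add: bracket_simps)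

lemma bracket_gl_up_same:
  assumes "r < l" "s < l" "r \<noteq> s"
  shows "lie_bracket (gl_mat r s) (elem_mat l s (l + s)) = up_mat r s"
  using assms
  by (intro bracket_eqI mat_carrier elem_mat_carrier) (simp_all add: bracket_simps)

lemma bracket_low_gl:
  assumes "r < l" "s < l" "t < l" "r \<noteq> s" "r \<noteq> t"
  shows "lie_bracket (low_mat r t) (gl_mat r s) = low_mat s t"
  using assms by (intro bracket_eqI mat_carrier) (simp_all add: bracket_simps)

lemma bracket_low_gl_same:
  assumes "r < l" "s < l" "r \<noteq> s"
  shows "lie_bracket (elem_mat l (l + r) r) (gl_mat r s) = low_mat s r"
  using assms
  by (intro bracket_eqI mat_carrier elem_mat_carrier) (simp_all add: bracket_simps)

lemma bracket_elem_elem: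
  assumes "r < l"
  shows "lie_bracket (elem_mat l r (l + r)) (elem_mat l (l + r) r) = gl_mat r r"
  using assms
  by (intro bracket_eqI mat_carrier elem_mat_carrier) (simp_all add: bracket_simps)

lemma elem_mat_eq:
  "elem_mat l r (l + r) = (1/2) \<cdot>\<^sub>m up_mat r r" "elem_mat l (l + r) r = (1/2) \<cdot>\<^sub>m low_mat r r"
  by (auto intro!: eq_matI simp: up_mat_def low_mat_def)

lemma elem_mat_in_sp:
  assumes "r < l"
  shows "elem_mat l r (l + r) \<in> sp l" "elem_mat l (l + r) r \<in> sp l"
  unfolding elem_mat_eq by (intro sp_smult mat_in_sp assms)+

text \<open>Neighbouring indices give Chevalley generators; larger distances follow by bracketing
  with one more generator.\<close>

lemma gl_mat_closed_neq:
  assumes "r < l" "s < l" "r \<noteq> s"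
  shows "P (gl_mat r s)"
proof -
  have 1: "P (gl_mat r (r + Suc d)) \<and> P (gl_mat (r + Suc d) r)" if "r + Suc d < l" for r d
    using that
  proof (induction d)
    case 0
    then have "gl_mat r (Suc r) = chev_e l (Suc r)" "gl_mat (Suc r) r = chev_f l (Suc r)"
      by (simp_all add: gl_mat_def chev_e_def chev_f_def)
    with 0 chev(1)[of "Suc r"] chev(2)[of "Suc r"] show ?case by simp
  next
    case (Suc d)
    let ?s = "r + Suc d" and ?t = "r + Suc (Suc d)"
    have st: "gl_mat ?s ?t = chev_e l ?t" "gl_mat ?t ?s = chev_f l ?t"
      using Suc.prems by (simp_all add: gl_mat_def chev_e_def chev_f_def)
    have "P (lie_bracket (gl_mat r ?s) (gl_mat ?s ?t))" "P (lie_bracket (gl_mat ?t ?s) (gl_mat ?s r))"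
      using Suc chev(1)[of ?t] chev(2)[of ?t] by (intro bracket mat_in_sp; simp add: st del: add_Suc_right)+
    then show ?case
      using Suc.prems bracket_gl_gl[of r ?s ?t] bracket_gl_gl[of ?t ?s r] by simp
  qed
  consider d where "s = r + Suc d" | d where "r = s + Suc d"
    using assms(3) by (metis add_Suc_right less_imp_Suc_add linorder_neqE_nat)
  then show ?thesis
    by cases (use 1 assms in blast)+
qed

text \<open>The long root vectors at node l are generators. Bracketing with \<open>gl_mat\<close>
  moves first one index and then the other away from the last position.\<close>

lemma up_low_mat_closed:
  assumes "r < l" "s < l"
  shows "P (up_mat r s)" "P (low_mat r s)"
proof -
  let ?m = "l - 1"
  have m: "?m < l" "2 * l - 1 = l + (l - 1)" using l by auto
  have mm: "P (elem_mat l ?m (l + ?m))" "P (elem_mat l (l + ?m) ?m)"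
    using chev(1)[of l] chev(2)[of l] l unfolding chev_e_def chev_f_def m(2) by simp_all
  have sym: "up_mat r s = up_mat s r" "low_mat r s = low_mat s r" for r s
    unfolding up_mat_def low_mat_def by (auto intro!: comm_add_mat)
  have rm: "P (up_mat r ?m)" "P (low_mat r ?m)" if r: "r < l" for r
  proof -
    have dbl: "up_mat ?m ?m = 2 \<cdot>\<^sub>m elem_mat l ?m (l + ?m)" "low_mat ?m ?m = 2 \<cdot>\<^sub>m elem_mat l (l + ?m) ?m"
      unfolding elem_mat_eq by (auto intro!: eq_matI)
    show "P (up_mat r ?m)"
    proof (cases "r = ?m")
      case False
      then have "P (lie_bracket (gl_mat r ?m) (elem_mat l ?m (l + ?m)))"
        using r m(1) mm by (intro bracket mat_in_sp gl_mat_closed_neq elem_mat_in_sp)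
      then show ?thesis
        unfolding bracket_gl_up_same[OF r m(1) False] .
    qed (simp only: mm smult elem_mat_in_sp m(1) dbl)
    show "P (low_mat r ?m)"
    proof (cases "r = ?m")
      case False
      then have "P (lie_bracket (elem_mat l (l + ?m) ?m) (gl_mat ?m r))"
        using r m(1) mm(2) by (intro bracket mat_in_sp gl_mat_closed_neq elem_mat_in_sp) metis+
      then show ?thesis
        using bracket_low_gl_same[OF m(1) r] False by simp
    qed (simp only: mm smult elem_mat_in_sp m(1) dbl)
  qed
  show "P (up_mat r s)"
  proof (cases "r = ?m \<or> s = ?m")
    case True
    then show ?thesis using rm assms sym by metis
  next
    case False
    then have "P (lie_bracket (gl_mat r ?m) (up_mat ?m s))"
      using rm(1)[of s] sym(1)[of s ?m] assms m(1) by (intro bracket mat_in_sp gl_mat_closed_neq) auto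
    then show ?thesis using bracket_gl_up[of r ?m s] assms m(1) False by simp
  qed
  show "P (low_mat r s)"
  proof (cases "r = ?m \<or> s = ?m")
    case True
    then show ?thesis using rm assms sym by metis
  next
    case False
    then have "P (lie_bracket (low_mat ?m s) (gl_mat ?m r))"
      using rm(2)[of s] sym(2)[of s ?m] assms m(1) by (intro bracket mat_in_sp gl_mat_closed_neq) auto
    then show ?thesis using bracket_low_gl[of ?m r s] assms m(1) False by simp
  qed
qed

text \<open>The diagonal elements are brackets of opposite long root vectors.\<close>

lemma gl_mat_closed:
  assumes "r < l" "s < l"
  shows "P (gl_mat r s)"
proof (cases "r = s")
  case True
  have "P (elem_mat l r (l + r))" "P (elem_mat l (l + r) r)"
    unfolding elem_mat_eq using assms by (auto intro!: smult mat_in_sp up_low_mat_closed)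
  then have "P (lie_bracket (elem_mat l r (l + r)) (elem_mat l (l + r) r))"
    using assms by (intro bracket elem_mat_in_sp)
  then show ?thesis
    using True assms by (simp add: bracket_elem_elem)
qed (use gl_mat_closed_neq assms in blast)

text \<open>Clearing one nonzero entry (and its mirror image) at a time avoids writing \<open>X\<close> as an
  explicit linear combination.\<close>

lemma all_of_sp:
  assumes "X \<in> sp l"
  shows "P X"
  using assms
proof (induction "card {(i, j). i < 2*l \<and> j < 2*l \<and> X $$ (i, j) \<noteq> 0}" arbitrary: X rule: less_induct)
  case less
  let ?N = "\<lambda>X. {(i, j). i < 2*l \<and> j < 2*l \<and> X $$ (i, j) \<noteq> (0 :: complex)}"
  have fin: "finite (?N X)" for X :: "complex mat"
    by (rule finite_subset[of _ "{..<2*l} \<times> {..<2*l}"]) auto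
  note Xc = sp_carrier[OF less.prems]
  show ?case
  proof (cases "?N X = {}")
    case True
    have "X = 0 \<cdot>\<^sub>m chev_e l 1"
      using True Xc by (intro eq_matI) auto
    then show ?thesis using smult[OF generators_in_sp(1) chev(1), of 1 0] l by simp
  next
    case False
    have step: "P X" if Z: "Z \<in> sp l" "P Z" and c: "i < 2*l" "j < 2*l" "X $$ (i, j) \<noteq> 0" "Z $$ (i, j) = X $$ (i, j)"
      "\<And>i' j'. i' < 2*l \<Longrightarrow> j' < 2*l \<Longrightarrow> X $$ (i', j') = 0 \<Longrightarrow> Z $$ (i', j') = 0" for Z i j
    proof -
      let ?Y = "X + (- 1) \<cdot>\<^sub>m Z"
      have Zc: "Z \<in> carrier_mat (2*l) (2*l)" using Z sp_carrier by blast
      have Y: "?Y \<in> sp l" using Z less.prems by (intro sp_add sp_smult)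
      have "?N ?Y \<subseteq> ?N X" using c(5) Xc Zc by auto
      moreover have "(i, j) \<in> ?N X" "(i, j) \<notin> ?N ?Y" using c Xc Zc by auto
      ultimately have "card (?N ?Y) < card (?N X)" by (intro psubset_card_mono fin) auto
      then have "P ?Y" using less.hyps Y by blast
      then have "P (?Y + Z)" using add[OF Y Z(1)] Z(2) by blast
      moreover have "?Y + Z = X" using Xc Zc by (intro eq_matI) auto
      ultimately show ?thesis by simp
    qed
    have sp: "X $$ (l + r, l + s) = - X $$ (s, r)" "X $$ (r, l + s) = X $$ (s, l + r)"
      "X $$ (l + r, s) = X $$ (l + s, r)" if "r < l" "s < l" for r s
      using less.prems that unfolding sp_iff by blast+
    have gl: "P X" if rs: "r < l" "s < l" "X $$ (r, s) \<noteq> 0" for r s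
    proof (rule step[of "X $$ (r, s) \<cdot>\<^sub>m gl_mat r s" r s])
      show "(X $$ (r, s) \<cdot>\<^sub>m gl_mat r s) $$ (i, j) = 0"
        if "i < 2*l" "j < 2*l" "X $$ (i, j) = 0" for i j
        using rs that sp(1)[of s r] mat_carrier(1)[of r s] by (auto simp: mat_index)
    qed (use rs mat_carrier(1)[of r s] in \<open>auto intro!: sp_smult mat_in_sp smult gl_mat_closed simp: mat_index\<close>)
    from False obtain i j where ij: "i < 2*l" "j < 2*l" "X $$ (i, j) \<noteq> 0" by auto
    consider "i < l" "j < l" | s where "i < l" "j = l + s" "s < l" | r where "i = l + r" "r < l" "j < l"
      | r s where "i = l + r" "j = l + s" "r < l" "s < l"
      using ij(1,2) by (metis add.commute add_less_cancel_right le_Suc_ex less_diff_conv mult_2 not_less)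
    then show ?thesis
    proof cases
      case 1
      then show ?thesis using gl ij by blast
    next
      case 4
      then show ?thesis using gl[of s r] ij sp(1)[of r s] by simp
    next
      case 2
      \<comment> \<open>For equal indices the two matrix units of \<open>up_mat\<close> coincide and
        the entry is 2.\<close>
      let ?c = "X $$ (i, j) / (if i = s then 2 else 1)"
      show ?thesis
      proof (rule step[of "?c \<cdot>\<^sub>m up_mat i s" i j])
        show "(?c \<cdot>\<^sub>m up_mat i s) $$ (i', j') = 0"
          if "i' < 2*l" "j' < 2*l" "X $$ (i', j') = 0" for i' j'
          using 2 that sp(2)[of i s] mat_carrier(2)[of i s] by (auto simp: mat_index)
      qed (use 2 ij mat_carrier(2)[of i s] in \<open>auto intro!: sp_smult mat_in_sp smult up_low_mat_closed simp: mat_index\<close>)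
    next
      case 3
      let ?c = "X $$ (i, j) / (if r = j then 2 else 1)"
      show ?thesis
      proof (rule step[of "?c \<cdot>\<^sub>m low_mat r j" i j])
        show "(?c \<cdot>\<^sub>m low_mat r j) $$ (i', j') = 0"
          if "i' < 2*l" "j' < 2*l" "X $$ (i', j') = 0" for i' j'
        proof -
          have "X $$ (l + r, j) \<noteq> 0" "X $$ (l + j, r) \<noteq> 0"
            using 3 ij(3) sp(3)[of r j] by simp_all
          then have "\<not> (i' = l + r \<and> j' = j)" "\<not> (i' = l + j \<and> j' = r)"
            using that(3) by blast+
          then have "low_mat r j $$ (i', j') = 0"
            unfolding mat_index(3)[OF that(1,2)] by (simp only: of_bool_eq simp_thms add_0_left)
          then show ?thesis using that mat_carrier(3)[of r j] by simp
        qed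
      next
        have "low_mat r j $$ (i, j) = (if r = j then 2 else 1)"
          unfolding mat_index(3)[OF ij(1,2)] using 3 by (auto simp: of_bool_def)
        then show "(?c \<cdot>\<^sub>m low_mat r j) $$ (i, j) = X $$ (i, j)"
          using ij mat_carrier(3)[of r j] by simp
      qed (use 3 ij in \<open>auto intro!: sp_smult mat_in_sp smult up_low_mat_closed\<close>)
    qed
  qed
qed

end

section \<open>Modules that are free of rank one over the Cartan part\<close>

lemma sp_moduleD:
  assumes "sp_module l scale V \<rho>"
  shows "vector_space scale" "module.subspace scale V"
    "\<And>x v. x \<in> sp l \<Longrightarrow> v \<in> V \<Longrightarrow> \<rho> x v \<in> V"
    "\<And>x v w. x \<in> sp l \<Longrightarrow> v \<in> V \<Longrightarrow> w \<in> V \<Longrightarrow> \<rho> x (v + w) = \<rho> x v + \<rho> x w"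
    "\<And>x c v. x \<in> sp l \<Longrightarrow> v \<in> V \<Longrightarrow> \<rho> x (scale c v) = scale c (\<rho> x v)"
    "\<And>x y v. x \<in> sp l \<Longrightarrow> y \<in> sp l \<Longrightarrow> v \<in> V \<Longrightarrow> \<rho> (x + y) v = \<rho> x v + \<rho> y v"
    "\<And>x c v. x \<in> sp l \<Longrightarrow> v \<in> V \<Longrightarrow> \<rho> (c \<cdot>\<^sub>m x) v = scale c (\<rho> x v)"
    "\<And>x y v. x \<in> sp l \<Longrightarrow> y \<in> sp l \<Longrightarrow> v \<in> V \<Longrightarrow>
      \<rho> (lie_bracket x y) v = \<rho> x (\<rho> y v) - \<rho> y (\<rho> x v)"
  using assms unfolding sp_module_def by blast+

section \<open>The action of U(h) on a module\<close>

locale sp_mod =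
  fixes l :: nat and scale :: "complex \<Rightarrow> 'v :: ab_group_add \<Rightarrow> 'v" and V \<rho>
  assumes sp_mod: "sp_module l scale V \<rho>"
begin

lemmas module_simps = sp_moduleD[OF sp_mod]

sublocale vector_space scale by (rule module_simps(1))

lemma V_closed: "0 \<in> V" "v \<in> V \<Longrightarrow> w \<in> V \<Longrightarrow> v + w \<in> V" "v \<in> V \<Longrightarrow> scale c v \<in> V"
  using module_simps(2) unfolding subspace_def by auto

lemma V_sum: "(\<And>x. x \<in> A \<Longrightarrow> f x \<in> V) \<Longrightarrow> sum f A \<in> V"
  by (induction A rule: infinite_finite_induct) (auto intro: V_closed)

lemma action_zero: "x \<in> sp l \<Longrightarrow> \<rho> x 0 = 0"
  using module_simps(5)[of x 0 0] V_closed(1) by simp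

lemma action_sum: "x \<in> sp l \<Longrightarrow> (\<And>i. i \<in> A \<Longrightarrow> f i \<in> V) \<Longrightarrow> \<rho> x (sum f A) = (\<Sum>i\<in>A. \<rho> x (f i))"
  by (induction A rule: infinite_finite_induct) (auto simp: action_zero module_simps(4) V_sum)

lemma action_zero_mat: "v \<in> V \<Longrightarrow> \<rho> (0\<^sub>m (2*l) (2*l)) v = 0"
proof -
  assume v: "v \<in> V"
  have z: "0\<^sub>m (2*l) (2*l) \<in> sp l" unfolding sp_iff by auto
  have "0 \<cdot>\<^sub>m 0\<^sub>m (2*l) (2*l) = (0\<^sub>m (2*l) (2*l) :: complex mat)" by auto
  then show ?thesis using module_simps(7)[OF z v, of 0] by simp
qed

lemma bracket_diag_diag: "lie_bracket (sp_diag l d) (sp_diag l d') = 0\<^sub>m (2*l) (2*l)"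
proof (rule eq_matI)
  fix i j assume "i < dim_row (0\<^sub>m (2*l) (2*l) :: complex mat)" "j < dim_col (0\<^sub>m (2*l) (2*l) :: complex mat)"
  then have ij: "i < 2*l" "j < 2*l" by auto
  show "lie_bracket (sp_diag l d) (sp_diag l d') $$ (i, j) = 0\<^sub>m (2*l) (2*l) $$ (i, j)"
    unfolding bracket_diag_index[OF sp_diag_carrier ij] using ij by (auto simp: sp_diag_def)
qed (simp_all add: bracket_dim)

lemma coweight_commute:
  assumes "i \<in> {1..l}" "j \<in> {1..l}" "v \<in> V"
  shows "\<rho> (coweight l i) (\<rho> (coweight l j) v) = \<rho> (coweight l j) (\<rho> (coweight l i) v)"
  using module_simps(8)[OF generators_in_sp(4)[OF assms(1)] generators_in_sp(4)[OF assms(2)] assms(3)]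
    action_zero_mat[OF assms(3)]
  by (simp add: coweight_def bracket_diag_diag)

abbreviation R :: "nat \<Rightarrow> 'v \<Rightarrow> 'v" where "R i \<equiv> \<rho> (coweight l i)"

lemma R_pow_in: "i \<in> {1..l} \<Longrightarrow> v \<in> V \<Longrightarrow> (R i ^^ n) v \<in> V"
  by (induction n) (simp_all add: module_simps(3) generators_in_sp(4))

lemma R_pow_commute:
  assumes "i \<in> {1..l}" "j \<in> {1..l}" "v \<in> V"
  shows "(R i ^^ n) (R j v) = R j ((R i ^^ n) v)"
  using assms by (induction n) (auto simp: coweight_commute R_pow_in)

text \<open>The monomial part of \<open>Uh_act\<close>, for an arbitrary list of nodes so that
  induction on the list is possible.\<close>

definition mon_act :: "nat list \<Rightarrow> (nat \<Rightarrow> nat) \<Rightarrow> 'v \<Rightarrow> 'v" where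
  "mon_act xs e v = foldr (\<lambda>i. R i ^^ e i) xs v"

lemma mon_act_in: "set xs \<subseteq> {1..l} \<Longrightarrow> v \<in> V \<Longrightarrow> mon_act xs e v \<in> V"
  unfolding mon_act_def by (induction xs) (auto intro: R_pow_in)

text \<open>The additional H_i sits in the middle of the composition; commutativity moves it to the
  front.\<close>

lemma mon_act_Suc:
  assumes "set xs \<subseteq> {1..l}" "distinct xs" "i \<in> {1..l}" "v \<in> V"
  shows "mon_act xs (\<lambda>j. of_bool (j = i) + e j) v
    = (if i \<in> set xs then R i (mon_act xs e v) else mon_act xs e v)"
  using assms
proof (induction xs)
  case (Cons x xs)
  have in_V: "mon_act xs e v \<in> V" using Cons.prems by (intro mon_act_in) auto
  have "mon_act (x # xs) (\<lambda>j. of_bool (j = i) + e j) v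
      = (R x ^^ (of_bool (x = i) + e x)) (if i \<in> set xs then R i (mon_act xs e v) else mon_act xs e v)"
    using Cons by (simp add: mon_act_def)
  moreover have "mon_act (x # xs) e v = (R x ^^ e x) (mon_act xs e v)"
    by (simp add: mon_act_def)
  ultimately show ?case
    using Cons.prems R_pow_commute[of x i "mon_act xs e v" "e x"] in_V by auto
qed (simp add: mon_act_def)

lemma Uh_act_superset:
  assumes "finite A" "Poly_Mapping.keys p \<subseteq> A"
  shows "Uh_act l scale \<rho> p v = (\<Sum>m\<in>A. scale (Poly_Mapping.lookup p m)
      (mon_act [1..<Suc l] (Poly_Mapping.lookup m) v))"
  unfolding Uh_act_def mon_act_def using assms
  by (intro sum.mono_neutral_left) (auto simp: in_keys_iff)

lemma Uh_act_add: "Uh_act l scale \<rho> (p + q) v = Uh_act l scale \<rho> p v + Uh_act l scale \<rho> q v"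
proof -
  let ?A = "Poly_Mapping.keys p \<union> Poly_Mapping.keys q"
  have "Poly_Mapping.keys (p + q) \<subseteq> ?A" by (rule keys_add)
  then show ?thesis
    by (subst (1 2 3) Uh_act_superset[of ?A])
       (auto simp: lookup_add scale_left_distrib sum.distrib)
qed

lemma Uh_act_single:
  "Uh_act l scale \<rho> (Poly_Mapping.single m c) v = scale c (mon_act [1..<Suc l] (Poly_Mapping.lookup m) v)"
  using Uh_act_superset[of "{m}" "Poly_Mapping.single m c" v] by simp

lemma Uh_act_sum: "Uh_act l scale \<rho> (sum f A) v = (\<Sum>x\<in>A. Uh_act l scale \<rho> (f x) v)"
  by (induction A rule: infinite_finite_induct) (auto simp: Uh_act_add, simp_all add: Uh_act_def)

lemma Uh_act_cst: "Uh_act l scale \<rho> (cst c * p) v = scale c (Uh_act l scale \<rho> p v)"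
proof -
  have "cst c * p = cst c * (\<Sum>m \<in> Poly_Mapping.keys p. cst (Poly_Mapping.lookup p m) * monom_of m)"
    by (rule arg_cong[OF cpoly_expansion])
  also have "\<dots> = (\<Sum>m \<in> Poly_Mapping.keys p. Poly_Mapping.single m (c * Poly_Mapping.lookup p m))"
    unfolding sum_distrib_left
    by (intro sum.cong refl) (metis cst_mult cst_mult_monom_of mult.assoc)
  finally have "Uh_act l scale \<rho> (cst c * p) v = (\<Sum>m \<in> Poly_Mapping.keys p.
      scale (c * Poly_Mapping.lookup p m) (mon_act [1..<Suc l] (Poly_Mapping.lookup m) v))"
    by (simp only: Uh_act_sum Uh_act_single)
  then show ?thesis
    unfolding Uh_act_superset[OF finite_keys order.refl, of p] scale_sum_right by simp
qed

text \<open>With additivity and scalars, this makes p -> p v linear over the polynomial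
  ring.\<close>

lemma Uh_act_var:
  assumes "i \<in> {1..l}" "v \<in> V"
  shows "Uh_act l scale \<rho> (var i * p) v = R i (Uh_act l scale \<rho> p v)"
proof -
  have set: "set [1..<Suc l] = {1..l}" by auto
  have e: "Poly_Mapping.lookup (Poly_Mapping.single i 1 + m) = (\<lambda>j. of_bool (j = i) + Poly_Mapping.lookup m j)"
    for m :: "nat \<Rightarrow>\<^sub>0 nat"
    by (auto simp: lookup_add lookup_single when_def fun_eq_iff)
  have M: "mon_act [1..<Suc l] (Poly_Mapping.lookup m) v \<in> V" for m :: "nat \<Rightarrow>\<^sub>0 nat"
    using assms by (intro mon_act_in) auto
  have "var i * p = (\<Sum>m \<in> Poly_Mapping.keys p.
      Poly_Mapping.single (Poly_Mapping.single i 1 + m) (Poly_Mapping.lookup p m))"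
    by (subst cpoly_expansion[of p])
       (simp add: sum_distrib_left cst_mult_monom_of var_def mult_single)
  then have "Uh_act l scale \<rho> (var i * p) v = (\<Sum>m \<in> Poly_Mapping.keys p. scale (Poly_Mapping.lookup p m)
      (mon_act [1..<Suc l] (\<lambda>j. of_bool (j = i) + Poly_Mapping.lookup m j) v))"
    by (simp only: Uh_act_sum Uh_act_single e)
  also have "\<dots> = (\<Sum>m \<in> Poly_Mapping.keys p. scale (Poly_Mapping.lookup p m)
      (R i (mon_act [1..<Suc l] (Poly_Mapping.lookup m) v)))"
    using assms set by (subst mon_act_Suc) auto
  also have "\<dots> = R i (Uh_act l scale \<rho> p v)"
    unfolding Uh_act_superset[OF finite_keys order.refl, of p]
    using assms M by (simp add: action_sum module_simps(5) generators_in_sp V_closed(3))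
  finally show ?thesis .
qed

end

section \<open>Transport of structure to the polynomial ring\<close>

lemma sp_module_transport:
  assumes V: "sp_module l scale V \<rho>" and scale': "vector_space scale'" "module.subspace scale' U"
    and bij: "bij_betw \<psi> U V"
    and add: "\<And>p q. p \<in> U \<Longrightarrow> q \<in> U \<Longrightarrow> \<psi> (p + q) = \<psi> p + \<psi> q"
    and smult: "\<And>c p. p \<in> U \<Longrightarrow> \<psi> (scale' c p) = scale c (\<psi> p)"
  defines "\<rho>' \<equiv> \<lambda>x p. inv_into U \<psi> (\<rho> x (\<psi> p))"
  shows "sp_module l scale' U \<rho>'"
    and "sp_module_iso l scale V \<rho> scale' U \<rho>'"
    and "x \<in> sp l \<Longrightarrow> p \<in> U \<Longrightarrow> \<rho>' x p \<in> U"
    and "x \<in> sp l \<Longrightarrow> p \<in> U \<Longrightarrow> \<psi> (\<rho>' x p) = \<rho> x (\<psi> p)"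
proof -
  interpret sp_mod l scale V \<rho> by unfold_locales (rule V)
  interpret U: vector_space scale' by (rule scale')
  let ?\<phi> = "inv_into U \<psi>"
  have \<psi>V: "\<psi> p \<in> V" if "p \<in> U" for p using bij that by (auto simp: bij_betw_def)
  have \<phi>U: "?\<phi> v \<in> U" and \<psi>\<phi>: "\<psi> (?\<phi> v) = v" if "v \<in> V" for v
    using bij that by (auto simp: bij_betw_def inv_into_into f_inv_into_f)
  have \<phi>\<psi>: "?\<phi> (\<psi> p) = p" if "p \<in> U" for p using bij that by (auto simp: bij_betw_def)
  have Uc: "p \<in> U \<Longrightarrow> q \<in> U \<Longrightarrow> p + q \<in> U" "p \<in> U \<Longrightarrow> scale' c p \<in> U" for p q c
    using scale'(2) unfolding U.subspace_def by auto
  have \<phi>add: "?\<phi> (v + w) = ?\<phi> v + ?\<phi> w" if "v \<in> V" "w \<in> V" for v w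
    using \<phi>\<psi>[of "?\<phi> v + ?\<phi> w"] add[of "?\<phi> v" "?\<phi> w"] that by (simp add: \<phi>U \<psi>\<phi> Uc)
  have \<phi>smult: "?\<phi> (scale c v) = scale' c (?\<phi> v)" if "v \<in> V" for v c
    using \<phi>\<psi>[of "scale' c (?\<phi> v)"] smult[of "?\<phi> v" c] that by (simp add: \<phi>U \<psi>\<phi> Uc)
  have \<phi>diff: "?\<phi> (v - w) = ?\<phi> v - ?\<phi> w" if "v \<in> V" "w \<in> V" for v w
  proof -
    have "v - w = v + scale (- 1) w" by simp
    then show ?thesis using \<phi>add[of v "scale (- 1) w"] \<phi>smult[of w "- 1"] that V_closed(3)[of w "- 1"] by simp
  qed
  show closed: "\<rho>' x p \<in> U" if "x \<in> sp l" "p \<in> U" for x p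
    using that by (simp add: \<rho>'_def \<phi>U \<psi>V module_simps(3))
  show inter: "\<psi> (\<rho>' x p) = \<rho> x (\<psi> p)" if "x \<in> sp l" "p \<in> U" for x p
    using that by (simp add: \<rho>'_def \<psi>\<phi> \<psi>V module_simps(3))
  show "sp_module l scale' U \<rho>'"
    unfolding sp_module_def
  proof (intro conjI ballI allI)
    fix x y p assume xy: "x \<in> sp l" "y \<in> sp l" and p: "p \<in> U"
    show "\<rho>' (lie_bracket x y) p = \<rho>' x (\<rho>' y p) - \<rho>' y (\<rho>' x p)"
      using xy p by (simp add: \<rho>'_def module_simps(3,8) \<psi>V \<psi>\<phi> \<phi>diff)
    show "\<rho>' (x + y) p = \<rho>' x p + \<rho>' y p"
      using xy p by (simp add: \<rho>'_def module_simps(3,6) \<psi>V \<phi>add)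
  next
    fix x p q assume x: "x \<in> sp l" and p: "p \<in> U" "q \<in> U"
    show "\<rho>' x (p + q) = \<rho>' x p + \<rho>' x q"
      using x p by (simp add: \<rho>'_def add module_simps(3,4) \<psi>V \<phi>add)
  next
    fix x c p assume x: "x \<in> sp l" and p: "p \<in> U"
    show "\<rho>' x (scale' c p) = scale' c (\<rho>' x p)" "\<rho>' (c \<cdot>\<^sub>m x) p = scale' c (\<rho>' x p)"
      using x p by (simp_all add: \<rho>'_def smult module_simps(3,5,7) \<psi>V \<phi>smult)
  qed (use scale' closed in auto)
  show "sp_module_iso l scale V \<rho> scale' U \<rho>'"
    unfolding sp_module_iso_def
  proof (intro exI[of _ ?\<phi>] conjI ballI allI)
    show "bij_betw ?\<phi> V U" by (rule bij_betw_inv_into[OF bij])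
  qed (auto simp: \<phi>add \<phi>smult \<rho>'_def \<psi>\<phi>)
qed

text \<open>A free generator v gives the bijection p -> p v; conjugating the action by it turns H_i
  into multiplication.\<close>

lemma in_H_polys:
  assumes "in_H l scale V \<rho>"
  obtains \<rho>' where "sp_module l poly_scale (polys l) \<rho>'"
    "sp_module_iso l scale V \<rho> poly_scale (polys l) \<rho>'"
    "\<And>i g. i \<in> {1..l} \<Longrightarrow> g \<in> polys l \<Longrightarrow> \<rho>' (coweight l i) g = var i * g"
proof -
  obtain v where v: "v \<in> V" "bij_betw (\<lambda>p. Uh_act l scale \<rho> p v) (polys l) V"
    and V: "sp_module l scale V \<rho>"
    using assms unfolding in_H_def by blast
  interpret sp_mod l scale V \<rho> by unfold_locales (rule V)
  let ?\<psi> = "\<lambda>p. Uh_act l scale \<rho> p v"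
  let ?\<rho> = "\<lambda>x p. inv_into (polys l) ?\<psi> (\<rho> x (?\<psi> p))"
  have smult: "?\<psi> (poly_scale c p) = scale c (?\<psi> p)" for c p
    unfolding poly_scale_def by (rule Uh_act_cst)
  note tr = sp_module_transport[where \<psi> = ?\<psi>, OF V poly_scale_vector_space polys_subspace v(2)
      Uh_act_add smult]
  show ?thesis
  proof
    show "?\<rho> (coweight l i) g = var i * g" if "i \<in> {1..l}" "g \<in> polys l" for i g
    proof -
      have "?\<psi> (?\<rho> (coweight l i) g) = ?\<psi> (var i * g)"
        using tr(4)[of "coweight l i" g] that by (simp add: generators_in_sp Uh_act_var v(1))
      moreover have "?\<rho> (coweight l i) g \<in> polys l" "var i * g \<in> polys l"
        using tr(3)[of "coweight l i" g] that by (simp_all add: generators_in_sp polys_mult polys_var)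
      ultimately show ?thesis using v(2) unfolding bij_betw_def inj_on_def by blast
    qed
  qed (rule tr(1), rule tr(2))
qed

section \<open>Uniqueness of M(a, S) and its membership in the category\<close>

lemma is_MD:
  assumes "is_M l a S \<rho>"
  shows "sp_module l poly_scale (polys l) \<rho>"
    "\<And>i g. i \<in> {1..l} \<Longrightarrow> g \<in> polys l \<Longrightarrow> \<rho> (coweight l i) g = var i * g"
    "\<And>i g. i \<in> {1..l} \<Longrightarrow> g \<in> polys l \<Longrightarrow> \<rho> (chev_e l i) g = fst (EF l a S i) * sigma i g"
    "\<And>i g. i \<in> {1..l} \<Longrightarrow> g \<in> polys l \<Longrightarrow> \<rho> (chev_f l i) g = snd (EF l a S i) * sigma_inv i g"
  using assms unfolding is_M_def by (auto simp: inv_into_sigma Hvar_def)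

text \<open>The elements on which two actions agree are closed under sums, scalars and brackets, and
  contain the Chevalley generators.\<close>

lemma is_M_unique:
  assumes "1 \<le> l" and M: "is_M l a S \<rho>" "is_M l a S \<rho>'" and "X \<in> sp l" "g \<in> polys l"
  shows "\<rho> X g = \<rho>' X g"
proof -
  note m = sp_moduleD[OF is_MD(1)[OF M(1)]] and m' = sp_moduleD[OF is_MD(1)[OF M(2)]]
  interpret sp_closed l "\<lambda>X. \<forall>g \<in> polys l. \<rho> X g = \<rho>' X g"
    by unfold_locales
      (use assms(1) in \<open>auto simp: m m' is_MD(3)[OF M(1)] is_MD(3)[OF M(2)] is_MD(4)[OF M(1)] is_MD(4)[OF M(2)]\<close>)
  show ?thesis using all_of_sp assms(4,5) by blast
qed

lemma monom_of_eq_prod: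
  assumes "Poly_Mapping.keys m \<subseteq> A" "finite A"
  shows "monom_of m = (\<Prod>i\<in>A. var i ^ Poly_Mapping.lookup m i)"
proof -
  have "monom_of m = (\<Prod>i\<in>Poly_Mapping.keys m. var i ^ Poly_Mapping.lookup m i)"
    using subst.ev_single[of var m 1] by (simp add: monom_of_def)
  also have "\<dots> = (\<Prod>i\<in>A. var i ^ Poly_Mapping.lookup m i)"
    using assms by (intro prod.mono_neutral_left) (auto simp: in_keys_iff)
  finally show ?thesis .
qed

text \<open>The constant 1 is a free generator, as H acts by multiplication.\<close>

lemma is_M_in_H:
  assumes M: "is_M l a S \<rho>"
  shows "in_H l poly_scale (polys l) \<rho>"
proof -
  have pow: "(\<rho> (coweight l i) ^^ n) g = var i ^ n * g \<and> var i ^ n * g \<in> polys l"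
    if "i \<in> {1..l}" "g \<in> polys l" for i n g
    using that by (induction n) (auto simp: is_MD(2)[OF M] mult.assoc intro!: polys_mult polys_var)
  have fold: "foldr (\<lambda>i. \<rho> (coweight l i) ^^ e i) xs 1 = (\<Prod>i\<in>set xs. var i ^ e i)
      \<and> (\<Prod>i\<in>set xs. var i ^ e i) \<in> polys l"
    if "set xs \<subseteq> {1..l}" "distinct xs" for xs e
    using that by (induction xs) (auto simp: pow)
  have "Uh_act l poly_scale \<rho> p 1 = p" if p: "p \<in> polys l" for p
  proof -
    have "Uh_act l poly_scale \<rho> p 1 = (\<Sum>m \<in> Poly_Mapping.keys p.
        cst (Poly_Mapping.lookup p m) * monom_of m)"
      unfolding Uh_act_def poly_scale_def
    proof (intro sum.cong refl arg_cong2[where f = "(*)"])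
      fix m assume "m \<in> Poly_Mapping.keys p"
      moreover have "set [1..<Suc l] = {1..l}" by auto
      ultimately have keys: "Poly_Mapping.keys m \<subseteq> set [1..<Suc l]" using p unfolding polys_def by blast
      have "set [1..<Suc l] \<subseteq> {1..l}" "distinct [1..<Suc l]" by auto
      from fold[OF this, of "Poly_Mapping.lookup m"]
      show "foldr (\<lambda>i. \<rho> (coweight l i) ^^ Poly_Mapping.lookup m i) [1..<Suc l] 1 = monom_of m"
        by (simp only: monom_of_eq_prod[OF keys finite_set])
    qed
    then show ?thesis using cpoly_expansion[of p] by simp
  qed
  then have "bij_betw (\<lambda>p. Uh_act l poly_scale \<rho> p 1) (polys l) (polys l)"
    by (subst bij_betw_cong[of _ _ "\<lambda>p. p"]) (auto simp: bij_betw_def)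
  then show ?thesis
    unfolding in_H_def using is_MD(1)[OF M] polys_one by blast
qed

section \<open>Simplicity\<close>

text \<open>The strict bound avoids a convention for the degree of 0: at n = 0 only the zero
  polynomial is left.\<close>

definition tdeg_less :: "nat \<Rightarrow> cpoly set" where
  "tdeg_less n = {p. \<forall>m \<in> Poly_Mapping.keys p. (\<Sum>i\<in>Poly_Mapping.keys m. Poly_Mapping.lookup m i) < n}"

lemma tdeg_less_0: "p \<in> tdeg_less 0 \<Longrightarrow> p = 0"
  by (metis (mono_tags, lifting) mem_Collect_eq not_less_zero tdeg_less_def ex_in_conv keys_eq_empty)

lemma tdeg_less_add: "p \<in> tdeg_less n \<Longrightarrow> q \<in> tdeg_less n \<Longrightarrow> p + q \<in> tdeg_less n"
  using keys_add[of p q] by (auto simp: tdeg_less_def)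

lemma tdeg_less_zero [simp]: "0 \<in> tdeg_less n"
  by (simp add: tdeg_less_def)

lemma tdeg_less_sum: "(\<And>x. x \<in> A \<Longrightarrow> f x \<in> tdeg_less n) \<Longrightarrow> sum f A \<in> tdeg_less n"
  by (induction A rule: infinite_finite_induct) (auto intro: tdeg_less_add)

lemma tdeg_less_mono: "p \<in> tdeg_less n \<Longrightarrow> n \<le> k \<Longrightarrow> p \<in> tdeg_less k"
  by (force simp: tdeg_less_def)

lemma tdeg_less_cst: "p \<in> tdeg_less n \<Longrightarrow> cst c * p \<in> tdeg_less n"
  using keys_mult[of "cst c" p] by (auto simp: tdeg_less_def cst_def split: if_splits)

lemma tdeg_less_exists: "\<exists>n. p \<in> tdeg_less n"
  by (rule exI[of _ "Suc (\<Sum>m\<in>Poly_Mapping.keys p. \<Sum>i\<in>Poly_Mapping.keys m. Poly_Mapping.lookup m i)"])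
     (auto simp: tdeg_less_def less_Suc_eq_le intro: member_le_sum)

lemma tdeg_less_var: "p \<in> tdeg_less n \<Longrightarrow> var i * p \<in> tdeg_less (Suc n)"
  unfolding tdeg_less_def
proof safe
  fix m assume p: "\<forall>m\<in>Poly_Mapping.keys p. (\<Sum>i\<in>Poly_Mapping.keys m. Poly_Mapping.lookup m i) < n"
    and m: "m \<in> Poly_Mapping.keys (var i * p)"
  then obtain m' where m': "m = Poly_Mapping.single i 1 + m'" "m' \<in> Poly_Mapping.keys p"
    using keys_mult[of "var i" p] by (auto simp: var_def)
  then have i: "i \<in> Poly_Mapping.keys m" by (simp add: in_keys_iff lookup_add)
  show "(\<Sum>i\<in>Poly_Mapping.keys m. Poly_Mapping.lookup m i) < Suc n"
    using i
  proof (rule exponent_split)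
    fix m'' assume m'': "m = Poly_Mapping.single i 1 + m''"
      "(\<Sum>j\<in>Poly_Mapping.keys m. Poly_Mapping.lookup m j) = Suc (\<Sum>j\<in>Poly_Mapping.keys m''. Poly_Mapping.lookup m'' j)"
    then have "m'' = m'" using m' by simp
    then show ?thesis using p m'(2) m''(2) by auto
  qed
qed

text \<open>Induction on the total exponent. The product rule yields d_i times a shifted smaller
  monomial, so a bound on the monomial itself is proved along with the difference.\<close>

lemma shift_monom_tdeg:
  "shift d (monom_of m) - monom_of m \<in> tdeg_less (\<Sum>i\<in>Poly_Mapping.keys m. Poly_Mapping.lookup m i)
   \<and> monom_of m \<in> tdeg_less (Suc (\<Sum>i\<in>Poly_Mapping.keys m. Poly_Mapping.lookup m i))"
proof (induction "\<Sum>i\<in>Poly_Mapping.keys m. Poly_Mapping.lookup m i" arbitrary: m)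
  case 0
  then have "m = 0"
    by (intro poly_mapping_eqI) (metis finite_keys in_keys_iff lookup_zero sum_eq_0_iff)
  then show ?case by (auto simp: tdeg_less_def)
next
  case (Suc n)
  then have "Poly_Mapping.keys m \<noteq> {}" by auto
  then obtain i where "i \<in> Poly_Mapping.keys m" by blast
  then obtain m' where m': "m = Poly_Mapping.single i 1 + m'"
    "(\<Sum>j\<in>Poly_Mapping.keys m. Poly_Mapping.lookup m j)
      = Suc (\<Sum>j\<in>Poly_Mapping.keys m'. Poly_Mapping.lookup m' j)"
    by (rule exponent_split)
  let ?q = "monom_of m'"
  have n: "(\<Sum>j\<in>Poly_Mapping.keys m'. Poly_Mapping.lookup m' j) = n" using Suc m'(2) by simp
  have IH: "shift d ?q - ?q \<in> tdeg_less n" "?q \<in> tdeg_less (Suc n)"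
    using Suc.hyps(1)[of m'] n by auto
  have eq: "monom_of m = var i * ?q"
    unfolding m'(1) by (simp only: monom_of_add monom_of_single_1)
  have "shift d ?q = (shift d ?q - ?q) + ?q" by simp
  then have sq: "shift d ?q \<in> tdeg_less (Suc n)"
    using IH tdeg_less_mono[OF IH(1), of "Suc n"] tdeg_less_add by force
  have "shift d (monom_of m) - monom_of m = var i * (shift d ?q - ?q) + cst (- d i) * shift d ?q"
    by (simp add: eq cst_minus algebra_simps)
  also have "\<dots> \<in> tdeg_less (Suc n)"
    by (intro tdeg_less_add tdeg_less_var tdeg_less_cst IH sq)
  finally show ?case using tdeg_less_var[OF IH(2), of i] eq m'(2) n by simp
qed

lemma shift_tdeg:
  assumes "p \<in> tdeg_less (Suc n)"
  shows "shift d p - p \<in> tdeg_less n"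
proof -
  have sum: "shift d (sum f A) = (\<Sum>x\<in>A. shift d (f x))" for f and A :: "(nat \<Rightarrow>\<^sub>0 nat) set"
    by (induction A rule: infinite_finite_induct) auto
  have "shift d p - p = (\<Sum>m \<in> Poly_Mapping.keys p.
      cst (Poly_Mapping.lookup p m) * (shift d (monom_of m) - monom_of m))"
    by (subst (1 2) cpoly_expansion[of p]) (simp add: sum sum_subtractf right_diff_distrib)
  also have "\<dots> \<in> tdeg_less n"
  proof (intro tdeg_less_sum tdeg_less_cst)
    fix m assume "m \<in> Poly_Mapping.keys p"
    then have "(\<Sum>i\<in>Poly_Mapping.keys m. Poly_Mapping.lookup m i) \<le> n"
      using assms by (auto simp: tdeg_less_def)
    then show "shift d (monom_of m) - monom_of m \<in> tdeg_less n"
      using shift_monom_tdeg[of d m] tdeg_less_mono by blast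
  qed
  finally show ?thesis .
qed

text \<open>The doubled shifts in the h_k generate some nonzero multiple of the shift of each H_j,
  so no variable can occur.\<close>

lemma shift_invariant_imp_cst:
  assumes g: "g \<in> polys l" and inv: "\<And>r. r \<in> {1..l} \<Longrightarrow> shift (\<lambda>i. 2 * wtshift l r i) g = g"
  shows "\<exists>c. g = cst c"
proof (rule deg_eq_0_imp_cst)
  fix j
  show "deg j g = 0"
  proof (cases "j \<in> {1..l}")
    case False
    have "sigma j g = shift (\<lambda>_. 0) g"
      unfolding sigma_eq_shift shift_def using False by (intro poly_subst_cong[OF g]) auto
    then show ?thesis by (simp add: sigma_invariant_iff)
  next
    case True
    show ?thesis
    proof (cases "j = l")
      case True
      have "sigma l g = shift (\<lambda>i. 2 * wtshift l l i) g"
        unfolding sigma_eq_shift shift_def by (intro poly_subst_cong[OF g]) (auto simp: wtshift_def)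
      then show ?thesis using inv[of l] True \<open>j \<in> {1..l}\<close> sigma_invariant_iff by simp
    next
      case False
      have 1: "shift (\<lambda>i. 2 * wtshift l j i) g = g" "shift (\<lambda>i. 2 * wtshift l (Suc j) i) g = g"
        using inv True False by auto
      have "g = shift (\<lambda>i. - (2 * wtshift l (Suc j) i)) (shift (\<lambda>i. 2 * wtshift l (Suc j) i) g)"
        by (simp only: shift_shift) simp
      then have 2: "shift (\<lambda>i. - (2 * wtshift l (Suc j) i)) g = g" using 1 by simp
      \<comment> \<open>The shifts for h_j and h_(j+1) differ only at H_j; in particular their
        entries 1/2 at H_l cancel.\<close>
      have "sigma j (sigma j g) = shift (\<lambda>i. - (2 * wtshift l (Suc j) i)) (shift (\<lambda>i. 2 * wtshift l j i) g)"
        unfolding sigma_eq_shift shift_shift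
        using False by (intro arg_cong2[where f = shift]) (auto simp: wtshift_def fun_eq_iff)
      also have "\<dots> = g" using 1 2 by simp
      finally show ?thesis using sigma_pow_invariant[where n = 2 and p = g] by (simp add: numeral_2_eq_2)
    qed
  qed
qed

text \<open>Every long root vector is, for one of its two signs, a pure shift; applied to a nonzero
  element of least total degree such shifts can only fix it.\<close>

lemma is_M_simple:
  assumes l: "2 \<le> l" and par: "is_param l a S" and M: "is_M l a S \<rho>"
  shows "sp_simple l poly_scale (polys l) \<rho>"
proof -
  obtain b where b: "oscillator l b" "\<And>k. k \<in> {1..<l} \<Longrightarrow> a k = b k * inverse (b (k + 1))"
    "a l = (if l \<in> S then - (b l)\<^sup>2 / 2 else 2 * (b l)\<^sup>2)"
    using oscillator_params[OF l par] by blast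
  interpret osc: oscillator l b S by (rule b)
  \<comment> \<open>The trivial predicate only opens access to the facts on root vectors.\<close>
  interpret sp: sp_closed l "\<lambda>_. True" using l by unfold_locales auto
  have \<rho>: "\<rho> X g = osc.quad X g" if "X \<in> sp l" "g \<in> polys l" for X g
    using is_M_unique[OF _ M osc.quad_is_M] b l that by auto
  interpret vs: vector_space poly_scale by (rule poly_scale_vector_space)
  have "W = polys l" if W: "W \<subseteq> polys l" "module.subspace poly_scale W"
    "\<forall>x \<in> sp l. \<forall>w \<in> W. \<rho> x w \<in> W" "W \<noteq> {0}" for W
  proof -
    have add: "p \<in> W \<Longrightarrow> q \<in> W \<Longrightarrow> p + q \<in> W" and zero: "0 \<in> W"
      and scale: "p \<in> W \<Longrightarrow> cst c * p \<in> W" for p q c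
      using W(2) unfolding vs.subspace_def poly_scale_def by auto
    have diff: "p - q \<in> W" if "p \<in> W" "q \<in> W" for p q
      using add[OF that(1) scale[OF that(2), of "- 1"]] by (simp add: cst_minus)
    have var: "var i * p \<in> W" if "i \<in> {1..l}" "p \<in> W" for i p
      using W(1,3) generators_in_sp(4)[OF that(1)] is_MD(2)[OF M that(1), of p] that by fastforce
    have mult: "p * w \<in> W" if "p \<in> polys l" "w \<in> W" for p w
      using that by (induction p rule: polys_induct) (auto simp: distrib_right mult.assoc intro: add scale var)
    have shift: "shift (\<lambda>i. (if r \<in> S then 2 else - 2) * wtshift l r i) w \<in> W"
      if r: "r \<in> {1..l}" and w: "w \<in> W" for r w
    proof -
      have r1: "r - 1 < l" "l + r - 1 = l + (r - 1)" using r by auto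
      have br: "b r \<noteq> 0" using osc.b r by blast
      show ?thesis
      proof (cases "r \<in> S")
        case True
        have "\<rho> (elem_mat l (r - 1) (l + r - 1)) w \<in> W"
          using sp.elem_mat_in_sp(1)[OF r1(1)] W(3) w unfolding r1(2) by blast
        then have "- cst ((b r)\<^sup>2 / 2) * shift (\<lambda>i. 2 * wtshift l r i) w \<in> W"
          using \<rho> sp.elem_mat_in_sp(1)[OF r1(1)] W(1) w osc.quad_long(1)[OF r, of w] True
          unfolding r1(2) by (auto simp: up_def)
        from scale[OF this, of "- 2 / (b r)\<^sup>2"] show ?thesis
          using br True by (simp add: mult.assoc[symmetric] flip: cst_mult cst_minus)
      next
        case False
        have "\<rho> (elem_mat l (l + r - 1) (r - 1)) w \<in> W"
          using sp.elem_mat_in_sp(2)[OF r1(1)] W(3) w unfolding r1(2) by blast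
        then have "cst (inverse ((b r)\<^sup>2) / 2) * shift (\<lambda>i. - 2 * wtshift l r i) w \<in> W"
          using \<rho> sp.elem_mat_in_sp(2)[OF r1(1)] W(1) w osc.quad_long(2)[OF r, of w] False
          unfolding r1(2) by (auto simp: down_def)
        from scale[OF this, of "2 * (b r)\<^sup>2"] show ?thesis
          using br False by (simp add: mult.assoc[symmetric] flip: cst_mult cst_minus)
      qed
    qed
    have ex: "\<exists>n. \<exists>g. g \<in> W \<and> g \<noteq> 0 \<and> g \<in> tdeg_less n"
      using W(4) zero tdeg_less_exists by blast
    define n where "n = (LEAST n. \<exists>g. g \<in> W \<and> g \<noteq> 0 \<and> g \<in> tdeg_less n)"
    obtain g where g: "g \<in> W" "g \<noteq> 0" "g \<in> tdeg_less n"
      using LeastI_ex[OF ex] unfolding n_def by blast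
    obtain n' where n': "n = Suc n'"
      using g tdeg_less_0 by (cases n) auto
    have fixed: "shift (\<lambda>i. (if r \<in> S then 2 else - 2) * wtshift l r i) g = g" (is "?sg = g")
      if r: "r \<in> {1..l}" for r
    proof (rule ccontr)
      assume "?sg \<noteq> g"
      moreover have "?sg - g \<in> W" using shift[OF r g(1)] g(1) by (rule diff)
      moreover have "?sg - g \<in> tdeg_less n'" using g(3) n' shift_tdeg by simp
      ultimately have "n \<le> n'" unfolding n_def by (intro Least_le) (auto intro!: exI[of _ "?sg - g"])
      then show False using n' by simp
    qed
    have "shift (\<lambda>i. 2 * wtshift l r i) g = g" if r: "r \<in> {1..l}" for r
    proof (cases "r \<in> S")
      case True
      then show ?thesis using fixed[OF r] by simp
    next
      case False
      have "shift (\<lambda>i. 2 * wtshift l r i) (shift (\<lambda>i. - 2 * wtshift l r i) g) = g"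
        by (simp only: shift_shift) simp
      then show ?thesis using fixed[OF r] False by simp
    qed
    then obtain c where c: "g = cst c" using shift_invariant_imp_cst g(1) W(1) by blast
    have "cst (inverse c) * g \<in> W" using g(1) scale by blast
    moreover have "cst (inverse c) * g = 1" using c g(2) by (simp flip: cst_mult)
    ultimately have "1 \<in> W" by simp
    then show "W = polys l" using mult[of _ 1] W(1) by auto
  qed
  moreover have "polys l \<noteq> {0}" using polys_one by (metis singletonD zero_neq_one)
  ultimately show ?thesis unfolding sp_simple_def using is_MD(1)[OF M] by blast
qed

section \<open>Classification\<close>

lemma deg_0_intros:
  "deg j (cst c) = 0" "deg j 0 = 0" "deg j 1 = 0" "deg j (numeral n) = 0" "i \<noteq> j \<Longrightarrow> deg j (var i) = 0"
  "deg j p = 0 \<Longrightarrow> deg j (- p) = 0"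
  "deg j p = 0 \<Longrightarrow> deg j q = 0 \<Longrightarrow> deg j (p + q) = 0"
  "deg j p = 0 \<Longrightarrow> deg j q = 0 \<Longrightarrow> deg j (p - q) = 0"
  "deg j p = 0 \<Longrightarrow> deg j q = 0 \<Longrightarrow> deg j (p * q) = 0"
proof -
  show "deg j (numeral n) = 0" by (simp add: deg_def)
  assume "deg j p = 0"
  then show "deg j (- p) = 0" by (simp add: deg_def)
  assume "deg j q = 0"
  then show "deg j (p + q) = 0" "deg j (p - q) = 0" "deg j (p * q) = 0"
    using \<open>deg j p = 0\<close> by (simp_all add: deg_def uni_const)
qed (simp_all add: deg_def)

lemma uni_quadratic:
  assumes "deg j a = 0" "deg j b = 0" "deg j c = 0"
  shows "uni j (a * (var j * var j) + b * var j + c) = [:c, b, a:]"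
  using assms by (simp add: uni_const)

lemma uni_linear:
  assumes "deg j a = 0" "deg j b = 0"
  shows "uni j (a * var j + b) = [:b, a:]"
  using assms by (simp add: uni_const)

lemma uni_sigma_inv_same: "uni j (sigma_inv j p) = pcompose (uni j p) [:1, 1:]"
proof -
  have "uni j p = pcompose (uni j (sigma_inv j p)) [:-1, 1:]"
    by (metis sigma_sigma_inv uni_sigma_same)
  then show ?thesis
    by (simp add: pcompose_assoc[symmetric] pcompose_pCons pcompose_idR)
qed

lemma uni_sigma_inv: "i \<noteq> j \<Longrightarrow> uni j (sigma_inv i p) = map_poly (sigma_inv i) (uni j p)"
  using uni_sigma[of i j "sigma_inv i p"]
  by (simp add: poly_eq_iff coeff_map_poly)

text \<open>The coefficient just below the leading one, and 0 for constants. Reflection turns it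
  into the coefficient of degree 1, which gives the product rule at once.\<close>

definition subcoeff :: "'a :: idom poly \<Rightarrow> 'a" where
  "subcoeff p = coeff (reflect_poly p) 1"

lemma subcoeff_mult: "subcoeff (p * q) = lead_coeff p * subcoeff q + subcoeff p * lead_coeff q"
  by (simp add: subcoeff_def reflect_poly_mult coeff_mult numeral_2_eq_2)

lemma subcoeff_pCons:
  "subcoeff (pCons a p) = subcoeff p + (if p \<noteq> 0 \<and> degree p = 0 then a else 0)"
  by (cases "degree p") (auto simp: subcoeff_def coeff_reflect_poly coeff_pCons split: nat.splits)

lemma subcoeff_const_add:
  assumes "degree p > 0"
  shows "subcoeff ([:a:] + p) = subcoeff p + (if degree p = 1 then a else 0)"
proof -
  have "degree ([:a:] + p) = degree p" using assms by (simp add: degree_add_eq_right)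
  then show ?thesis using assms
    by (auto simp: subcoeff_def coeff_reflect_poly coeff_pCons split: nat.splits)
qed

text \<open>The binomial formula for the top two coefficients: this is where a shift records the
  degree.\<close>

lemma subcoeff_pcompose:
  "subcoeff (pcompose p [:c, 1:]) = subcoeff p + of_nat (degree p) * c * lead_coeff p"
proof (induction p)
  case 0
  then show ?case by (simp add: subcoeff_def)
next
  case (pCons a p)
  let ?q = "pcompose p [:c, 1:]"
  show ?case
  proof (cases "p = 0")
    case True
    then show ?thesis by simp
  next
    case False
    have q: "degree ?q = degree p" "lead_coeff ?q = lead_coeff p" "?q \<noteq> 0"
      using False lead_coeff_comp[of "[:c, 1:]" p]
      by (auto simp: degree_pcompose pcompose_eq_0)
    have "subcoeff (pcompose (pCons a p) [:c, 1:]) = subcoeff ([:a:] + [:c, 1:] * ?q)"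
      by (simp add: pcompose_pCons)
    also have "\<dots> = subcoeff ([:c, 1:] * ?q) + (if degree p = 0 then a else 0)"
      using q by (subst subcoeff_const_add) (auto simp: degree_mult_eq simp del: mult_pCons_left)
    also have "subcoeff ([:c, 1:] * ?q) = subcoeff ?q + c * lead_coeff p"
      unfolding subcoeff_mult q(2) by (simp add: subcoeff_pCons, simp add: subcoeff_def)
    finally show ?thesis
      using pCons.IH False by (simp add: subcoeff_pCons algebra_simps)
  qed
qed

lemma map_poly_sigma:
  fixes p :: "cpoly poly"
  shows "lead_coeff (map_poly (sigma i) p) = sigma i (lead_coeff p)"
    "subcoeff (map_poly (sigma i) p) = sigma i (subcoeff p)"
    "lead_coeff (map_poly (sigma_inv i) p) = sigma_inv i (lead_coeff p)"
    "subcoeff (map_poly (sigma_inv i) p) = sigma_inv i (subcoeff p)"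
proof -
  have [simp]: "sigma_inv i q = 0 \<longleftrightarrow> q = 0" for q by (metis sigma_inv_simps(4) sigma_sigma_inv sigma_simps(4))
  have d: "degree (map_poly (sigma i) p) = degree p" "degree (map_poly (sigma_inv i) p) = degree p"
    by (auto intro!: degree_map_poly)
  show "lead_coeff (map_poly (sigma i) p) = sigma i (lead_coeff p)"
    "subcoeff (map_poly (sigma i) p) = sigma i (subcoeff p)"
    "lead_coeff (map_poly (sigma_inv i) p) = sigma_inv i (lead_coeff p)"
    "subcoeff (map_poly (sigma_inv i) p) = sigma_inv i (subcoeff p)"
    by (simp_all add: subcoeff_def coeff_reflect_poly coeff_map_poly d)
qed

lemma lead_coeff_shift: "lead_coeff (pcompose p [:c, 1:]) = lead_coeff (p :: 'a :: idom poly)"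
  using lead_coeff_comp[of "[:c, 1:]" p] by simp

text \<open>Comparing the subleading coefficients in \<open>H\<^sub>j\<close> of the relations \<open>[e\<^sub>j, f\<^sub>i] = 0 = [e\<^sub>i, f\<^sub>j]\<close>
  shows that the degrees of \<open>E\<^sub>i\<close> and \<open>F\<^sub>i\<close> in \<open>H\<^sub>j\<close> add up to minus a Cartan integer.\<close>

lemma deg_sum:
  assumes ij: "i \<noteq> j" and nz: "B \<noteq> 0" "B' \<noteq> 0"
    and prod: "A * sigma j A' = - (var j * var j) + t * var j + c" "deg j t = 0" "deg j c = 0"
    and rel: "A * sigma j B' = B' * sigma_inv i A" "B * sigma i A' = A' * sigma_inv j B"
  shows "sigma i t - t = - of_nat (deg j B + deg j B')"
proof -
  let ?lc = "\<lambda>p. lead_coeff (uni j p)" and ?sc = "\<lambda>p. subcoeff (uni j p)"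
  have "- (var j * var j) + t * var j + c = cst (- 1) * (var j * var j) + t * var j + c"
    by (simp add: cst_minus)
  then have u: "uni j (A * sigma j A') = [:c, t, -1:]"
    using prod uni_quadratic[of j "cst (- 1)" t c] by (simp add: deg_0_intros cst_minus)
  \<comment> \<open>Hence both leading coefficients are units, that is, constants.\<close>
  have lc: "?lc A * ?lc A' = - 1"
  proof -
    have "lead_coeff (uni j (A * sigma j A')) = - 1" unfolding u by simp
    then show ?thesis by (simp add: lead_coeff_mult uni_sigma_same lead_coeff_shift)
  qed
  have sc: "t = ?lc A * (?sc A' - of_nat (deg j A') * ?lc A') + ?sc A * ?lc A'"
  proof -
    have "subcoeff (uni j (A * sigma j A')) = t" unfolding u by (simp add: subcoeff_pCons, simp add: subcoeff_def)
    then show ?thesis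
      by (simp add: subcoeff_mult uni_sigma_same lead_coeff_shift subcoeff_pcompose deg_def)
  qed
  have "?lc A * ?lc A' = cst (- 1)" "?lc A' * ?lc A = cst (- 1)" using lc by (simp_all add: cst_minus mult.commute)
  then obtain u v where uv: "?lc A = cst u" "?lc A' = cst v"
    using unit_imp_cst[of "?lc A" "?lc A'" "- 1"] unit_imp_cst[of "?lc A'" "?lc A" "- 1"] by auto
  have nz': "?lc B \<noteq> 0" "?lc B' \<noteq> 0" using nz by simp_all
  \<comment> \<open>Here \<open>sigma j\<close> shifts the main variable and contributes the degree
    of B', while \<open>sigma_inv i\<close> changes only the subleading coefficient of A.\<close>
  have "subcoeff (uni j (A * sigma j B')) = subcoeff (uni j (B' * sigma_inv i A))"
    using rel(1) by simp
  then have "?lc B' * (?sc A - sigma_inv i (?sc A)) = ?lc B' * (of_nat (deg j B') * cst u)"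
    by (simp add: subcoeff_mult uni_sigma_same uni_sigma_inv[OF ij] lead_coeff_shift subcoeff_pcompose
        deg_def map_poly_sigma uv algebra_simps)
  then have 1: "?sc A - sigma_inv i (?sc A) = cst (of_nat (deg j B') * u)"
    using nz' by (simp add: cst_mult cst_of_nat)
  have n: "sigma i (of_nat n) = of_nat n" for n
    using sigma_simps(1)[of i "of_nat n"] by (simp add: cst_of_nat)
  have A: "sigma i (?sc A) - ?sc A = of_nat (deg j B') * cst u"
    using arg_cong[OF 1, of "sigma i"] by (simp add: cst_mult cst_of_nat n)
  have "subcoeff (uni j (B * sigma i A')) = subcoeff (uni j (A' * sigma_inv j B))"
    using rel(2) by simp
  then have "?lc B * (sigma i (?sc A') - ?sc A') = ?lc B * (of_nat (deg j B) * cst v)"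
    by (simp add: subcoeff_mult uni_sigma[OF ij] uni_sigma_inv_same lead_coeff_shift subcoeff_pcompose
        deg_def map_poly_sigma uv algebra_simps)
  then have A': "sigma i (?sc A') - ?sc A' = of_nat (deg j B) * cst v"
    using nz' by simp
  have "sigma i t - t = cst u * (sigma i (?sc A') - ?sc A') + (sigma i (?sc A) - ?sc A) * cst v"
    by (subst (1 2) sc) (simp add: uv n algebra_simps)
  also have "\<dots> = (cst u * cst v) * of_nat (deg j B + deg j B')"
    unfolding A A' by (simp add: algebra_simps)
  finally show ?thesis using lc uv by simp
qed

text \<open>A factor free of H_j divides the leading coefficient in H_j, which is a unit.\<close>

lemma unit_factor:
  assumes "uni j (p * q) = r" "lead_coeff r = cst u" "u \<noteq> 0" "deg j p = 0"
  shows "\<exists>a. p = cst a \<and> a \<noteq> 0"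
proof -
  have "p * lead_coeff (uni j q) = cst u"
    using assms(1,2) uni_const[OF assms(4)] by (metis lead_coeff_mult lead_coeff_pCons(2) uni_simps(3))
  then show ?thesis using unit_imp_cst assms(3) by blast
qed

text \<open>One of the factors has degree 0 in H_j, so \<open>unit_factor\<close> applies to
  it.\<close>

lemma linear_factor:
  assumes "uni j (p * q) = [:r, cst u:]" "u \<noteq> 0"
  shows "(\<exists>a. p = cst a \<and> a \<noteq> 0) \<or> (\<exists>a. q = cst a \<and> a \<noteq> 0)"
proof -
  have "uni j (p * q) \<noteq> 0" using assms by simp
  then have "p \<noteq> 0" "q \<noteq> 0" by auto
  then have "deg j p + deg j q = 1"
    using assms deg_mult[of p q j] by (simp add: deg_def)
  then consider "deg j p = 0" | "deg j q = 0" by linarith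
  then show ?thesis
    by cases (use unit_factor[OF assms(1), of u] unit_factor[of j q p, of "[:r, cst u:]" u] assms in
      \<open>auto simp: mult.commute\<close>)
qed

section \<open>The two nodes at the end of the diagram\<close>

lemma degree_1_E:
  fixes p :: "'a :: zero poly"
  assumes "degree p = 1"
  obtains a b where "p = [:a, b:]" "b \<noteq> 0"
proof -
  obtain a q where q: "p = pCons a q" by (cases p)
  then have "degree q = 0" "q \<noteq> 0" using assms by (auto split: if_splits)
  then obtain b where "q = [:b:]" "b \<noteq> 0" by (metis degree_eq_zeroE pCons_0_0)
  with q that show ?thesis by blast
qed

lemma node_start_expansion:
  fixes x m \<alpha> :: "'a :: comm_ring_1"
  shows "- (x - 1 + (m - 2 * \<alpha> * x)) * (m - 2 * \<alpha> * x)
    = (2 * \<alpha> * (1 - 2 * \<alpha>)) * (x * x) + (2 * \<alpha> * (m - 1) - (1 - 2 * \<alpha>) * m) * x + - (m * (m - 1))"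
  by (simp add: algebra_simps)

text \<open>\<alpha> and h stand for 1/4 and 1/2. Stating this by \<open>4 * \<alpha> = 1\<close>
  and \<open>2 * h = 1\<close> keeps the identities integral, up to visible multiples of
  \<open>1 - 4 * \<alpha>\<close>.\<close>

lemma node_start_identities:
  fixes x y p h m \<alpha> \<beta> \<gamma> :: "'a :: comm_ring_1"
  assumes "\<beta> = 2 * \<alpha> * (m - 1) - (1 - 2 * \<alpha>) * m" "\<gamma> = - (m * (m - 1))" "m = \<alpha> - \<beta>"
    and \<alpha>: "4 * \<alpha> = 1" and h: "2 * h = 1"
  shows "4 * (y * y - (x - 1) * y + (\<alpha> * (x * x) + \<beta> * x + \<gamma>)) = (2 * y - x + 3 * h) * (2 * y - x + h)"
    "p * y + - (p * (x - 1 + (m - 2 * \<alpha> * x))) = (2 * y - x + h) * (h * p)"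
proof -
  have z: "1 - 4 * \<alpha> = 0" using \<alpha> by simp
  have "h = h * (4 * \<alpha>)" using \<alpha> by simp
  also have "\<dots> = (2 * h) * (2 * \<alpha>)" by (simp add: algebra_simps)
  finally have h: "h = 2 * \<alpha>" using h by simp
  have "2 * \<alpha> * (m - 1) - (1 - 2 * \<alpha>) * m = - (1 - 4 * \<alpha>) * m - 2 * \<alpha>"
    by (simp add: algebra_simps)
  then have \<beta>: "\<beta> = - (2 * \<alpha>)" using assms(1) z by simp
  have m: "m = 3 * \<alpha>" using assms(3) \<beta> by simp
  have "4 * (y * y - (x - 1) * y + (\<alpha> * (x * x) + (- (2 * \<alpha>)) * x + - (3 * \<alpha> * (3 * \<alpha> - 1))))
      = (2 * y - x + 3 * (2 * \<alpha>)) * (2 * y - x + 2 * \<alpha>) + (1 - 4 * \<alpha>) * (4 * y - x * x + 12 * \<alpha>)"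
    by (simp add: algebra_simps)
  then show "4 * (y * y - (x - 1) * y + (\<alpha> * (x * x) + \<beta> * x + \<gamma>)) = (2 * y - x + 3 * h) * (2 * y - x + h)"
    unfolding h \<beta> assms(2) m z by simp
  have "p * y + - (p * (x - 1 + (3 * \<alpha> - 2 * \<alpha> * x)))
      = (2 * y - x + 2 * \<alpha>) * (2 * \<alpha> * p) + (1 - 4 * \<alpha>) * (p * (y - x + 1 + \<alpha>))"
    by (simp add: algebra_simps)
  then show "p * y + - (p * (x - 1 + (m - 2 * \<alpha> * x))) = (2 * y - x + h) * (h * p)"
    unfolding h m z by simp
qed
text \<open>(E, F) belongs to node l with y = H_l, and (P, Q) to node l - 1 with x = H_(l-1).
  Degrees force E to be constant; the relation between P and F then becomes a functional equation in
  x that determines F and exhibits a linear factor of P.\<close>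

lemma node_start_half:
  fixes X Y :: nat
  defines "x \<equiv> var X" and "y \<equiv> var Y"
  assumes XY: "X \<noteq> Y"
    and EF: "E * sigma Y F = - (y * y) + (x + 1) * y + c" "deg Y c = 0"
    and PQ: "P * sigma X Q = - (x * x) + (2 * y + w + 1) * x + d" "deg X d = 0" "deg X w = 0" "deg Y w = 0"
    and rel: "E * sigma Y Q = Q * sigma_inv X E" "P * sigma X F = F * sigma_inv Y P"
    and degs: "deg X E + deg X F = 2" "deg Y P = 1" "deg Y Q = 0"
    and nz: "E \<noteq> 0" "F \<noteq> 0" "P \<noteq> 0" "Q \<noteq> 0"
  shows "\<exists>a p. a \<noteq> 0 \<and> E = cst a
    \<and> F = - cst (inverse a / 4) * (2 * y - x + cst (3/2)) * (2 * y - x + cst (1/2))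
    \<and> P = (2 * y - x + cst (1/2)) * p"
proof -
  have dx: "deg Y x = 0" "deg X y = 0" using XY by (auto simp: x_def y_def intro: deg_0_intros)
  \<comment> \<open>Q is fixed by \<open>sigma Y\<close>, so it cancels from the first
    relation.\<close>
  have E_X: "deg X E = 0"
  proof -
    have "sigma Y Q = Q" using degs(3) sigma_invariant_iff by simp
    then have "sigma_inv X E = E" using rel(1) nz by simp
    then have "sigma X E = E" by (metis sigma_sigma_inv)
    then show ?thesis by (simp add: sigma_invariant_iff)
  qed
  then have F_X: "deg X F = 2" using degs by simp
  have u: "uni Y (E * sigma Y F) = [:c, x + 1, cst (- 1):]"
  proof -
    have "E * sigma Y F = cst (- 1) * (var Y * var Y) + (x + 1) * var Y + c"
      using EF(1) by (simp add: y_def cst_minus)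
    then show ?thesis using uni_quadratic[of Y "cst (- 1)" "x + 1" c] EF(2) dx
      by (simp add: deg_0_intros)
  qed
  have "deg Y E + deg Y F = 2"
  proof -
    have "deg Y (E * sigma Y F) = 2" unfolding deg_def u by simp
    then show ?thesis using deg_mult[of E "sigma Y F" Y] nz by simp
  qed
  then consider "deg Y F = 0" | "deg Y E = 1" "deg Y F = 1" | "deg Y E = 0" by linarith
  then obtain a where a: "E = cst a" "a \<noteq> 0"
  proof cases
    case 1
    \<comment> \<open>If F were free of y it would be constant, against its degree 2 in x.\<close>
    have "uni Y (sigma Y F * E) = [:c, x + 1, cst (- 1):]" using u by (simp add: mult.commute)
    then have "\<exists>a. sigma Y F = cst a \<and> a \<noteq> 0"
      by (rule unit_factor[where u = "- 1"]) (use 1 in simp_all)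
    then have "deg X (sigma Y F) = 0" by (elim exE conjE) (simp only: deg_0_intros)
    then show ?thesis using F_X by simp
  next
    case 2
    obtain e0 e1 where e: "uni Y E = [:e0, e1:]"
      using 2(1) unfolding deg_def by (rule degree_1_E)
    obtain f0 f1 where f: "uni Y (sigma Y F) = [:f0, f1:]"
      using degree_1_E[of "uni Y (sigma Y F)"] 2(2) deg_sigma[of Y Y F] unfolding deg_def by metis
    have eq: "e0 * f1 + e1 * f0 = x + 1" "e1 * f1 = cst (- 1)"
      using u unfolding uni_simps e f by (simp_all add: algebra_simps)
    obtain v where v: "e1 = cst v" using unit_imp_cst[OF eq(2)] by auto
    obtain v' where v': "f1 = cst v'" using unit_imp_cst[of f1 e1 "- 1"] eq(2) by (auto simp: mult.commute)
    have E: "E = e0 + e1 * y" "sigma Y F = f0 + f1 * y"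
      using arg_cong[OF e, of "\<lambda>p. poly p y"] arg_cong[OF f, of "\<lambda>p. poly p y"]
      by (simp_all add: y_def mult.commute)
    have "deg X (E - e1 * y) = 0" using E_X dx by (intro deg_0_intros) (simp_all add: v deg_0_intros)
    then have e0: "deg X e0 = 0" using E by simp
    \<comment> \<open>If both were linear in y, this expression would give F degree 1 in x instead
      of 2.\<close>
    have "e1 * sigma Y F = cst 1 * x + (1 - e0 * f1 + e1 * f1 * y)"
      using eq(1) unfolding E by (simp add: algebra_simps)
    then have "uni X (e1 * sigma Y F) = [:1 - e0 * f1 + e1 * f1 * y, cst 1:]"
      unfolding x_def using e0 dx by (subst uni_linear[symmetric]) (simp_all add: v v' deg_0_intros)
    then have "deg X (e1 * sigma Y F) = 1" by (simp add: deg_def)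
    moreover have "deg X (e1 * sigma Y F) = deg X F"
      using eq(2) nz by (subst deg_mult) (auto simp: v deg_0_intros)
    ultimately show ?thesis using F_X by simp
  next
    case 3
    then show ?thesis using unit_factor[OF u, of "- 1"] that by auto
  qed
  define G where "G = y * y - (x - 1) * y - (x + c)"
  have ai: "cst (inverse a) * cst a = 1" using a by (simp flip: cst_mult)
  have F: "F = - cst (inverse a) * G"
  proof -
    have "F = cst (inverse a) * sigma_inv Y (cst a * sigma Y F)"
      using ai by (simp add: mult.assoc[symmetric])
    also have "cst a * sigma Y F = - (y * y) + (x + 1) * y + c" using EF(1) a by simp
    also have "sigma_inv Y \<dots> = - G"
    proof -
      have "sigma_inv Y c = c" using EF(2) sigma_invariant_iff by (metis sigma_inv_sigma)
      then show ?thesis using XY by (simp add: G_def x_def y_def algebra_simps)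
    qed
    finally show ?thesis by simp
  qed
  define c' where "c' = - (x + c)"
  have c': "deg Y c' = 0" unfolding c'_def using dx EF(2) by (intro deg_0_intros)
  have G: "G = y * y - (x - 1) * y + c'" by (simp add: G_def c'_def)
  have G_X: "deg X G = 2"
  proof -
    have "G \<noteq> 0" using F nz by auto
    then have "deg X F = deg X G"
      unfolding F using a by (subst deg_mult) (auto simp flip: cst_minus simp: deg_0_intros)
    then show ?thesis using F_X by simp
  qed
  obtain p q where pq: "uni Y P = [:q, p:]"
    using degs(2) unfolding deg_def by (rule degree_1_E)
  have P: "P = p * y + q"
    using arg_cong[OF pq, of "\<lambda>p. poly p y"] by (simp add: y_def mult.commute add.commute)
  have pq0: "deg Y p = 0" "deg Y q = 0" "p \<noteq> 0"
  proof -
    show "p \<noteq> 0" using degs(2) pq by (auto simp: deg_def)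
    have "p = coeff (uni Y P) 1" "q = coeff (uni Y P) 0" unfolding pq by simp_all
    then show "deg Y p = 0" "deg Y q = 0" using deg_coeff_uni by metis+
  qed
  define \<Delta> where "\<Delta> = sigma X c' - c'"
  have \<Delta>Y: "deg Y \<Delta> = 0" unfolding \<Delta>_def using c' by (intro deg_0_intros) simp_all
  \<comment> \<open>The relation between P and F with P G cancelled: \<open>sigma X\<close> adds
    \<open>y + \<Delta>\<close> to G, and \<open>sigma_inv Y\<close> adds p to P.\<close>
  have "P * (y + \<Delta>) = p * G"
  proof -
    have "sigma X G = G + (y + \<Delta>)"
      using XY by (simp add: G \<Delta>_def x_def y_def algebra_simps)
    moreover have "sigma_inv Y P = P + p"
    proof -
      have "sigma_inv Y p = p" "sigma_inv Y q = q"
        using pq0 sigma_invariant_iff by (metis sigma_inv_sigma)+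
      then show ?thesis unfolding P by (simp add: y_def algebra_simps)
    qed
    moreover have "cst (inverse a) * (P * sigma X G) = cst (inverse a) * (G * sigma_inv Y P)"
      using rel(2) unfolding F by (simp add: algebra_simps)
    ultimately have "P * (G + (y + \<Delta>)) = G * (P + p)" using a by simp
    then show ?thesis by (simp add: algebra_simps)
  qed
  then have "p * (y * y) + (p * \<Delta> + q) * y + q * \<Delta> = p * (y * y) + (- (p * (x - 1))) * y + p * c'"
    unfolding P G by (simp add: algebra_simps)
  then have "uni Y (p * (y * y) + (p * \<Delta> + q) * y + q * \<Delta>)
      = uni Y (p * (y * y) + (- (p * (x - 1))) * y + p * c')"
    by (rule arg_cong)
  \<comment> \<open>The y-coefficients express q through p and leave an equation for c' alone, since
    \<Delta> is its difference under \<open>sigma X\<close>.\<close>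
  then have co: "p * \<Delta> + q = - (p * (x - 1))" "q * \<Delta> = p * c'"
    unfolding y_def
    by (subst (asm) (1 2) uni_quadratic; use pq0 \<Delta>Y c' dx in \<open>auto intro!: deg_0_intros\<close>)+
  have q: "q = - (p * (x - 1 + \<Delta>))"
    using co(1) by (simp add: algebra_simps eq_neg_iff_add_eq_0)
  have "p * c' = p * (- (x - 1 + \<Delta>) * \<Delta>)"
    using co(2) unfolding q by (simp add: algebra_simps)
  then have c'\<Delta>: "c' = - (x - 1 + \<Delta>) * \<Delta>" using pq0(3) by (simp only: mult_cancel_left) simp
  obtain \<alpha> \<beta> \<gamma> where c'_eq: "c' = \<alpha> * (x * x) + \<beta> * x + \<gamma>"
    and \<alpha>: "\<alpha> \<noteq> 0" "deg X \<alpha> = 0" "deg X \<beta> = 0" "deg X \<gamma> = 0"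
  proof -
    obtain g0 g1 g2 where g: "uni X G = [:g0, g1, g2:]" "g2 \<noteq> 0"
    proof -
      obtain g0 r where r: "uni X G = pCons g0 r" by (cases "uni X G")
      then have "degree r = 1" using G_X by (auto simp: deg_def split: if_splits)
      then obtain g1 g2 where "r = [:g1, g2:]" "g2 \<noteq> 0"
        by (rule degree_1_E)
      with r that show ?thesis by blast
    qed
    have "g0 = coeff (uni X G) 0" "g1 = coeff (uni X G) 1" "g2 = coeff (uni X G) 2"
      unfolding g by (simp_all add: numeral_2_eq_2)
    then have dg: "deg X g0 = 0" "deg X g1 = 0" "deg X g2 = 0" using deg_coeff_uni by metis+
    have "G = g2 * (x * x) + g1 * x + g0"
      using arg_cong[OF g(1), of "\<lambda>p. poly p x"] by (simp add: x_def algebra_simps)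
    then have "c' = g2 * (x * x) + (g1 + y) * x + (g0 - y * y - y)"
      unfolding G by (simp add: algebra_simps)
    then show ?thesis using g(2) dg dx by (intro that[of g2 "g1 + y" "g0 - y * y - y"]) (auto intro!: deg_0_intros)
  qed
  define m where "m = \<alpha> - \<beta>"
  have dm: "deg X m = 0" unfolding m_def using \<alpha> by (intro deg_0_intros)
  have \<Delta>: "\<Delta> = m - 2 * \<alpha> * x"
  proof -
    have "sigma X \<alpha> = \<alpha>" "sigma X \<beta> = \<beta>" "sigma X \<gamma> = \<gamma>" using \<alpha> by (simp_all add: sigma_invariant_iff)
    then show ?thesis unfolding \<Delta>_def c'_eq m_def by (simp add: x_def algebra_simps)
  qed
  have "c' = (2 * \<alpha> * (1 - 2 * \<alpha>)) * (x * x) + (2 * \<alpha> * (m - 1) - (1 - 2 * \<alpha>) * m) * x + - (m * (m - 1))"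
    using c'\<Delta> unfolding \<Delta> node_start_expansion .
  then have "uni X (\<alpha> * (x * x) + \<beta> * x + \<gamma>)
      = uni X ((2 * \<alpha> * (1 - 2 * \<alpha>)) * (x * x) + (2 * \<alpha> * (m - 1) - (1 - 2 * \<alpha>) * m) * x + - (m * (m - 1)))"
    unfolding c'_eq by (rule arg_cong)
  then have coX: "\<alpha> = 2 * \<alpha> * (1 - 2 * \<alpha>)" "\<beta> = 2 * \<alpha> * (m - 1) - (1 - 2 * \<alpha>) * m" "\<gamma> = - (m * (m - 1))"
    unfolding x_def
    by (subst (asm) (1 2) uni_quadratic; use \<alpha> dm in \<open>auto intro!: deg_0_intros\<close>)+
  \<comment> \<open>As c' has exact degree 2 in x, \<alpha> is nonzero and must be 1/4.\<close>
  have "\<alpha> * (4 * \<alpha> - 1) = 0" using coX(1) by (simp add: algebra_simps)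
  then have \<alpha>4: "4 * \<alpha> = 1" using \<alpha>(1) by simp
  define h where "h = cst (1/2)"
  have h: "2 * h = 1" "cst (3/2) = 3 * h" by (simp_all add: h_def) (simp del: cst_numeral flip: cst_numeral cst_mult)
  note ids = node_start_identities[OF coX(2,3) m_def \<alpha>4 h(1)]
  have G4: "4 * G = (2 * y - x + 3 * h) * (2 * y - x + h)"
    unfolding G c'_eq by (rule ids(1))
  have P2: "P = (2 * y - x + h) * (h * p)"
    unfolding P q \<Delta> by (rule ids(2))
  have "F = - cst (inverse a / 4) * (4 * G)"
  proof -
    have "cst (inverse a) = cst (inverse a / 4) * 4"
      by (simp del: cst_numeral flip: cst_numeral cst_mult)
    then show ?thesis unfolding F by (simp add: mult_ac)
  qed
  then have "F = - cst (inverse a / 4) * (2 * y - x + cst (3/2)) * (2 * y - x + cst (1/2))"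
    unfolding G4 h by (simp add: h_def mult.assoc)
  with a P2 show ?thesis unfolding h_def by blast
qed


text \<open>Replacing \<open>(E, F)\<close> by \<open>(F, E)\<close> composed with this automorphism preserves all relations and
  exchanges the two alternatives at the end node.\<close>

definition neg_vars :: "cpoly \<Rightarrow> cpoly" where
  "neg_vars = poly_subst (\<lambda>i. - var i)"

lemma neg_vars_simps [simp]:
  "neg_vars (cst c) = cst c" "neg_vars (p + q) = neg_vars p + neg_vars q"
  "neg_vars (p * q) = neg_vars p * neg_vars q" "neg_vars 0 = 0" "neg_vars 1 = 1"
  "neg_vars (- p) = - neg_vars p" "neg_vars (p - q) = neg_vars p - neg_vars q"
  "neg_vars (numeral k) = numeral k" "neg_vars (var i) = - var i"
  by (simp_all add: neg_vars_def)

lemma neg_vars_neg_vars [simp]: "neg_vars (neg_vars p) = p"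
  by (induction p rule: cpoly_induct) auto

lemma neg_vars_eq_0_iff [simp]: "neg_vars p = 0 \<longleftrightarrow> p = 0"
  by (metis neg_vars_neg_vars neg_vars_simps(4))

lemma neg_vars_sigma:
  "neg_vars (sigma i p) = sigma_inv i (neg_vars p)" "neg_vars (sigma_inv i p) = sigma i (neg_vars p)"
  by (induction p rule: cpoly_induct) (auto simp: of_bool_def algebra_simps)

lemma deg_neg_vars [simp]: "deg j (neg_vars p) = deg j p"
proof -
  have "degree (uni j (neg_vars q)) \<le> degree (uni j q)" for q
  proof -
    have "uni j (neg_vars q) = pcompose (map_poly neg_vars (uni j q)) [:0, -1:]"
    proof (induction q rule: cpoly_induct)
      case (add p q)
      have "map_poly neg_vars (uni j p + uni j q) = map_poly neg_vars (uni j p) + map_poly neg_vars (uni j q)"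
        by (simp add: poly_eq_iff coeff_map_poly)
      with add show ?case by (simp add: pcompose_add)
    next
      case (var i q)
      show ?case
      proof (cases "i = j")
        case True
        with var show ?thesis by (simp add: map_poly_pCons pcompose_pCons)
      next
        case False
        have "map_poly neg_vars (smult (var i) (uni j q)) = smult (- var i) (map_poly neg_vars (uni j q))"
          by (simp add: poly_eq_iff coeff_map_poly)
        with False var show ?thesis by (simp add: pcompose_smult pcompose_uminus)
      qed
    qed (simp add: map_poly_pCons)
    moreover have "degree (map_poly neg_vars (uni j q)) = degree (uni j q)"
      by (intro degree_map_poly) simp
    ultimately show ?thesis by (simp add: degree_pcompose)
  qed
  from this[of p] this[of "neg_vars p"] show ?thesis unfolding deg_def by simp
qed

lemma node_start:
  fixes X Y :: nat
  defines "x \<equiv> var X" and "y \<equiv> var Y"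
  assumes XY: "X \<noteq> Y"
    and EF: "E * sigma Y F = - (y * y) + (x + 1) * y + c" "deg Y c = 0"
    and PQ: "P * sigma X Q = - (x * x) + (2 * y + w + 1) * x + d" "deg X d = 0" "deg X w = 0" "deg Y w = 0"
    and rel: "E * sigma Y Q = Q * sigma_inv X E" "P * sigma X F = F * sigma_inv Y P"
  shows "(\<exists>a p. a \<noteq> 0 \<and> E = cst a
      \<and> F = - cst (inverse a / 4) * (2 * y - x + cst (3/2)) * (2 * y - x + cst (1/2))
      \<and> P = (2 * y - x + cst (1/2)) * p)
    \<or> (\<exists>a p. a \<noteq> 0 \<and> F = cst (inverse a)
      \<and> E = - cst (a / 4) * (2 * y - x - cst (3/2)) * (2 * y - x - cst (1/2))
      \<and> Q = (2 * y - x - cst (1/2)) * p)"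
proof -
  have dx: "deg Y x = 0" "deg X y = 0" using XY by (auto simp: x_def y_def intro: deg_0_intros)
  have "uni Y (E * sigma Y F) \<noteq> 0" "uni X (P * sigma X Q) \<noteq> 0"
  proof -
    have "E * sigma Y F = cst (- 1) * (var Y * var Y) + (x + 1) * var Y + c"
      using EF(1) by (simp add: y_def cst_minus)
    moreover have "P * sigma X Q = cst (- 1) * (var X * var X) + (2 * y + w + 1) * var X + d"
      using PQ(1) by (simp add: x_def cst_minus)
    ultimately show "uni Y (E * sigma Y F) \<noteq> 0" "uni X (P * sigma X Q) \<noteq> 0"
      using EF(2) PQ(2,3) dx by (simp_all only: uni_quadratic deg_0_intros) simp_all
  qed
  then have nz: "E \<noteq> 0" "F \<noteq> 0" "P \<noteq> 0" "Q \<noteq> 0" by auto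
  \<comment> \<open>Under \<open>sigma Y\<close> the middle coefficient \<open>2 * y + w + 1\<close>
    drops by 2, and below \<open>x + 1\<close> drops by 1 under \<open>sigma X\<close>: the two
    off-diagonal Cartan integers.\<close>
  have dX: "deg X E + deg X F = 2"
  proof -
    have "sigma Y (2 * y + w + 1) - (2 * y + w + 1) = - of_nat (deg X E + deg X F)"
      using PQ dx rel XY nz unfolding x_def y_def
      by (intro deg_sum[of Y X E F P Q "2 * y + w + 1" d, unfolded y_def]) (auto intro!: deg_0_intros)
    moreover have "sigma Y w = w" using PQ(4) sigma_invariant_iff by simp
    ultimately have "(of_nat (deg X E + deg X F) :: cpoly) = of_nat 2"
      by (simp add: y_def algebra_simps)
    then show ?thesis by (simp only: of_nat_eq_iff)
  qed
  have dY: "deg Y P + deg Y Q = 1"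
  proof -
    have "sigma X (x + 1) - (x + 1) = - of_nat (deg Y P + deg Y Q)"
      using EF dx rel XY nz unfolding x_def y_def
      by (intro deg_sum[of X Y P Q E F "x + 1" c, unfolded x_def]) (auto intro!: deg_0_intros)
    then have "(of_nat (deg Y P + deg Y Q) :: cpoly) = of_nat 1"
      by (simp add: x_def algebra_simps)
    then show ?thesis by (simp only: of_nat_eq_iff)
  qed
  from dY consider "deg Y P = 1" "deg Y Q = 0" | "deg Y P = 0" "deg Y Q = 1" by linarith
  then show ?thesis
  proof cases
    case 1
    then show ?thesis
      using node_start_half[OF XY EF[unfolded x_def y_def] PQ[unfolded x_def y_def] rel dX 1 nz]
      unfolding x_def y_def by blast
  next
    case 2
    let ?n = neg_vars
    have c: "sigma_inv Y c = c" "sigma_inv X d = d" "sigma_inv X w = w"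
      using EF(2) PQ(2,3) sigma_invariant_iff by (metis sigma_inv_sigma)+
    \<comment> \<open>Passing to the inverse shift produces lower terms; they go into the new
      constant terms, and w changes to \<open>- ?n w\<close>.\<close>
    have "?n F * sigma Y (?n E) = ?n (sigma_inv Y (E * sigma Y F))"
      by (simp add: neg_vars_sigma mult.commute)
    also have "\<dots> = - (y * y) + (x + 1) * y + (?n c - x)"
      unfolding EF(1) using XY c by (simp add: x_def y_def algebra_simps)
    finally have EF': "?n F * sigma Y (?n E) = - (y * y) + (x + 1) * y + (?n c - x)"
      "deg Y (?n c - x) = 0" using EF(2) dx by (simp_all add: deg_0_intros)
    have "?n Q * sigma X (?n P) = ?n (sigma_inv X (P * sigma X Q))"
      by (simp add: neg_vars_sigma mult.commute)
    also have "\<dots> = - (x * x) + (2 * y + (- ?n w) + 1) * x + (?n d + ?n w - 2 * y)"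
      unfolding PQ(1) using XY c by (simp add: x_def y_def algebra_simps)
    finally have PQ': "?n Q * sigma X (?n P) = - (x * x) + (2 * y + (- ?n w) + 1) * x + (?n d + ?n w - 2 * y)"
      "deg X (?n d + ?n w - 2 * y) = 0" "deg X (- ?n w) = 0" "deg Y (- ?n w) = 0"
      using PQ dx by (auto intro!: deg_0_intros)
    have rel': "?n F * sigma Y (?n P) = ?n P * sigma_inv X (?n F)" "?n Q * sigma X (?n E) = ?n E * sigma_inv Y (?n Q)"
      using arg_cong[OF rel(1), of ?n] arg_cong[OF rel(2), of ?n] by (simp_all add: neg_vars_sigma)
    obtain a p where a: "a \<noteq> 0" "?n F = cst a"
      "?n E = - cst (inverse a / 4) * (2 * y - x + cst (3/2)) * (2 * y - x + cst (1/2))"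
      "?n Q = (2 * y - x + cst (1/2)) * p"
      using node_start_half[OF XY EF'[unfolded x_def y_def] PQ'[unfolded x_def y_def] rel'] dX 2 nz
      unfolding x_def y_def by (auto simp: add.commute)
    have "F = cst (inverse (inverse a))" using arg_cong[OF a(2), of ?n] by simp
    moreover have "E = - cst (inverse a / 4) * (2 * y - x - cst (3/2)) * (2 * y - x - cst (1/2))"
      using arg_cong[OF a(3), of ?n] by (simp add: x_def y_def algebra_simps)
    moreover have "Q = (2 * y - x - cst (1/2)) * (- ?n p)"
      using arg_cong[OF a(4), of ?n] by (simp add: x_def y_def algebra_simps)
    ultimately show ?thesis using a(1) by (intro disjI2 exI[of _ "inverse a"] exI[of _ "- ?n p"]) simp
  qed
qed


section \<open>From node to node down the diagram\<close>

lemma sigma_inv_wt: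
  assumes "k \<in> {1..l}" "i \<in> {1..l}"
  shows "sigma_inv i (wt l k) = wt l k + of_bool (i = k) * (if i = l then 2 else 1) - of_bool (k = i + 1)"
  using assms by (auto simp: wt_def Hvar_def algebra_simps)

lemma casimir_identities:
  fixes h a b \<phi> x y w d :: cpoly
  assumes "2 * h = 1"
  shows "\<phi> - (a - b) - (a + 1 - h) * (b - 1 + h) = \<phi> - (a - h) * (b + h)"
    "(x - w - h) * (2 * y - x + h) + d
      = - (x * x) + (2 * y + w + 1) * x + (d - (w + h) * (2 * y + h))"
proof -
  have z: "1 - 2 * h = 0" using assms by simp
  have "\<phi> - (a - b) - (a + 1 - h) * (b - 1 + h) = \<phi> - (a - h) * (b + h) + (1 - 2 * h)"
    by (simp add: algebra_simps)
  then show "\<phi> - (a - b) - (a + 1 - h) * (b - 1 + h) = \<phi> - (a - h) * (b + h)"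
    unfolding z by simp
  have "(x - w - h) * (2 * y - x + h) + d
      = - (x * x) + (2 * y + w + 1) * x + (d - (w + h) * (2 * y + h)) - (1 - 2 * h) * x"
    by (simp add: algebra_simps)
  then show "(x - w - h) * (2 * y - x + h) + d
      = - (x * x) + (2 * y + w + 1) * x + (d - (w + h) * (2 * y + h))"
    unfolding z by simp
qed

text \<open>The brackets of e_i with f_j evaluated at the generator; on the right are the coroots in
  the coordinates h_k.\<close>

locale free_rank1 =
  fixes l :: nat and E F :: "nat \<Rightarrow> cpoly"
  assumes l: "2 \<le> l"
    and rel: "i \<in> {1..l} \<Longrightarrow> j \<in> {1..l} \<Longrightarrow> E i * sigma i (F j) - F j * sigma_inv j (E i)
      = (if i = j then if i = l then wt l l else wt l i - wt l (i + 1) else 0)"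
begin

lemma rel_neq:
  "i \<in> {1..l} \<Longrightarrow> j \<in> {1..l} \<Longrightarrow> i \<noteq> j \<Longrightarrow> E i * sigma i (F j) = F j * sigma_inv j (E i)"
  using rel[of i j] by simp

text \<open>The relation says that E_l \<open>sigma l\<close> F_l changes by h_l under the inverse
  shift. The displayed quadratic changes in the same way, so the rest is invariant.\<close>

lemma casimir_last:
  obtains c where "E l * sigma l (F l) = - (var l * var l) + (var (l - 1) + 1) * var l + c" "deg l c = 0"
proof
  let ?\<phi> = "E l * sigma l (F l)"
  let ?c = "?\<phi> + (var l * var l - (var (l - 1) + 1) * var l)"
  show "?\<phi> = - (var l * var l) + (var (l - 1) + 1) * var l + ?c" by simp
  have ne: "l \<noteq> l - 1" "l - 1 \<noteq> 0" using l by auto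
  have "sigma_inv l ?\<phi> = ?\<phi> - (2 * var l - var (l - 1))"
    using rel[of l l] ne l by (simp add: wt_def Hvar_def algebra_simps)
  then have "sigma_inv l ?c = ?c"
    unfolding sigma_inv_simps(2)[of l ?\<phi>] using ne by (simp add: algebra_simps)
  then show "deg l ?c = 0" by (metis sigma_invariant_iff sigma_sigma_inv)
qed

text \<open>As for node l; the product of linear factors is the value in M(a, S), where c
  vanishes.\<close>

lemma casimir:
  assumes k: "1 \<le> k" "k < l"
  obtains c where "E k * sigma k (F k) = (wt l k - cst (1/2)) * (wt l (k + 1) + cst (1/2)) + c" "deg k c = 0"
proof
  let ?\<phi> = "E k * sigma k (F k)"
  let ?c = "?\<phi> - (wt l k - cst (1/2)) * (wt l (k + 1) + cst (1/2))"
  show "?\<phi> = (wt l k - cst (1/2)) * (wt l (k + 1) + cst (1/2)) + ?c" by simp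
  have \<phi>: "sigma_inv k ?\<phi> = ?\<phi> - (wt l k - wt l (k + 1))"
    using rel[of k k] k by (simp add: algebra_simps)
  have w: "sigma_inv k (wt l k) = wt l k + 1" "sigma_inv k (wt l (k + 1)) = wt l (k + 1) - 1"
    using k by (simp_all add: sigma_inv_wt)
  define h where "h = cst (1/2)"
  have h: "2 * h = 1" "sigma_inv k h = h" by (simp_all add: h_def)
  have "sigma_inv k ?c = ?c"
    unfolding sigma_inv_simps(7)[of k ?\<phi>] \<phi> h_def[symmetric]
    unfolding sigma_inv_simps w h(2) using h(1) by (rule casimir_identities(1))
  then show "deg k ?c = 0" by (metis sigma_invariant_iff sigma_sigma_inv)
qed

text \<open>Here s stands for k in S. In M(a, S) \<open>down l S k\<close> divides E_(k-1) and
  \<open>up l S k\<close> divides F_(k-1); the condition records the nontrivial one.\<close>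

definition down_dvd :: "bool \<Rightarrow> nat \<Rightarrow> bool" where
  "down_dvd s k \<longleftrightarrow> (\<exists>p. if s then E (k - 1) = (wt l k + cst (1/2)) * p
     else F (k - 1) = (wt l k - cst (1/2)) * p)"

lemma last_node:
  "\<exists>s a. a \<noteq> 0 \<and> (E l, F l) = EF l (\<lambda>_. a) (if s then {l} else {}) l \<and> down_dvd s l"
proof -
  define w where "w = Hvar (l - 2)"
  have ne: "l - 1 \<noteq> l" "l - 1 \<in> {1..l}" "l \<in> {1..l}" "l - 1 + 1 = l" using l by auto
  have w: "deg (l - 1) w = 0" "deg l w = 0"
    using l by (auto simp: w_def Hvar_def intro!: deg_0_intros)
  obtain c where c: "E l * sigma l (F l) = - (var l * var l) + (var (l - 1) + 1) * var l + c" "deg l c = 0"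
    by (rule casimir_last)
  obtain d where d: "E (l - 1) * sigma (l - 1) (F (l - 1))
      = (wt l (l - 1) - cst (1/2)) * (wt l l + cst (1/2)) + d" "deg (l - 1) d = 0"
    using casimir[of "l - 1"] l ne by auto
  have wt: "wt l (l - 1) = var (l - 1) - w" "wt l l = 2 * var l - var (l - 1)"
    using l by (auto simp: wt_def Hvar_def w_def numeral_2_eq_2)
  define h where "h = cst (1/2)"
  have h: "2 * h = 1" by (simp add: h_def)
  have d': "E (l - 1) * sigma (l - 1) (F (l - 1)) = - (var (l - 1) * var (l - 1))
      + (2 * var l + w + 1) * var (l - 1) + (d - (w + h) * (2 * var l + h))"
    unfolding d(1) wt h_def[symmetric] using h by (rule casimir_identities(2))
  have dd: "deg (l - 1) (d - (w + h) * (2 * var l + h)) = 0"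
    using d(2) w ne by (intro deg_0_intros) (auto simp: h_def deg_0_intros)
  from node_start[OF ne(1) c d' dd w rel_neq[OF ne(3,2) ne(1)[symmetric]] rel_neq[OF ne(2,3,1)]]
  show ?thesis unfolding wt(2)[symmetric]
  proof (elim disjE exE conjE)
    fix a p assume "a \<noteq> 0" "E l = cst a"
      "F l = - cst (inverse a / 4) * (wt l l + cst (3/2)) * (wt l l + cst (1/2))"
      "E (l - 1) = (wt l l + cst (1/2)) * p"
    then show ?thesis
      by (intro exI[of _ True] exI[of _ a]) (auto simp: EF_last[OF l] down_dvd_def)
  next
    fix a p assume "a \<noteq> 0" "F l = cst (inverse a)"
      "E l = - cst (a / 4) * (wt l l - cst (3/2)) * (wt l l - cst (1/2))"
      "F (l - 1) = (wt l l - cst (1/2)) * p"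
    then show ?thesis
      by (intro exI[of _ False] exI[of _ a]) (auto simp: EF_last[OF l] down_dvd_def)
  qed
qed

text \<open>After the known factor is split off, the remaining parts multiply to h_k - 1/2, so one
  of them is constant. Which one decides whether k belongs to S.\<close>

lemma node_step:
  assumes k: "1 \<le> k" "k < l" and dvd: "down_dvd (k + 1 \<in> S) (k + 1)"
  shows "\<exists>s a. a \<noteq> 0
    \<and> E k = cst a * (if s then 1 else wt l k - cst (1/2)) * down l S (k + 1)
    \<and> F k = cst (inverse a) * (if s then wt l k + cst (1/2) else 1) * up l S (k + 1)"
proof -
  obtain c where c: "E k * sigma k (F k) = (wt l k - cst (1/2)) * (wt l (k + 1) + cst (1/2)) + c"
    "deg k c = 0" using casimir[OF k] by blast
  have u1: "uni k (wt l k - cst (1/2)) = [:- Hvar (k - 1) - cst (1/2), cst 1:]"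
    using k by (auto simp: wt_def Hvar_def)
  have u2: "degree (uni k (wt l (k + 1) + cst (1/2))) = 1"
    using k by (cases "k + 1 = l") (auto simp: wt_def Hvar_def numeral_poly)
  have s: "sigma k (wt l (k + 1)) = wt l (k + 1) + 1" "sigma_inv k (wt l k) = wt l k + 1"
    using k by (simp_all add: sigma_wt sigma_inv_wt)
  have half: "1 - cst (1/2) = cst (1/2)" by (simp flip: cst_1 cst_diff)
  \<comment> \<open>The error term c is divisible by h_(k+1) + 1/2, which has degree 1 in H_k, while
    c is free of H_k; so c must vanish.\<close>
  have cofactor: "u = wt l k - cst (1/2)"
    if "(wt l (k + 1) + cst (1/2)) * u = E k * sigma k (F k)" for u
  proof (rule ccontr)
    assume "u \<noteq> wt l k - cst (1/2)"
    then have "u - (wt l k - cst (1/2)) \<noteq> 0" by simp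
    moreover have "wt l (k + 1) + cst (1/2) \<noteq> 0"
      using u2 by (metis degree_0 uni_simps(4) zero_neq_one)
    ultimately have "deg k ((wt l (k + 1) + cst (1/2)) * (u - (wt l k - cst (1/2)))) \<ge> 1"
      using u2 by (subst deg_mult) (auto simp: deg_def)
    moreover have "(wt l (k + 1) + cst (1/2)) * (u - (wt l k - cst (1/2))) = c"
      using that c(1) by (simp add: algebra_simps)
    ultimately show False using c(2) by simp
  qed
  have ii: "cst (inverse a) * (cst a * p) = p" "cst a * (cst (inverse a) * p) = p" if "a \<noteq> 0" for a p
    using that by (simp_all add: mult.assoc[symmetric] flip: cst_mult)
  have inv: "q = cst (inverse a) * r" if "cst a * q = r" "a \<noteq> 0" for a q r
    using ii(1)[OF that(2), of q] that(1) by simp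
  \<comment> \<open>u and v are the parts of E_k and F_k left after removing the factors in
    h_(k+1).\<close>
  have conc: ?thesis if "E k = u * down l S (k + 1)" "F k = v * up l S (k + 1)"
    "u * sigma k v = wt l k - cst (1/2)" for u v
  proof -
    have "uni k (u * sigma k v) = [:- Hvar (k - 1) - cst (1/2), cst 1:]" using that(3) u1 by simp
    then consider a where "u = cst a" "a \<noteq> 0" | a where "sigma k v = cst a" "a \<noteq> 0"
      using linear_factor[of k u "sigma k v" _ 1] by auto
    then show ?thesis
    proof cases
      case 1
      then have "sigma k v = cst (inverse a) * (wt l k - cst (1/2))"
        using that(3) by (intro inv) simp_all
      then have "v = sigma_inv k (cst (inverse a) * (wt l k - cst (1/2)))" by (metis sigma_inv_sigma)
      also have "\<dots> = cst (inverse a) * (wt l k + cst (1/2))" using s half by (simp add: add_diff_eq[symmetric])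
      finally show ?thesis using 1 that by (intro exI[of _ True] exI[of _ a]) simp
    next
      case 2
      then have "v = cst a" by (metis sigma_inv_sigma sigma_inv_simps(1))
      moreover have "u = cst (inverse a) * (wt l k - cst (1/2))"
        using that(3) 2 by (intro inv) (simp_all add: mult.commute)
      ultimately show ?thesis using 2 that by (intro exI[of _ False] exI[of _ "inverse a"]) simp
    qed
  qed
  show ?thesis
  proof (cases "k + 1 \<in> S")
    case True
    then obtain p where p: "E k = (wt l (k + 1) + cst (1/2)) * p" using dvd by (auto simp: down_dvd_def)
    have "p * sigma k (F k) = wt l k - cst (1/2)"
      by (rule cofactor) (simp add: p mult.assoc)
    then show ?thesis using p True by (intro conc[of p "F k"]) (auto simp: up_def down_def mult.commute)
  next
    case False
    then obtain p where p: "F k = (wt l (k + 1) - cst (1/2)) * p" using dvd by (auto simp: down_dvd_def)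
    have "sigma k (F k) = (wt l (k + 1) + (1 - cst (1/2))) * sigma k p"
      unfolding p sigma_simps s by (simp add: algebra_simps)
    then have "E k * sigma k p = wt l k - cst (1/2)"
      unfolding half by (intro cofactor) (simp only: mult_ac)
    then show ?thesis using p False by (intro conc[of "E k" p]) (auto simp: up_def down_def mult.commute)
  qed
qed

text \<open>The factor of F_k or E_k in h_k is shifted by 1 in the relation with node k - 1, whereas
  the factor in h_(k+1) is not affected and cancels.\<close>

lemma dvd_step:
  assumes k: "2 \<le> k" "k < l" and a: "a \<noteq> 0"
    and E: "E k = cst a * up l S k * down l S (k + 1)"
    and F: "F k = cst (inverse a) * down l S k * up l S (k + 1)"
  shows "down_dvd (k \<in> S) k"
proof -
  define j m where "j = k - 1" and "m = k + 1"
  then have j: "j \<in> {1..l}" "k \<in> {1..l}" "j \<noteq> k" "j + 1 = k" "m \<in> {1..l}" "m \<noteq> j" "m \<noteq> j + 1" "j < l" "k < m"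
    using k by auto
  note E = E[folded m_def] and F = F[folded m_def]
  have s: "sigma j (wt l k) = wt l k + 1" "sigma_inv j (wt l k) = wt l k - 1"
    "sigma j (wt l m) = wt l m" "sigma_inv j (wt l m) = wt l m"
    using j by (auto simp: sigma_wt sigma_inv_wt)
  have inv: "sigma j (up l S m) = up l S m" "sigma_inv j (down l S m) = down l S m"
    using s by (auto simp: up_def down_def)
  have nz: "up l S m \<noteq> 0" "down l S m \<noteq> 0"
  proof -
    have "uni m (wt l m + cst e) \<noteq> 0" for e
      using j(9) by (auto simp: wt_def Hvar_def numeral_poly)
    then have "wt l m + cst e \<noteq> 0" for e by (metis uni_simps(4))
    from this[of "1/2"] this[of "- 1/2"] show "up l S m \<noteq> 0" "down l S m \<noteq> 0"
      by (auto simp: up_def down_def cst_minus)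
  qed
  show ?thesis
  proof (cases "k \<in> S")
    case True
    let ?g = "cst (inverse a) * up l S m"
    have "F k = (wt l k + cst (1/2)) * ?g" using F True by (simp add: down_def mult_ac)
    then have "E j * ((wt l k + 1 + cst (1/2)) * ?g) = (wt l k + cst (1/2)) * ?g * sigma_inv k (E j)"
      using rel_neq[OF j(1,2,3)] by (simp add: s inv)
    then have "?g * (E j * (wt l k + 1 + cst (1/2))) = ?g * ((wt l k + cst (1/2)) * sigma_inv k (E j))"
      by (simp only: mult_ac)
    then have "E j * (wt l k + 1 + cst (1/2)) = (wt l k + cst (1/2)) * sigma_inv k (E j)"
      using nz a by simp
    \<comment> \<open>Subtract E_j times the right-hand factor: the two linear factors differ by 1,
      so E_j itself remains on the left.\<close>
    then have "E j = (wt l k + cst (1/2)) * (sigma_inv k (E j) - E j)"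
      by (simp add: algebra_simps)
    then show ?thesis using True unfolding down_dvd_def j_def by auto
  next
    case False
    let ?g = "cst a * down l S m"
    have "E k = (wt l k - cst (1/2)) * ?g" using E False by (simp add: up_def mult_ac)
    then have "(wt l k - cst (1/2)) * ?g * sigma k (F j) = F j * ((wt l k - 1 - cst (1/2)) * ?g)"
      using rel_neq[OF j(2,1) j(3)[symmetric]] by (simp add: s inv)
    then have "?g * ((wt l k - cst (1/2)) * sigma k (F j)) = ?g * (F j * (wt l k - 1 - cst (1/2)))"
      by (simp only: mult_ac)
    then have "(wt l k - cst (1/2)) * sigma k (F j) = F j * (wt l k - 1 - cst (1/2))"
      using nz a by simp
    then have "F j = (wt l k - cst (1/2)) * (F j - sigma k (F j))"
      by (simp add: algebra_simps)
    then show ?thesis using False unfolding down_dvd_def j_def by auto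
  qed
qed

lemma EF_cong:
  assumes "k \<in> {1..l}" "a k = a' k" "k \<in> S \<longleftrightarrow> k \<in> S'" "k < l \<Longrightarrow> k + 1 \<in> S \<longleftrightarrow> k + 1 \<in> S'"
  shows "EF l a S k = EF l a' S' k"
proof (cases "k = l")
  case True
  then show ?thesis using assms by (simp add: EF_last[OF l])
next
  case False
  then have "k < l" using assms by simp
  then show ?thesis using assms by (simp add: EF_less up_def down_def)
qed

text \<open>Induction from node l downwards. The divisibility at the lowest treated node is carried
  along as the input for the next one.\<close>

lemma classification: "\<exists>a S. is_param l a S \<and> (\<forall>k\<in>{1..l}. (E k, F k) = EF l a S k)"
proof -
  have "\<exists>a S. S \<subseteq> {1..l} \<and> (\<forall>k\<in>{l-n..l}. a k \<noteq> 0 \<and> (E k, F k) = EF l a S k)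
      \<and> (2 \<le> l - n \<longrightarrow> down_dvd (l - n \<in> S) (l - n))" if "n < l" for n
    using that
  proof (induction n)
    case 0
    obtain s a where sa: "a \<noteq> 0" "(E l, F l) = EF l (\<lambda>_. a) (if s then {l} else {}) l" "down_dvd s l"
      using last_node by blast
    define S where "S = (if s then {l} else {})"
    have S: "S \<subseteq> {1..l}" "l \<in> S \<longleftrightarrow> s" using l by (auto simp: S_def)
    have "l - 0 = l" "{l - 0..l} = {l}" by auto
    then show ?case using sa(1,3) sa(2)[folded S_def] S
      by (intro exI[of _ "\<lambda>_. a"] exI[of _ S]) simp
  next
    case (Suc n)
    then obtain a S where S: "S \<subseteq> {1..l}"
      and EF: "\<And>k. k \<in> {l-n..l} \<Longrightarrow> a k \<noteq> 0 \<and> (E k, F k) = EF l a S k"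
      and dvd: "2 \<le> l - n \<longrightarrow> down_dvd (l - n \<in> S) (l - n)"
      using Suc_lessD by metis
    define k where "k = l - Suc n"
    have k: "1 \<le> k" "k < l" "l - n = k + 1" using Suc.prems by (auto simp: k_def)
    obtain s b where b: "b \<noteq> 0"
      "E k = cst b * (if s then 1 else wt l k - cst (1/2)) * down l S (k + 1)"
      "F k = cst (inverse b) * (if s then wt l k + cst (1/2) else 1) * up l S (k + 1)"
      using node_step[of k S] dvd k by auto
    \<comment> \<open>Changing index k is harmless: the formulas at nodes above k read
      \<open>a\<close> and S only at larger indices.\<close>
    define S' where "S' = (if s then insert k S else S - {k})"
    define a' where "a' = a(k := b)"
    have ud: "down l S' (k + 1) = down l S (k + 1)" "up l S' (k + 1) = up l S (k + 1)"
      "up l S' k = (if s then 1 else wt l k - cst (1/2))" "down l S' k = (if s then wt l k + cst (1/2) else 1)"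
      by (auto simp: up_def down_def S'_def)
    have "S' \<subseteq> {1..l}" using S k by (auto simp: S'_def)
    moreover have "a' i \<noteq> 0 \<and> (E i, F i) = EF l a' S' i" if i: "i \<in> {k..l}" for i
    proof (cases "i = k")
      case True
      have "EF l a' S' k = (E k, F k)"
        using EF_less[of k l a' S'] k(1,2) unfolding ud b(2,3) by (simp add: a'_def)
      then show ?thesis using True b(1) by (simp add: a'_def)
    next
      case False
      then have i': "i \<in> {l-n..l}" using i k by auto
      have "EF l a' S' i = EF l a S i"
        using False i k by (intro EF_cong) (auto simp: a'_def S'_def)
      then show ?thesis using EF[OF i'] False by (simp add: a'_def)
    qed
    moreover have "2 \<le> k \<longrightarrow> down_dvd (k \<in> S') k"
    proof
      assume "2 \<le> k"
      then show "down_dvd (k \<in> S') k"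
        using k(2) b(1) by (rule dvd_step) (unfold ud, rule b(2), rule b(3))
    qed
    ultimately show ?case unfolding k_def by blast
  qed
  from this[of "l - 1"] l obtain a S where "S \<subseteq> {1..l}" "\<forall>k\<in>{1..l}. a k \<noteq> 0 \<and> (E k, F k) = EF l a S k"
    by auto
  then show ?thesis unfolding is_param_def by blast
qed

end

section \<open>The relations in an arbitrary object of the category\<close>

lemma sp_diag_eq_combination:
  assumes "\<And>j. j < l \<Longrightarrow> d j = c * d1 j + c' * d2 j"
  shows "sp_diag l d = c \<cdot>\<^sub>m sp_diag l d1 + c' \<cdot>\<^sub>m sp_diag l d2"
  using assms by (intro eq_matI) (auto simp: sp_diag_def algebra_simps)

lemma sp_diag_in_sp: "sp_diag l d \<in> sp l"
  unfolding sp_iff by (auto simp: sp_diag_def)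

locale twisted_module = sp_mod l poly_scale "polys l" \<rho> for l \<rho> +
  assumes l2: "2 \<le> l"
    and coweight: "i \<in> {1..l} \<Longrightarrow> g \<in> polys l \<Longrightarrow> \<rho> (coweight l i) g = var i * g"
begin

lemma sp_diag_action:
  assumes "\<And>j. j < l \<Longrightarrow> d j = c * d1 j + c' * d2 j" "g \<in> polys l"
    and "\<rho> (sp_diag l d1) g = p * g" "\<rho> (sp_diag l d2) g = q * g"
  shows "\<rho> (sp_diag l d) g = (cst c * p + cst c' * q) * g"
proof -
  have "\<rho> (sp_diag l d) g = \<rho> (c \<cdot>\<^sub>m sp_diag l d1 + c' \<cdot>\<^sub>m sp_diag l d2) g"
    using sp_diag_eq_combination[of l d c d1 c' d2] assms(1) by simp
  also have "\<dots> = poly_scale c (\<rho> (sp_diag l d1) g) + poly_scale c' (\<rho> (sp_diag l d2) g)"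
    using assms(2) by (simp add: module_simps(6,7) sp_diag_in_sp sp_smult)
  finally show ?thesis unfolding assms(3,4) by (simp add: poly_scale_def algebra_simps)
qed

lemma Hvar_action:
  assumes "i < l" "g \<in> polys l"
  shows "\<rho> (sp_diag l (\<lambda>j. of_bool (j < i))) g = Hvar i * g"
proof (cases "i = 0")
  case True
  have "sp_diag l (\<lambda>j. of_bool (j < 0)) = 0\<^sub>m (2*l) (2*l)"
    by (intro eq_matI) (auto simp: sp_diag_def)
  then show ?thesis using True assms action_zero_mat by (simp add: Hvar_def)
next
  case False
  then have "coweight l i = sp_diag l (\<lambda>j. of_bool (j < i))" using assms by (simp add: coweight_def)
  then show ?thesis using coweight[of i g] assms False by (simp add: Hvar_def)
qed

text \<open>The k-th diagonal coordinate is a difference of neighbouring H, except for k = l, where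
  H_l has entries 1/2 and is doubled first.\<close>

lemma wt_action:
  assumes k: "k \<in> {1..l}" and g: "g \<in> polys l"
  shows "\<rho> (sp_diag l (\<lambda>j. of_bool (Suc j = k))) g = wt l k * g"
proof (cases "k = l")
  case True
  have "\<rho> (sp_diag l (\<lambda>j. 1/2)) g = var l * g"
    using coweight[of l g] k g True by (simp add: coweight_def)
  then have "\<rho> (sp_diag l (\<lambda>j. of_bool (Suc j = k))) g = (cst 2 * var l + cst (- 1) * Hvar (l - 1)) * g"
    using k True by (intro sp_diag_action[OF _ g _ Hvar_action[OF _ g]]) auto
  then show ?thesis using True by (simp add: wt_def cst_minus)
next
  case False
  then have "\<rho> (sp_diag l (\<lambda>j. of_bool (Suc j = k))) g = (cst 1 * Hvar k + cst (- 1) * Hvar (k - 1)) * g"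
    using k by (intro sp_diag_action[OF _ g Hvar_action[OF _ g] Hvar_action[OF _ g]]) auto
  then show ?thesis using False by (simp add: wt_def cst_minus)
qed

lemma coroot_action:
  assumes i: "i \<in> {1..l}" and g: "g \<in> polys l"
  shows "\<rho> (coroot l i) g = (if i = l then wt l l else wt l i - wt l (i + 1)) * g"
proof (cases "i = l")
  case True
  have "coroot l l = sp_diag l (\<lambda>j. of_bool (Suc j = l))"
    by (intro eq_matI) (auto simp: coroot_def sp_diag_def)
  then show ?thesis using wt_action[OF i g] True by simp
next
  case False
  have "\<rho> (coroot l i) g = (cst 1 * wt l i + cst (- 1) * wt l (i + 1)) * g"
    unfolding coroot_def using i False
    by (intro sp_diag_action[OF _ g wt_action[OF _ g] wt_action[OF _ g]]) auto
  then show ?thesis using False by (simp add: cst_minus)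
qed

definition E :: "nat \<Rightarrow> cpoly" where "E i = \<rho> (chev_e l i) 1"
definition F :: "nat \<Rightarrow> cpoly" where "F i = \<rho> (chev_f l i) 1"

lemma EF_in_polys: "i \<in> {1..l} \<Longrightarrow> E i \<in> polys l" "i \<in> {1..l} \<Longrightarrow> F i \<in> polys l"
  by (simp_all add: E_def F_def module_simps(3) generators_in_sp)

text \<open>An operator that commutes with the variables up to the twist \<theta> is determined by
  its value at 1.\<close>

lemma twisted_linear:
  assumes x: "x \<in> sp l" and twist: "\<And>j g. j \<in> {1..l} \<Longrightarrow> g \<in> polys l \<Longrightarrow> \<rho> x (var j * g) = \<theta> (var j) * \<rho> x g"
    and \<theta>: "\<And>c. \<theta> (cst c) = cst c" "\<And>p q. \<theta> (p + q) = \<theta> p + \<theta> q" "\<And>p q. \<theta> (p * q) = \<theta> p * \<theta> q"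
    and g: "g \<in> polys l"
  shows "\<rho> x g = \<rho> x 1 * \<theta> g"
  using g
proof (induction g rule: polys_induct)
  case (cst c)
  show ?case using module_simps(5)[OF x polys_one, of c] by (simp add: poly_scale_def \<theta> mult.commute)
next
  case (add p q)
  then show ?case by (simp add: module_simps(4)[OF x] \<theta> distrib_left)
next
  case (var i p)
  have "\<rho> x (var i * p) = \<theta> (var i) * (\<rho> x 1 * \<theta> p)"
    unfolding twist[OF var.hyps] var.IH ..
  then show ?case by (simp add: \<theta> mult.left_commute)
qed

text \<open>The bracket of H_j with e_i says that e_i is linear up to
  \<open>sigma i\<close>.\<close>

lemma e_action:
  assumes i: "i \<in> {1..l}" and g: "g \<in> polys l"
  shows "\<rho> (chev_e l i) g = E i * sigma i g"
proof -
  have "\<rho> (chev_e l i) (var j * g) = sigma i (var j) * \<rho> (chev_e l i) g"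
    if j: "j \<in> {1..l}" and g: "g \<in> polys l" for j g
  proof -
    let ?x = "\<rho> (chev_e l i) g"
    note sp = generators_in_sp(4)[OF j] generators_in_sp(1)[OF i]
    have x: "?x \<in> polys l" using sp g by (simp add: module_simps(3))
    have "\<rho> (of_bool (j = i) \<cdot>\<^sub>m chev_e l i) g = var j * ?x - \<rho> (chev_e l i) (var j * g)"
      using module_simps(8)[OF sp g] coweight[OF j] g x coweight_bracket_e[OF j i] by simp
    then have "of_bool (j = i) * ?x = var j * ?x - \<rho> (chev_e l i) (var j * g)"
      using module_simps(7)[OF sp(2) g, of "of_bool (j = i)"] by (auto simp: poly_scale_def)
    then show ?thesis by (auto simp: algebra_simps)
  qed
  then show ?thesis unfolding E_def using generators_in_sp(1)[OF i] g by (intro twisted_linear) auto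
qed

lemma f_action:
  assumes i: "i \<in> {1..l}" and g: "g \<in> polys l"
  shows "\<rho> (chev_f l i) g = F i * sigma_inv i g"
proof -
  have "\<rho> (chev_f l i) (var j * g) = sigma_inv i (var j) * \<rho> (chev_f l i) g"
    if j: "j \<in> {1..l}" and g: "g \<in> polys l" for j g
  proof -
    let ?x = "\<rho> (chev_f l i) g"
    note sp = generators_in_sp(4)[OF j] generators_in_sp(2)[OF i]
    have x: "?x \<in> polys l" using sp g by (simp add: module_simps(3))
    have "\<rho> ((- of_bool (j = i)) \<cdot>\<^sub>m chev_f l i) g = var j * ?x - \<rho> (chev_f l i) (var j * g)"
      using module_simps(8)[OF sp g] coweight[OF j] g x coweight_bracket_f[OF j i] by simp
    then have "- of_bool (j = i) * ?x = var j * ?x - \<rho> (chev_f l i) (var j * g)"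
      using module_simps(7)[OF sp(2) g, of "- of_bool (j = i)"]
      by (auto simp: poly_scale_def cst_minus split: if_splits)
    then show ?thesis by (auto simp: algebra_simps)
  qed
  then show ?thesis unfolding F_def using generators_in_sp(2)[OF i] g by (intro twisted_linear) auto
qed

sublocale free_rank1 l E F
proof
  fix i j assume i: "i \<in> {1..l}" and j: "j \<in> {1..l}"
  have "\<rho> (lie_bracket (chev_e l i) (chev_f l j)) 1 = E i * sigma i (F j) - F j * sigma_inv j (E i)"
    unfolding module_simps(8)[OF generators_in_sp(1)[OF i] generators_in_sp(2)[OF j] polys_one]
    using i j EF_in_polys by (simp add: e_action f_action)
  moreover have "\<rho> (lie_bracket (chev_e l i) (chev_f l j)) 1
      = (if i = j then if i = l then wt l l else wt l i - wt l (i + 1) else 0)"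
    unfolding chev_e_bracket_f[OF i j] using coroot_action[OF i polys_one] action_zero_mat[OF polys_one]
    by (cases "i = j") (simp_all only: simp_thms if_True if_False mult_1_right)
  ultimately show "E i * sigma i (F j) - F j * sigma_inv j (E i)
      = (if i = j then if i = l then wt l l else wt l i - wt l (i + 1) else 0)" by simp
qed (rule l2)

lemma ex_is_M: "\<exists>a S. is_param l a S \<and> is_M l a S \<rho>"
proof -
  obtain a S where "is_param l a S" and EF: "\<And>k. k \<in> {1..l} \<Longrightarrow> (E k, F k) = EF l a S k"
    using classification by blast
  moreover have "is_M l a S \<rho>"
    unfolding is_M_def
    using sp_mod coweight e_action f_action by (auto simp: EF[symmetric] inv_into_sigma Hvar_def)
  ultimately show ?thesis by blast
qed

end

section \<open>Existence, uniqueness, classification and simplicity combined\<close>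

theorem proposition18:
  fixes l :: nat
  assumes "2 \<le> l"
  shows "(\<forall>a S. is_param l a S \<longrightarrow>
            (\<exists>\<rho>. is_M l a S \<rho>) \<and>
            (\<forall>\<rho> \<rho>'. is_M l a S \<rho> \<longrightarrow> is_M l a S \<rho>' \<longrightarrow>
               (\<forall>x \<in> sp l. \<forall>g \<in> polys l. \<rho> x g = \<rho>' x g)))
       \<and> (\<forall>a S \<rho>. is_param l a S \<longrightarrow> is_M l a S \<rho> \<longrightarrow> in_H l poly_scale (polys l) \<rho>)
       \<and> (\<forall>(scale :: complex \<Rightarrow> 'v :: ab_group_add \<Rightarrow> 'v) V \<rho>. in_H l scale V \<rho> \<longrightarrow>
            (\<exists>a S \<rho>'. is_param l a S \<and> is_M l a S \<rho>' \<and>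
               sp_module_iso l scale V \<rho> poly_scale (polys l) \<rho>'))
       \<and> (\<forall>a S \<rho>. is_param l a S \<longrightarrow> is_M l a S \<rho> \<longrightarrow> sp_simple l poly_scale (polys l) \<rho>)"
proof (intro conjI allI impI ballI)
  fix a S assume "is_param l a S"
  then obtain b where "oscillator l b" "\<And>k. k \<in> {1..<l} \<Longrightarrow> a k = b k * inverse (b (k + 1))"
    "a l = (if l \<in> S then - (b l)\<^sup>2 / 2 else 2 * (b l)\<^sup>2)"
    using oscillator_params[OF assms] by blast
  then show "\<exists>\<rho>. is_M l a S \<rho>"
    using oscillator.quad_is_M[OF _ assms] by blast
next
  fix a S \<rho> \<rho>' x g
  assume "is_M l a S \<rho>" "is_M l a S \<rho>'" "x \<in> sp l" "g \<in> polys l"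
  then show "\<rho> x g = \<rho>' x g" by (rule is_M_unique[rotated]) (use assms in simp)
next
  fix a S \<rho> assume "is_M l a S \<rho>"
  then show "in_H l poly_scale (polys l) \<rho>" by (rule is_M_in_H)
next
  fix scale :: "complex \<Rightarrow> 'v \<Rightarrow> 'v" and V \<rho>
  assume "in_H l scale V \<rho>"
  then obtain \<rho>' where \<rho>': "sp_module l poly_scale (polys l) \<rho>'"
    "sp_module_iso l scale V \<rho> poly_scale (polys l) \<rho>'"
    "\<And>i g. i \<in> {1..l} \<Longrightarrow> g \<in> polys l \<Longrightarrow> \<rho>' (coweight l i) g = var i * g"
    by (rule in_H_polys) blast
  interpret twisted_module l \<rho>' by unfold_locales (use \<rho>' assms in auto)
  show "\<exists>a S \<rho>'. is_param l a S \<and> is_M l a S \<rho>' \<and> sp_module_iso l scale V \<rho> poly_scale (polys l) \<rho>'"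
    using ex_is_M \<rho>'(2) by blast
next
  fix a S \<rho> assume "is_param l a S" "is_M l a S \<rho>"
  then show "sp_simple l poly_scale (polys l) \<rho>" by (rule is_M_simple[OF assms])
qed

end
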